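(* Let $C_n^{1/4}$ denote the Gegenbauer polynomial of degree $n$ and parameter $1/4$. Define \[ \mathfrak h_n=\frac{\pi\sqrt2\,\Gamma(n+\tfrac12)}{\Gamma(n+1)\,(n+\tfrac14)\,\Gamma(\tfrac14)^2},\qquad \Phi_n(\varphi)=\mathfrak h_n^{-1/2}C_n^{1/4}(\cos\varphi),\qquad n\ge0 . \] Then $\{\Phi_n\}_{n\ge0}$ is an orthonormal basis of $\mathcal H$, and $A_0\Phi_n=2n(2n+1)\Phi_n$ for every $n\ge0$. Consequently, if \[ T=\left(A_0+\frac14I\right)^{1/2}-\frac12I, \] then $T\Phi_n=2n\,\Phi_n$ for every $n\ge0$.
   Context: Let $\omega(\varphi)=(\sin\varphi)^{1/2}$ and $\mathcal H=L^2((0,\pi),\omega(\varphi)\,d\varphi)$. Let $\mathfrak a_0[f,g]=4\int_0^\pi\omega f'\,\overline{g'}\,d\varphi$ with form domain $\mathcal V=\{f\in\mathcal H: f\in H^1_{\mathrm{loc}}(0,\pi),\ \int_0^\pi\omega|f'|^2\,d\varphi<\infty\}$. This form is closed and nonnegative, and $A_0$ is the associated self-adjoint operator on $\mathcal H$, acting as $A_0f=-4\omega^{-1}(\omega f')'=-4\left(f''+\tfrac12\cot\varphi\,f'\right)$ (natural endpoint condition: vanishing weighted flux $\omega f'$ at $0$ and $\pi$). *)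

theory Defs
  imports "HOL-Analysis.Analysis" "HOL-Computational_Algebra.Polynomial"
begin

section \<open>Complex inner product spaces\<close>

class complex_vector = real_vector +
  fixes scaleC :: "complex \<Rightarrow> 'a \<Rightarrow> 'a"  (infixr \<open>*\<^sub>C\<close> 75)
  assumes scaleC_add_right: "a *\<^sub>C (x + y) = a *\<^sub>C x + a *\<^sub>C y"
    and scaleC_add_left: "(a + b) *\<^sub>C x = a *\<^sub>C x + b *\<^sub>C x"
    and scaleC_scaleC: "a *\<^sub>C b *\<^sub>C x = (a * b) *\<^sub>C x"
    and scaleC_one: "1 *\<^sub>C x = x"
    and scaleR_scaleC: "r *\<^sub>R x = complex_of_real r *\<^sub>C x"

global_interpretation complex_vector: vector_space "scaleC :: complex \<Rightarrow> 'a \<Rightarrow> 'a::complex_vector"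
  defines cspan = complex_vector.span
    and csubspace = complex_vector.subspace
  by unfold_locales (simp_all add: scaleC_add_right scaleC_add_left scaleC_scaleC scaleC_one)

text \<open>The inner product is linear in the first and conjugate-linear in the second argument. The
  norm and the topology are those of the underlying real inner product space.\<close>

class complex_inner = complex_vector + real_inner +
  fixes cinner :: "'a \<Rightarrow> 'a \<Rightarrow> complex"
  assumes cinner_commute: "cinner x y = cnj (cinner y x)"
    and cinner_add_left: "cinner (x + y) z = cinner x z + cinner y z"
    and cinner_scaleC_left: "cinner (a *\<^sub>C x) y = a * cinner x y"
    and inner_eq_Re_cinner: "inner x y = Re (cinner x y)"

definition orthonormal_basis :: "(nat \<Rightarrow> 'a::complex_inner) \<Rightarrow> bool" where
  "orthonormal_basis e \<longleftrightarrow>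
     (\<forall>m n. cinner (e m) (e n) = (if m = n then 1 else 0)) \<and>
     closure (cspan (range e)) = UNIV"


section \<open>Unbounded operators\<close>

text \<open>An unbounded operator is represented by its graph, so that \<^term>\<open>Domain A\<close> is its domain,
  \<^term>\<open>A O B\<close> is the composition applying first \<^term>\<open>A\<close> and then \<^term>\<open>B\<close>, on its natural
  domain, and \<^term>\<open>A `` {f} = {g}\<close> says that \<^term>\<open>f\<close> belongs to the domain and
  that \<^term>\<open>g\<close> is the value there.\<close>

definition linear_operator :: "('a::complex_inner) rel \<Rightarrow> bool" where
  "linear_operator A \<longleftrightarrow>
     single_valued A \<and> (0, 0) \<in> A \<and>
     (\<forall>f g f' g'. (f, g) \<in> A \<longrightarrow> (f', g') \<in> A \<longrightarrow> (f + f', g + g') \<in> A) \<and>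
     (\<forall>c f g. (f, g) \<in> A \<longrightarrow> (c *\<^sub>C f, c *\<^sub>C g) \<in> A)"

definition adjoint_operator :: "('a::complex_inner) rel \<Rightarrow> 'a rel" where
  "adjoint_operator A = {(h, k). \<forall>(f, g) \<in> A. cinner g h = cinner f k}"

definition selfadjoint_operator :: "('a::complex_inner) rel \<Rightarrow> bool" where
  "selfadjoint_operator A \<longleftrightarrow>
     linear_operator A \<and> closure (Domain A) = UNIV \<and> adjoint_operator A = A"

definition nonnegative_operator :: "('a::complex_inner) rel \<Rightarrow> bool" where
  "nonnegative_operator A \<longleftrightarrow> (\<forall>(f, g) \<in> A. Im (cinner g f) = 0 \<and> 0 \<le> Re (cinner g f))"

text \<open>\<open>A + c I\<close>\<close>

definition add_scalar_operator :: "('a::complex_inner) rel \<Rightarrow> complex \<Rightarrow> 'a rel" where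
  "add_scalar_operator A c = {(f, g + c *\<^sub>C f) | f g. (f, g) \<in> A}"

text \<open>The square root of a nonnegative self-adjoint operator: its unique nonnegative self-adjoint
  square root.\<close>

definition sqrt_operator :: "('a::complex_inner) rel \<Rightarrow> 'a rel" where
  "sqrt_operator A =
     (THE B. selfadjoint_operator B \<and> nonnegative_operator B \<and> B O B = A)"


section \<open>The weighted Hilbert space\<close>

definition omega :: "real \<Rightarrow> real" where
  "omega \<phi> = sqrt (sin \<phi>)"

definition omega_measure :: "real measure" where
  "omega_measure = density (restrict_space lborel {0<..<pi}) (\<lambda>\<phi>. ennreal (omega \<phi>))"

definition square_integrable :: "(real \<Rightarrow> complex) \<Rightarrow> bool" where
  "square_integrable u \<longleftrightarrow>
     u \<in> borel_measurable omega_measure \<and> integrable omega_measure (\<lambda>\<phi>. (cmod (u \<phi>))\<^sup>2)"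

lemma square_integrable_zero: "square_integrable (\<lambda>_. 0)"
  by (simp add: square_integrable_def)

lemma square_integrable_scale: "square_integrable u \<Longrightarrow> square_integrable (\<lambda>\<phi>. c * u \<phi>)"
  by (auto simp: square_integrable_def norm_mult power_mult_distrib)

lemma square_integrable_mult_cnj:
  assumes "square_integrable u" "square_integrable v"
  shows "integrable omega_measure (\<lambda>\<phi>. u \<phi> * cnj (v \<phi>))"
proof (rule Bochner_Integration.integrable_bound)
  show "integrable omega_measure (\<lambda>\<phi>. (cmod (u \<phi>))\<^sup>2 + (cmod (v \<phi>))\<^sup>2)"
    using assms by (auto simp: square_integrable_def)
  show "(\<lambda>\<phi>. u \<phi> * cnj (v \<phi>)) \<in> borel_measurable omega_measure"
    using assms by (auto simp: square_integrable_def intro!: borel_measurable_times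
        measurable_compose[OF _ borel_measurable_continuous_onI[OF continuous_on_cnj]])
  have "norm (u \<phi> * cnj (v \<phi>)) \<le> norm ((cmod (u \<phi>))\<^sup>2 + (cmod (v \<phi>))\<^sup>2)" for \<phi>
  proof -
    have "2 * (cmod (u \<phi>) * cmod (v \<phi>)) \<le> (cmod (u \<phi>))\<^sup>2 + (cmod (v \<phi>))\<^sup>2"
      using sum_squares_bound[of "cmod (u \<phi>)" "cmod (v \<phi>)"] by (simp add: mult.assoc)
    moreover have "0 \<le> cmod (u \<phi>) * cmod (v \<phi>)" by simp
    ultimately have "cmod (u \<phi>) * cmod (v \<phi>) \<le> (cmod (u \<phi>))\<^sup>2 + (cmod (v \<phi>))\<^sup>2" by linarith
    then show ?thesis by (simp add: norm_mult)
  qed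
  then show "AE \<phi> in omega_measure. norm (u \<phi> * cnj (v \<phi>)) \<le> norm ((cmod (u \<phi>))\<^sup>2 + (cmod (v \<phi>))\<^sup>2)"
    by simp
qed

lemma square_integrable_add:
  assumes "square_integrable u" "square_integrable v"
  shows "square_integrable (\<lambda>\<phi>. u \<phi> + v \<phi>)"
proof -
  have m: "(\<lambda>\<phi>. u \<phi> + v \<phi>) \<in> borel_measurable omega_measure"
    using assms by (auto simp: square_integrable_def)
  have "integrable omega_measure (\<lambda>\<phi>. (cmod (u \<phi> + v \<phi>))\<^sup>2)"
  proof (rule Bochner_Integration.integrable_bound)
    show "integrable omega_measure (\<lambda>\<phi>. 2 * (cmod (u \<phi>))\<^sup>2 + 2 * (cmod (v \<phi>))\<^sup>2)"
      using assms by (auto simp: square_integrable_def)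
    show "(\<lambda>\<phi>. (cmod (u \<phi> + v \<phi>))\<^sup>2) \<in> borel_measurable omega_measure"
      using m by measurable
    have "norm ((cmod (u \<phi> + v \<phi>))\<^sup>2) \<le> norm (2 * (cmod (u \<phi>))\<^sup>2 + 2 * (cmod (v \<phi>))\<^sup>2)" for \<phi>
    proof -
      have "(cmod (u \<phi> + v \<phi>))\<^sup>2 \<le> (cmod (u \<phi>) + cmod (v \<phi>))\<^sup>2"
        by (intro power_mono norm_triangle_ineq) auto
      also have "\<dots> \<le> 2 * (cmod (u \<phi>))\<^sup>2 + 2 * (cmod (v \<phi>))\<^sup>2"
        using sum_squares_bound[of "cmod (u \<phi>)" "cmod (v \<phi>)"] by (simp add: power2_sum)
      finally show ?thesis by simp
    qed
    then show "AE \<phi> in omega_measure.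
        norm ((cmod (u \<phi> + v \<phi>))\<^sup>2) \<le> norm (2 * (cmod (u \<phi>))\<^sup>2 + 2 * (cmod (v \<phi>))\<^sup>2)"
      by simp
  qed
  with m show ?thesis by (simp add: square_integrable_def)
qed

definition L2_rel :: "(real \<Rightarrow> complex) \<Rightarrow> (real \<Rightarrow> complex) \<Rightarrow> bool" where
  "L2_rel u v \<longleftrightarrow>
     square_integrable u \<and> square_integrable v \<and> (AE \<phi> in omega_measure. u \<phi> = v \<phi>)"

lemma part_equivp_L2_rel: "part_equivp L2_rel"
proof (rule part_equivpI)
  show "\<exists>u. L2_rel u u"
    using square_integrable_zero by (auto simp: L2_rel_def)
  show "symp L2_rel"
    by (auto simp: symp_def L2_rel_def elim: eventually_mono)
  show "transp L2_rel"
    by (auto simp: transp_def L2_rel_def elim: eventually_elim2)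
qed

quotient_type weighted_L2 = "real \<Rightarrow> complex" / partial: L2_rel
  morphisms representative L2_class
  by (rule part_equivp_L2_rel)

lemma cinner_respects:
  assumes "L2_rel u u'" "L2_rel v v'"
  shows "(\<integral>\<phi>. u \<phi> * cnj (v \<phi>) \<partial>omega_measure) = (\<integral>\<phi>. u' \<phi> * cnj (v' \<phi>) \<partial>omega_measure)"
proof (rule integral_cong_AE)
  show "AE \<phi> in omega_measure. u \<phi> * cnj (v \<phi>) = u' \<phi> * cnj (v' \<phi>)"
    using assms by (auto simp: L2_rel_def elim: eventually_elim2)
qed (use assms in \<open>auto simp: L2_rel_def intro!: borel_measurable_integrable square_integrable_mult_cnj\<close>)

instantiation weighted_L2 :: complex_inner
begin

lift_definition zero_weighted_L2 :: weighted_L2 is "\<lambda>_. 0"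
  by (simp add: L2_rel_def square_integrable_zero)

lift_definition plus_weighted_L2 :: "weighted_L2 \<Rightarrow> weighted_L2 \<Rightarrow> weighted_L2"
  is "\<lambda>u v \<phi>. u \<phi> + v \<phi>"
  by (auto simp: L2_rel_def intro: square_integrable_add elim: eventually_elim2)

lift_definition scaleC_weighted_L2 :: "complex \<Rightarrow> weighted_L2 \<Rightarrow> weighted_L2"
  is "\<lambda>c u \<phi>. c * u \<phi>"
  by (auto simp: L2_rel_def intro: square_integrable_scale elim: eventually_mono)

definition uminus_weighted_L2 :: "weighted_L2 \<Rightarrow> weighted_L2" where
  "- f = (-1) *\<^sub>C f" for f :: weighted_L2

definition minus_weighted_L2 :: "weighted_L2 \<Rightarrow> weighted_L2 \<Rightarrow> weighted_L2" where
  "f - g = f + (- g)" for f g :: weighted_L2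

definition scaleR_weighted_L2 :: "real \<Rightarrow> weighted_L2 \<Rightarrow> weighted_L2" where
  "r *\<^sub>R f = complex_of_real r *\<^sub>C f" for f :: weighted_L2

lift_definition cinner_weighted_L2 :: "weighted_L2 \<Rightarrow> weighted_L2 \<Rightarrow> complex"
  is "\<lambda>u v. \<integral>\<phi>. u \<phi> * cnj (v \<phi>) \<partial>omega_measure"
  by (rule cinner_respects)

definition inner_weighted_L2 :: "weighted_L2 \<Rightarrow> weighted_L2 \<Rightarrow> real" where
  "inner f g = Re (cinner f g)" for f g :: weighted_L2

definition norm_weighted_L2 :: "weighted_L2 \<Rightarrow> real" where
  "norm f = sqrt (inner f f)" for f :: weighted_L2

definition dist_weighted_L2 :: "weighted_L2 \<Rightarrow> weighted_L2 \<Rightarrow> real" where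
  "dist f g = norm (f - g)" for f g :: weighted_L2

definition sgn_weighted_L2 :: "weighted_L2 \<Rightarrow> weighted_L2" where
  "sgn f = inverse (norm f) *\<^sub>R f" for f :: weighted_L2

definition uniformity_weighted_L2 :: "(weighted_L2 \<times> weighted_L2) filter" where
  "uniformity_weighted_L2 = (INF e\<in>{0<..}. principal {(f, g). dist f g < e})"

definition open_weighted_L2 :: "weighted_L2 set \<Rightarrow> bool" where
  "open_weighted_L2 U \<longleftrightarrow> (\<forall>f\<in>U. \<forall>\<^sub>F (f', g) in uniformity. f' = f \<longrightarrow> g \<in> U)"

instance
proof
  fix f g h :: weighted_L2 and a b :: complex and r s :: real
  show add_assoc: "f + g + h = f + (g + h)"
    by transfer (auto simp: L2_rel_def add.assoc intro!: square_integrable_add)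
  show add_commute: "f + g = g + f"
    by transfer (auto simp: L2_rel_def add.commute intro!: square_integrable_add)
  show "0 + f = f"
    by transfer (auto simp: L2_rel_def)
  show "- f + f = 0"
    unfolding uminus_weighted_L2_def
    by transfer (auto simp: L2_rel_def square_integrable_zero)
  show "f - g = f + - g"
    by (rule minus_weighted_L2_def)
  have sC_right: "a *\<^sub>C (f + g) = a *\<^sub>C f + a *\<^sub>C g" for a and f g :: weighted_L2
    by transfer (auto simp: L2_rel_def distrib_left
        intro!: square_integrable_add square_integrable_scale)
  have sC_left: "(a + b) *\<^sub>C f = a *\<^sub>C f + b *\<^sub>C f" for a b and f :: weighted_L2
    by transfer (auto simp: L2_rel_def distrib_right
        intro!: square_integrable_add square_integrable_scale)
  have sC_sC: "a *\<^sub>C b *\<^sub>C f = (a * b) *\<^sub>C f" for a b and f :: weighted_L2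
    by transfer (auto simp: L2_rel_def mult.assoc intro!: square_integrable_scale)
  have sC_one: "1 *\<^sub>C f = f" for f :: weighted_L2
    by transfer (auto simp: L2_rel_def)
  show "a *\<^sub>C (f + g) = a *\<^sub>C f + a *\<^sub>C g" by (rule sC_right)
  show "(a + b) *\<^sub>C f = a *\<^sub>C f + b *\<^sub>C f" by (rule sC_left)
  show "a *\<^sub>C b *\<^sub>C f = (a * b) *\<^sub>C f" by (rule sC_sC)
  show "1 *\<^sub>C f = f" by (rule sC_one)
  show "r *\<^sub>R f = complex_of_real r *\<^sub>C f"
    by (rule scaleR_weighted_L2_def)
  show "r *\<^sub>R (f + g) = r *\<^sub>R f + r *\<^sub>R g"
    by (simp add: scaleR_weighted_L2_def sC_right)
  show "(r + s) *\<^sub>R f = r *\<^sub>R f + s *\<^sub>R f"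
    by (simp add: scaleR_weighted_L2_def sC_left)
  show "r *\<^sub>R s *\<^sub>R f = (r * s) *\<^sub>R f"
    by (simp add: scaleR_weighted_L2_def sC_sC)
  show "1 *\<^sub>R f = f"
    by (simp add: scaleR_weighted_L2_def sC_one)
  show "sgn f = inverse (norm f) *\<^sub>R f"
    by (rule sgn_weighted_L2_def)
  show "dist f g = norm (f - g)"
    by (rule dist_weighted_L2_def)
  show "uniformity = (INF e\<in>{0<..}. principal {(f, g :: weighted_L2). dist f g < e})"
    by (rule uniformity_weighted_L2_def)
  show "open U \<longleftrightarrow> (\<forall>f\<in>U. \<forall>\<^sub>F (f', g) in uniformity. f' = f \<longrightarrow> g \<in> U)" for U :: "weighted_L2 set"
    by (rule open_weighted_L2_def)
  have commute: "cinner f g = cnj (cinner g f)" for f g :: weighted_L2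
    by transfer (subst Bochner_Integration.integral_cnj[symmetric], simp add: mult.commute)
  have add_left: "cinner (f + g) h = cinner f h + cinner g h" for f g h :: weighted_L2
    by transfer (auto simp: L2_rel_def distrib_right square_integrable_mult_cnj)
  have scale_left: "cinner (a *\<^sub>C f) g = a * cinner f g" for a and f g :: weighted_L2
    by transfer (simp add: mult.assoc)
  show "cinner f g = cnj (cinner g f)" by (rule commute)
  show "cinner (f + g) h = cinner f h + cinner g h" by (rule add_left)
  show "cinner (a *\<^sub>C f) g = a * cinner f g" by (rule scale_left)
  show "inner f g = Re (cinner f g)" by (rule inner_weighted_L2_def)
  show "inner f g = inner g f"
    unfolding inner_weighted_L2_def by (subst commute) simp
  show "inner (f + g) h = inner f h + inner g h"
    by (simp add: inner_weighted_L2_def add_left)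
  show "inner (r *\<^sub>R f) g = r * inner f g"
    by (simp add: inner_weighted_L2_def scaleR_weighted_L2_def scale_left)
  have cinner_self: "Re (\<integral>\<phi>. u \<phi> * cnj (u \<phi>) \<partial>omega_measure) = (\<integral>\<phi>. (cmod (u \<phi>))\<^sup>2 \<partial>omega_measure)"
    for u :: "real \<Rightarrow> complex"
    by (simp flip: complex_norm_square of_real_power)
  show "0 \<le> inner f f"
    unfolding inner_weighted_L2_def by transfer (simp add: cinner_self)
  show "inner f f = 0 \<longleftrightarrow> f = 0"
    unfolding inner_weighted_L2_def
  proof (transfer, unfold cinner_self)
    fix u assume "L2_rel u u"
    then have sq: "square_integrable u" by (simp add: L2_rel_def)
    then have "(\<integral>\<phi>. (cmod (u \<phi>))\<^sup>2 \<partial>omega_measure) = 0 \<longleftrightarrow> (AE \<phi> in omega_measure. (cmod (u \<phi>))\<^sup>2 = 0)"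
      by (intro integral_nonneg_eq_0_iff_AE) (auto simp: square_integrable_def)
    then show "(\<integral>\<phi>. (cmod (u \<phi>))\<^sup>2 \<partial>omega_measure) = 0 \<longleftrightarrow> L2_rel u (\<lambda>_. 0)"
      using sq square_integrable_zero by (simp add: L2_rel_def)
  qed
  show "norm f = sqrt (inner f f)"
    by (rule norm_weighted_L2_def)
qed

end


section \<open>The form and its operator\<close>

definition test_function :: "real set \<Rightarrow> (real \<Rightarrow> real) \<Rightarrow> bool" where
  "test_function S \<psi> \<longleftrightarrow>
     (\<forall>k x. (deriv ^^ k) \<psi> field_differentiable (at x)) \<and>
     compact (closure {x. \<psi> x \<noteq> 0}) \<and> closure {x. \<psi> x \<noteq> 0} \<subseteq> S"

definition L2_loc :: "real set \<Rightarrow> (real \<Rightarrow> complex) \<Rightarrow> bool" where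
  "L2_loc S u \<longleftrightarrow>
     set_borel_measurable lborel S u \<and>
     (\<forall>K. compact K \<longrightarrow> K \<subseteq> S \<longrightarrow> set_integrable lborel K (\<lambda>x. (cmod (u x))\<^sup>2))"

definition has_weak_derivative :: "real set \<Rightarrow> (real \<Rightarrow> complex) \<Rightarrow> (real \<Rightarrow> complex) \<Rightarrow> bool" where
  "has_weak_derivative S u v \<longleftrightarrow>
     (\<forall>\<psi>. test_function S \<psi> \<longrightarrow>
        (LBINT x:S. u x * complex_of_real (deriv \<psi> x)) =
        - (LBINT x:S. v x * complex_of_real (\<psi> x)))"

definition H1_loc :: "real set \<Rightarrow> (real \<Rightarrow> complex) \<Rightarrow> bool" where
  "H1_loc S u \<longleftrightarrow> L2_loc S u \<and> (\<exists>v. L2_loc S v \<and> has_weak_derivative S u v)"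

text \<open>A choice of weak derivative on \<open>(0, \<pi>)\<close>. On \<open>H\<^sup>1\<^sub>l\<^sub>o\<^sub>c\<close> it is determined up to null sets, also
  with respect to the choice of the representative of the class.\<close>

definition weak_derivative :: "weighted_L2 \<Rightarrow> real \<Rightarrow> complex" where
  "weak_derivative f =
     (SOME v. L2_loc {0<..<pi} v \<and> has_weak_derivative {0<..<pi} (representative f) v)"

definition form_domain :: "weighted_L2 set" where
  "form_domain =
     {f. H1_loc {0<..<pi} (representative f) \<and>
         set_integrable lborel {0<..<pi} (\<lambda>\<phi>. omega \<phi> * (cmod (weak_derivative f \<phi>))\<^sup>2)}"

definition form_a0 :: "weighted_L2 \<Rightarrow> weighted_L2 \<Rightarrow> complex" where
  "form_a0 f g =
     4 * (LBINT \<phi>:{0<..<pi}.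
            complex_of_real (omega \<phi>) * weak_derivative f \<phi> * cnj (weak_derivative g \<phi>))"

text \<open>The operator associated with the form, as in the first representation theorem.\<close>

definition A0 :: "weighted_L2 rel" where
  "A0 = {(f, g). f \<in> form_domain \<and> (\<forall>h\<in>form_domain. form_a0 f h = cinner g h)}"

definition T_op :: "weighted_L2 rel" where
  "T_op = add_scalar_operator (sqrt_operator (add_scalar_operator A0 (1/4))) (- (1/2))"


section \<open>Gegenbauer polynomials\<close>

text \<open>The three-term recurrence
  \<open>m C\<^sub>m(x) = 2 x (m + \<nu> - 1) C\<^sub>m\<^sub>-\<^sub>1(x) - (m + 2 \<nu> - 2) C\<^sub>m\<^sub>-\<^sub>2(x)\<close>, with \<open>m = n + 2\<close>.\<close>

fun gegenbauer :: "real \<Rightarrow> nat \<Rightarrow> real poly" where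
  "gegenbauer \<nu> 0 = 1"
| "gegenbauer \<nu> (Suc 0) = [:0, 2 * \<nu>:]"
| "gegenbauer \<nu> (Suc (Suc n)) =
     smult (1 / (real n + 2))
       (smult (2 * (real n + 1 + \<nu>)) ([:0, 1:] * gegenbauer \<nu> (Suc n))
        - smult (real n + 2 * \<nu>) (gegenbauer \<nu> n))"

definition h_const :: "nat \<Rightarrow> real" where
  "h_const n =
     pi * sqrt 2 * Gamma (real n + 1/2) /
     (Gamma (real n + 1) * (real n + 1/4) * (Gamma (1/4))\<^sup>2)"

definition Phi :: "nat \<Rightarrow> weighted_L2" where
  "Phi n =
     L2_class (\<lambda>\<phi>. complex_of_real
       (h_const n powr (- (1/2)) * poly (gegenbauer (1/4) n) (cos \<phi>)))"

end

theory Submission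
  imports Defs
begin

text \<open>
  In the variable \<open>t = cos \<phi>\<close> the operator \<open>A\<^sub>0\<close> is minus four times the Gegenbauer operator with
  parameter \<open>1/4\<close>, so the Gegenbauer differential equation (\<open>gegenbauer_ode\<close>) makes \<open>C\<^sub>n(cos \<phi>)\<close> a
  formal eigenfunction with eigenvalue \<open>4 n (n + 1/2) = 2 n (2 n + 1)\<close>. The natural boundary
  condition holds because the flux \<open>omega u'\<close> of a polynomial \<open>u\<close> in the cosine is of the order of
  \<open>omega sin\<close> at the ends of the interval. The rigorous form of both remarks is
  \<open>flux_integration_by_parts\<close>, which evaluates the form at such a \<open>u\<close> and an arbitrary element of
  the form domain. It is obtained by applying the definition of the weak derivative to the flux
  times a smooth cutoff and removing the cutoff by dominated convergence.

  Polynomials in the cosine are dense (\<open>cos_poly_dense\<close>), and the Gegenbauer polynomials span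
  them. They are orthogonal because the form is symmetric and the eigenvalues are distinct. Their
  norms satisfy the two-term recursion that comes from the three-term recurrence, and the initial
  value is a Beta integral (\<open>measure_omega\<close>). This gives the orthonormal basis.

  To evaluate the square root one needs all of \<open>A\<^sub>0\<close> and not only its values at the basis vectors.
  It is the maximal diagonal operator with the given eigenvalues (\<open>A0_eq_diagonal\<close>). The
  nontrivial inclusion uses that the weak derivative is closed and that the weighted space is
  complete. Density also yields the uniqueness of weak derivatives (\<open>weak_derivative_unique\<close>),
  which makes the chosen derivative in the definition of the form computable.

  Finally, a diagonal operator with eigenvalues \<open>\<mu>\<^sub>n\<^sup>2\<close>, where \<open>\<mu>\<^sub>n > 0\<close>, has the diagonal
  operator with eigenvalues \<open>\<mu>\<^sub>n\<close> as its only nonnegative self-adjoint square root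
  (\<open>sqrt_diagonal\<close>). Uniqueness is elementary: for a square root \<open>B\<close> the vector \<open>B e\<^sub>n - \<mu>\<^sub>n e\<^sub>n\<close>
  would be an eigenvector with the negative eigenvalue \<open>- \<mu>\<^sub>n\<close>, so it is zero. With \<open>2 n (2 n + 1)
  + 1/4 = (2 n + 1/2)\<^sup>2\<close> this yields the eigenvalues \<open>2 n\<close> of \<open>T\<close>.
\<close>

section \<open>Inner products and orthonormal bases\<close>

lemma cinner_zero_left [simp]: "cinner 0 (y::'a::complex_inner) = 0"
  using cinner_add_left[of 0 0 y] by simp

lemma cinner_zero_right [simp]: "cinner (x::'a::complex_inner) 0 = 0"
  by (subst cinner_commute) simp

lemma cinner_add_right: "cinner (x::'a::complex_inner) (y + z) = cinner x y + cinner x z"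
  by (metis cinner_add_left cinner_commute complex_cnj_add)

lemma cinner_scaleC_right: "cinner (x::'a::complex_inner) (a *\<^sub>C y) = cnj a * cinner x y"
  by (metis cinner_commute cinner_scaleC_left complex_cnj_mult)

lemma scaleC_minus_one: "(-1) *\<^sub>C (x::'a::complex_vector) = - x"
  using scaleR_scaleC[of "-1" x] by simp

lemma cinner_minus_left: "cinner (- x::'a::complex_inner) y = - cinner x y"
  using cinner_scaleC_left[of "-1" x y] by (simp add: scaleC_minus_one)

lemma cinner_diff_left: "cinner (x - y::'a::complex_inner) z = cinner x z - cinner y z"
  using cinner_add_left[of x "- y" z] by (simp add: cinner_minus_left)

lemma cinner_sum_left: "cinner (\<Sum>i\<in>I. (x i::'a::complex_inner)) y = (\<Sum>i\<in>I. cinner (x i) y)"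
  by (induction I rule: infinite_finite_induct) (auto simp: cinner_add_left)

lemma cinner_sum_right: "cinner (y::'a::complex_inner) (\<Sum>i\<in>I. x i) = (\<Sum>i\<in>I. cinner y (x i))"
  by (induction I rule: infinite_finite_induct) (auto simp: cinner_add_right)

lemma cinner_self: "cinner (x::'a::complex_inner) x = complex_of_real ((norm x)\<^sup>2)"
proof (rule complex_eqI)
  show "Re (cinner x x) = Re (complex_of_real ((norm x)\<^sup>2))"
    by (simp add: power2_norm_eq_inner inner_eq_Re_cinner)
  show "Im (cinner x x) = Im (complex_of_real ((norm x)\<^sup>2))"
    using arg_cong[OF cinner_commute[of x x], of Im] by simp
qed

lemma mult_cnj_eq_norm_square: "z * cnj z = complex_of_real ((cmod z)\<^sup>2)" for z
  by (simp only: complex_norm_square)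

lemma norm_scaleC: "norm (a *\<^sub>C (x::'a::complex_inner)) = cmod a * norm x"
proof -
  have "complex_of_real ((norm (a *\<^sub>C x))\<^sup>2) = (a * cnj a) * cinner x x"
    unfolding cinner_self[symmetric]
    by (simp only: cinner_scaleC_left cinner_scaleC_right mult_ac)
  also have "\<dots> = complex_of_real ((cmod a * norm x)\<^sup>2)"
    by (simp only: mult_cnj_eq_norm_square cinner_self power_mult_distrib of_real_mult)
  finally have "complex_of_real ((norm (a *\<^sub>C x))\<^sup>2) = complex_of_real ((cmod a * norm x)\<^sup>2)" .
  then have "(norm (a *\<^sub>C x))\<^sup>2 = (cmod a * norm x)\<^sup>2"
    using of_real_eq_iff by blast
  then show ?thesis
    by (rule power2_eq_imp_eq) simp_all
qed

text \<open>Multiplying \<open>x\<close> by a phase makes the complex inner product real and nonnegative, which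
  reduces the claim to the Cauchy--Schwarz inequality of the underlying real space.\<close>

lemma norm_cinner_le: "cmod (cinner (x::'a::complex_inner) y) \<le> norm x * norm y"
proof -
  define a where "a = cnj (sgn (cinner x y))"
  have a: "cmod a \<le> 1"
    by (simp add: a_def norm_sgn)
  have "a * cinner x y = complex_of_real (cmod (cinner x y))"
    by (cases "cinner x y = 0")
      (auto simp: a_def sgn_eq divide_simps mult.commute[of "cnj _"]
        simp flip: complex_norm_square power2_eq_square of_real_mult)
  then have "cmod (cinner x y) = inner (a *\<^sub>C x) y"
    by (simp add: inner_eq_Re_cinner cinner_scaleC_left)
  also have "\<dots> \<le> norm (a *\<^sub>C x) * norm y"
    by (rule norm_cauchy_schwarz)
  also have "\<dots> \<le> norm x * norm y"
    using a by (intro mult_right_mono) (auto simp: norm_scaleC mult_left_le_one_le)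
  finally show ?thesis .
qed

lemma bounded_bilinear_cinner: "bounded_bilinear (cinner :: 'a::complex_inner \<Rightarrow> 'a \<Rightarrow> complex)"
proof
  show "\<exists>K. \<forall>a b::'a. norm (cinner a b) \<le> norm a * norm b * K"
    using norm_cinner_le by (intro exI[of _ 1]) auto
qed (auto simp: cinner_add_left cinner_add_right scaleR_scaleC cinner_scaleC_left
        cinner_scaleC_right scaleR_conv_of_real)

lemmas tendsto_cinner = bounded_bilinear.tendsto[OF bounded_bilinear_cinner]

lemma cspan_cinner_zero:
  assumes "y \<in> cspan S" "\<And>s. s \<in> S \<Longrightarrow> cinner x s = 0"
  shows "cinner (x::'a::complex_inner) y = 0"
  using assms(1)
  by (induction rule: complex_vector.span_induct_alt)
     (auto simp: cinner_add_right cinner_scaleC_right assms(2))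

lemma csubspace_closure:
  assumes "csubspace (V :: 'a::complex_inner set)"
  shows "csubspace (closure V)"
  unfolding complex_vector.subspace_def
proof (intro conjI ballI allI)
  show "0 \<in> closure V"
    using complex_vector.subspace_0[OF assms] closure_subset by blast
next
  fix x y assume "x \<in> closure V" "y \<in> closure V"
  then obtain s t where "\<And>n. s n \<in> V" "s \<longlonglongrightarrow> x" "\<And>n. t n \<in> V" "t \<longlonglongrightarrow> y"
    unfolding closure_sequential by blast
  then show "x + y \<in> closure V"
    unfolding closure_sequential using assms
    by (intro exI[of _ "\<lambda>n. s n + t n"] conjI allI tendsto_add complex_vector.subspace_add)
next
  fix c x assume "x \<in> closure V"
  then obtain s where s: "\<And>n. s n \<in> V" "s \<longlonglongrightarrow> x"
    unfolding closure_sequential by blast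
  have "(\<lambda>n. c *\<^sub>C s n) \<longlonglongrightarrow> c *\<^sub>C x"
  proof (rule LIM_zero_cancel, rule tendsto_norm_zero_cancel)
    have "(\<lambda>n. cmod c * norm (s n - x)) \<longlonglongrightarrow> cmod c * norm (x - x)"
      by (intro tendsto_intros s)
    then show "(\<lambda>n. norm (c *\<^sub>C s n - c *\<^sub>C x)) \<longlonglongrightarrow> 0"
      by (simp add: norm_scaleC flip: complex_vector.scale_right_diff_distrib)
  qed
  then show "c *\<^sub>C x \<in> closure V"
    unfolding closure_sequential using s assms
    by (intro exI[of _ "\<lambda>n. c *\<^sub>C s n"] conjI allI complex_vector.subspace_scale)
qed

text \<open>Such an \<open>x\<close> is a limit of vectors to which it is orthogonal, hence orthogonal to itself.\<close>

lemma orthogonal_to_dense_imp_zero: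
  fixes x :: "'a::complex_inner"
  assumes "closure (cspan S) = UNIV" "\<And>s. s \<in> S \<Longrightarrow> cinner x s = 0"
  shows "x = 0"
proof -
  have "x \<in> closure (cspan S)"
    using assms(1) by simp
  then obtain t where t: "\<And>n. t n \<in> cspan S" "t \<longlonglongrightarrow> x"
    unfolding closure_sequential by blast
  have "(\<lambda>n. cinner x (t n)) \<longlonglongrightarrow> cinner x x"
    by (intro tendsto_cinner t tendsto_const)
  moreover have "cinner x (t n) = 0" for n
    using cspan_cinner_zero[OF t(1) assms(2)] by blast
  ultimately have "cinner x x = 0"
    by (simp add: LIMSEQ_const_iff)
  then show ?thesis by (simp add: cinner_self)
qed

definition fourier_sum :: "(nat \<Rightarrow> 'a::complex_inner) \<Rightarrow> 'a \<Rightarrow> nat \<Rightarrow> 'a" where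
  "fourier_sum e f N = (\<Sum>n<N. cinner f (e n) *\<^sub>C e n)"

context
  fixes e :: "nat \<Rightarrow> 'a::complex_inner"
  assumes basis: "orthonormal_basis e"
begin

lemma cinner_basis: "cinner (e m) (e n) = (if m = n then 1 else 0)"
  using basis by (simp add: orthonormal_basis_def)

lemma cinner_sum_basis:
  "cinner (\<Sum>n<N. c n *\<^sub>C e n) (e m) = (if m < N then c m else 0)"
proof -
  have "cinner (\<Sum>n<N. c n *\<^sub>C e n) (e m) = (\<Sum>n<N. if n = m then c m else 0)"
    by (simp add: cinner_sum_left cinner_scaleC_left cinner_basis if_distrib cong: if_cong)
  also have "\<dots> = (if m < N then c m else 0)"
    by simp
  finally show ?thesis .
qed

lemma norm_sum_basis: "(norm (\<Sum>n\<in>I. c n *\<^sub>C e n))\<^sup>2 = (\<Sum>n\<in>I. (cmod (c n))\<^sup>2)"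
  if "finite I"
proof -
  have "cinner (\<Sum>n\<in>I. c n *\<^sub>C e n) (\<Sum>n\<in>I. c n *\<^sub>C e n) = (\<Sum>n\<in>I. c n * cnj (c n))"
    using that
    by (simp add: cinner_sum_left cinner_scaleC_left cinner_sum_right cinner_scaleC_right
        cinner_basis if_distrib sum.delta mult.commute cong: if_cong)
  then have "complex_of_real ((norm (\<Sum>n\<in>I. c n *\<^sub>C e n))\<^sup>2) =
      complex_of_real (\<Sum>n\<in>I. (cmod (c n))\<^sup>2)"
    by (simp add: cinner_self mult_cnj_eq_norm_square)
  then show ?thesis
    by (simp only: of_real_eq_iff)
qed

text \<open>Bessel's inequality: since \<open>\<langle>f, P f\<rangle> = \<parallel>P f\<parallel>\<^sup>2\<close> for the partial sum \<open>P f\<close>, it is an instance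
  of Cauchy--Schwarz.\<close>

lemma norm_fourier_sum_le: "norm (fourier_sum e f N) \<le> norm f"
proof -
  let ?P = "fourier_sum e f N"
  have "cinner f ?P = (\<Sum>n<N. cinner f (e n) * cnj (cinner f (e n)))"
    by (simp add: fourier_sum_def cinner_sum_right cinner_scaleC_right mult.commute)
  also have "\<dots> = complex_of_real ((norm ?P)\<^sup>2)"
    unfolding fourier_sum_def norm_sum_basis[OF finite_lessThan]
    by (simp add: mult_cnj_eq_norm_square)
  finally have "cinner f ?P = complex_of_real ((norm ?P)\<^sup>2)" .
  then have "(norm ?P)\<^sup>2 = cmod (cinner f ?P)"
    by (simp add: norm_power)
  also have "\<dots> \<le> norm f * norm ?P"
    by (rule norm_cinner_le)
  finally show ?thesis
    by (cases "norm ?P = 0") (auto simp: power2_eq_square)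
qed

text \<open>On the span the partial sums are eventually constant. By Bessel's inequality they are
  contractions uniformly in \<open>N\<close>, so the convergence passes to the closure of the span.\<close>

lemma fourier_sum_tendsto: "fourier_sum e f \<longlonglongrightarrow> f"
proof -
  have span: "fourier_sum e y \<longlonglongrightarrow> y" if "y \<in> cspan (range e)" for y
    using that
  proof (induction rule: complex_vector.span_induct_alt)
    case base
    show ?case by (simp add: fourier_sum_def)
  next
    case (step c x y)
    then obtain m where x: "x = e m" by auto
    have "fourier_sum e (c *\<^sub>C x + y) N = c *\<^sub>C x + fourier_sum e y N" if "N > m" for N
    proof -
      have "cinner (c *\<^sub>C x + y) (e n) *\<^sub>C e n =
          (if n = m then c *\<^sub>C e m else 0) + cinner y (e n) *\<^sub>C e n" for n
        by (simp add: x cinner_add_left cinner_scaleC_left cinner_basis scaleC_add_left)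
      then have "fourier_sum e (c *\<^sub>C x + y) N =
          (\<Sum>n<N. if n = m then c *\<^sub>C e m else 0) + fourier_sum e y N"
        by (simp add: fourier_sum_def sum.distrib)
      then show ?thesis using that by (simp add: x)
    qed
    then have "eventually (\<lambda>N. c *\<^sub>C x + fourier_sum e y N
        = fourier_sum e (c *\<^sub>C x + y) N) sequentially"
      by (intro eventually_mono[OF eventually_gt_at_top[of m]]) simp
    with tendsto_add[OF tendsto_const step.IH] show ?case
      by (rule Lim_transform_eventually)
  qed
  show ?thesis
  proof (rule metric_LIMSEQ_I)
    fix r :: real assume "r > 0"
    moreover have "f \<in> closure (cspan (range e))"
      using basis by (simp add: orthonormal_basis_def)
    ultimately obtain y where y: "y \<in> cspan (range e)" "dist y f < r / 3"
      unfolding closure_approachable by (meson divide_pos_pos zero_less_numeral)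
    obtain N0 where N0: "\<And>N. N \<ge> N0 \<Longrightarrow> dist (fourier_sum e y N) y < r / 3"
      using metric_LIMSEQ_D[OF span[OF y(1)], of "r / 3"] \<open>r > 0\<close> by auto
    have "dist (fourier_sum e f N) f < r" if "N \<ge> N0" for N
    proof -
      have "fourier_sum e f N - f =
          fourier_sum e (f - y) N + (fourier_sum e y N - y) + (y - f)"
        by (simp add: fourier_sum_def cinner_diff_left complex_vector.scale_left_diff_distrib
            sum_subtractf)
      then have "norm (fourier_sum e f N - f) \<le>
          norm (fourier_sum e (f - y) N) + norm (fourier_sum e y N - y) + norm (y - f)"
        using norm_triangle_ineq norm_triangle_mono order_refl by metis
      moreover have "norm (fourier_sum e (f - y) N) \<le> norm (y - f)"
        using norm_fourier_sum_le[of "f - y" N] by (simp add: norm_minus_commute)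
      ultimately show ?thesis
        using y(2) N0[OF that] by (simp add: dist_norm)
    qed
    then show "\<exists>N0. \<forall>N\<ge>N0. dist (fourier_sum e f N) f < r" by blast
  qed
qed

lemma parseval: "(\<lambda>n. cinner f (e n) * cinner (e n) g) sums cinner f g"
proof -
  have "(\<lambda>N. cinner (fourier_sum e f N) g) \<longlonglongrightarrow> cinner f g"
    by (intro tendsto_cinner fourier_sum_tendsto tendsto_const)
  then show ?thesis
    by (simp add: sums_def fourier_sum_def cinner_sum_left cinner_scaleC_left)
qed

lemma eq_if_coefficients_eq:
  assumes "\<And>n. cinner f (e n) = cinner g (e n)"
  shows "f = g"
proof -
  have "fourier_sum e f = fourier_sum e g"
    by (simp add: fourier_sum_def assms fun_eq_iff)
  then show ?thesis
    using fourier_sum_tendsto LIMSEQ_unique by metis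
qed

lemma summable_coefficients: "summable (\<lambda>n. (cmod (cinner f (e n)))\<^sup>2)"
proof -
  have "cinner f (e n) * cinner (e n) f = complex_of_real ((cmod (cinner f (e n)))\<^sup>2)" for n
    by (subst cinner_commute[of "e n"]) (simp add: mult_cnj_eq_norm_square)
  with parseval[of f f] have "summable (\<lambda>n. complex_of_real ((cmod (cinner f (e n)))\<^sup>2))"
    by (simp add: sums_iff)
  then show ?thesis
    by (rule summable_of_real_iff[THEN iffD1])
qed

end

text \<open>The squared norm of a block of the orthogonal series is the corresponding block of the
  numerical series, so the partial sums form a Cauchy sequence.\<close>

lemma riesz_fischer:
  fixes e :: "nat \<Rightarrow> 'a::{complex_inner, complete_space}"
  assumes basis: "orthonormal_basis e" and c: "summable (\<lambda>n. (cmod (c n))\<^sup>2)"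
  obtains k where "\<And>n. cinner k (e n) = c n"
proof -
  define s where "s N = (\<Sum>n<N. c n *\<^sub>C e n)" for N
  have diff: "dist (s N) (s M) < r"
    if r: "r > 0" and MN: "M \<le> N" and less: "norm (\<Sum>n=M..<N. (cmod (c n))\<^sup>2) < r\<^sup>2" for M N r
  proof -
    have "s N - s M = (\<Sum>n=M..<N. c n *\<^sub>C e n)"
      using MN by (simp add: s_def sum_diff_nat_ivl flip: atLeast0LessThan)
    then have "(norm (s N - s M))\<^sup>2 < r\<^sup>2"
      using less norm_sum_basis[OF basis, of "{M..<N}" c] by simp
    then show ?thesis
      using r by (simp add: dist_norm power_less_imp_less_base)
  qed
  have "Cauchy s"
  proof (rule metric_CauchyI)
    fix r :: real assume "r > 0"
    then obtain K where K: "\<And>m n. m \<ge> K \<Longrightarrow> norm (\<Sum>n=m..<n. (cmod (c n))\<^sup>2) < r\<^sup>2"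
      using c unfolding summable_Cauchy by (meson zero_less_power)
    have "dist (s m) (s n) < r" if "m \<ge> K" "n \<ge> K" for m n
    proof (cases "m \<le> n")
      case True
      then show ?thesis
        using diff[OF \<open>r > 0\<close> True K[OF that(1)]] by (simp add: dist_commute)
    next
      case False
      then show ?thesis
        using diff[OF \<open>r > 0\<close> _ K[OF that(2)]] by simp
    qed
    then show "\<exists>K. \<forall>m\<ge>K. \<forall>n\<ge>K. dist (s m) (s n) < r" by blast
  qed
  then obtain k where k: "s \<longlonglongrightarrow> k"
    using Cauchy_convergent convergent_def by blast
  have "cinner k (e n) = c n" for n
  proof -
    have "(\<lambda>N. cinner (s N) (e n)) \<longlonglongrightarrow> cinner k (e n)"
      by (intro tendsto_cinner k tendsto_const)
    moreover have "(\<lambda>N. cinner (s N) (e n)) \<longlonglongrightarrow> c n"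
      by (rule tendsto_eventually, rule eventually_mono[OF eventually_gt_at_top[of n]])
         (simp add: s_def cinner_sum_basis[OF basis])
    ultimately show ?thesis by (rule LIMSEQ_unique)
  qed
  then show thesis by (rule that)
qed

section \<open>Diagonal operators and their square roots\<close>

text \<open>The domain is implicit and maximal: \<open>f\<close> belongs to it as soon as the numbers \<open>\<mu> n * cinner f
  (e n)\<close> are the coefficients of some vector.\<close>

definition diagonal_operator :: "(nat \<Rightarrow> 'a::complex_inner) \<Rightarrow> (nat \<Rightarrow> real) \<Rightarrow> 'a rel" where
  "diagonal_operator e \<mu> =
     {(f, g). \<forall>n. cinner g (e n) = complex_of_real (\<mu> n) * cinner f (e n)}"

context
  fixes e :: "nat \<Rightarrow> 'a::complex_inner"
  assumes basis: "orthonormal_basis e"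
begin

lemma basis_in_diagonal: "(e n, complex_of_real (\<mu> n) *\<^sub>C e n) \<in> diagonal_operator e \<mu>"
  by (simp add: diagonal_operator_def cinner_scaleC_left cinner_basis[OF basis])

lemma linear_diagonal: "linear_operator (diagonal_operator e \<mu>)"
  unfolding linear_operator_def
proof (intro conjI)
  show "single_valued (diagonal_operator e \<mu>)"
    by (auto simp: single_valued_def diagonal_operator_def intro: eq_if_coefficients_eq[OF basis])
qed (auto simp: diagonal_operator_def cinner_add_left cinner_scaleC_left algebra_simps)

text \<open>Testing the adjoint relation on the basis vectors alone already forces the diagonal relation
  between the coefficients of \<open>h\<close> and \<open>k\<close>; the converse inclusion is Parseval's identity.\<close>

lemma selfadjoint_diagonal: "selfadjoint_operator (diagonal_operator e \<mu>)"
  unfolding selfadjoint_operator_def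
proof (intro conjI)
  let ?D = "diagonal_operator e \<mu>"
  show lin: "linear_operator ?D" by (rule linear_diagonal)
  have "f \<in> Domain ?D" if "f \<in> cspan (range e)" for f
    using that
  proof (induction rule: complex_vector.span_induct_alt)
    case base
    show ?case using lin by (auto simp: linear_operator_def)
  next
    case (step c x y)
    then obtain m g where "x = e m" "(y, g) \<in> ?D" by auto
    then have "(c *\<^sub>C x + y, c *\<^sub>C (complex_of_real (\<mu> m) *\<^sub>C e m) + g) \<in> ?D"
      using lin basis_in_diagonal[of m \<mu>] unfolding linear_operator_def by blast
    then show ?case by blast
  qed
  then show "closure (Domain ?D) = UNIV"
    using closure_mono[of "cspan (range e)" "Domain ?D"] basis
    by (auto simp: orthonormal_basis_def)
  show "adjoint_operator ?D = ?D"
  proof (intro subset_antisym subrelI)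
    fix h k assume "(h, k) \<in> adjoint_operator ?D"
    then have "cinner (complex_of_real (\<mu> n) *\<^sub>C e n) h = cinner (e n) k" for n
      using basis_in_diagonal[of n \<mu>] by (auto simp: adjoint_operator_def)
    then have "cinner k (e n) = complex_of_real (\<mu> n) * cinner h (e n)" for n
      by (metis cinner_commute cinner_scaleC_right cinner_scaleC_left complex_cnj_complex_of_real)
    then show "(h, k) \<in> ?D" by (simp add: diagonal_operator_def)
  next
    fix h k assume hk: "(h, k) \<in> ?D"
    have "cinner g h = cinner f k" if fg: "(f, g) \<in> ?D" for f g
    proof -
      have "cinner (e n) k = complex_of_real (\<mu> n) * cinner (e n) h" for n
        using hk cinner_commute[of "e n"] by (simp add: diagonal_operator_def)
      then have "(\<lambda>n. cinner g (e n) * cinner (e n) h) = (\<lambda>n. cinner f (e n) * cinner (e n) k)"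
        using fg by (auto simp: diagonal_operator_def)
      then show ?thesis
        using parseval[OF basis, of g h] parseval[OF basis, of f k] by (metis sums_unique2)
    qed
    then show "(h, k) \<in> adjoint_operator ?D"
      by (auto simp: adjoint_operator_def)
  qed
qed

lemma nonnegative_diagonal:
  assumes "\<And>n. \<mu> n \<ge> 0"
  shows "nonnegative_operator (diagonal_operator e \<mu>)"
proof -
  have "Im (cinner g f) = 0 \<and> 0 \<le> Re (cinner g f)" if "(f, g) \<in> diagonal_operator e \<mu>" for f g
  proof -
    have "cinner g (e n) * cinner (e n) f =
        complex_of_real (\<mu> n * (cmod (cinner f (e n)))\<^sup>2)" for n
      using that cinner_commute[of "e n" f]
      by (simp add: diagonal_operator_def mult.assoc mult_cnj_eq_norm_square)
    then have sums: "(\<lambda>n. complex_of_real (\<mu> n * (cmod (cinner f (e n)))\<^sup>2)) sums cinner g f"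
      using parseval[OF basis, of g f] by simp
    have "(\<lambda>n. 0) sums Im (cinner g f)"
      using sums_Im[OF sums] by simp
    then have im: "Im (cinner g f) = 0"
      by (rule sums_unique2[OF _ sums_zero])
    have "(\<lambda>n. \<mu> n * (cmod (cinner f (e n)))\<^sup>2) sums Re (cinner g f)"
      using sums_Re[OF sums] by simp
    then have "0 \<le> Re (cinner g f)"
      by (rule sums_le[OF _ sums_zero, rotated]) (simp add: assms)
    with im show ?thesis by blast
  qed
  then show ?thesis by (auto simp: nonnegative_operator_def)
qed

text \<open>Let \<open>k\<close> be the value at \<open>e n\<close> of a square root \<open>B\<close>. Then \<open>w = k - \<mu> n *\<^sub>C e n\<close> satisfies \<open>B
  w = - \<mu> n *\<^sub>C w\<close>, which contradicts nonnegativity of \<open>B\<close> unless \<open>w = 0\<close>. So \<open>B\<close> has the expected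
  eigenvectors. Symmetry of \<open>B\<close> then gives one inclusion, and taking adjoints of it the other,
  since both operators are self-adjoint.\<close>

lemma sqrt_unique_diagonal:
  assumes B: "selfadjoint_operator B" "nonnegative_operator B"
    and BB: "B O B = diagonal_operator e (\<lambda>n. (\<mu> n)\<^sup>2)" and pos: "\<And>n. \<mu> n > 0"
  shows "B = diagonal_operator e \<mu>"
proof -
  have adj: "adjoint_operator B = B" and lin: "linear_operator B"
    using B(1) by (auto simp: selfadjoint_operator_def)
  have eig: "(e n, complex_of_real (\<mu> n) *\<^sub>C e n) \<in> B" for n
  proof -
    let ?m = "complex_of_real (\<mu> n)"
    have "(e n, ?m\<^sup>2 *\<^sub>C e n) \<in> B O B"
      unfolding BB using basis_in_diagonal[of n "\<lambda>n. (\<mu> n)\<^sup>2"] by simp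
    then obtain k where k: "(e n, k) \<in> B" "(k, ?m\<^sup>2 *\<^sub>C e n) \<in> B"
      by blast
    define w where "w = k + (- ?m) *\<^sub>C e n"
    have "(w, ?m\<^sup>2 *\<^sub>C e n + (- ?m) *\<^sub>C k) \<in> B"
      using lin k unfolding linear_operator_def w_def by blast
    moreover have "?m\<^sup>2 *\<^sub>C e n + (- ?m) *\<^sub>C k = (- ?m) *\<^sub>C w"
      unfolding w_def scaleC_add_right scaleC_scaleC
      by (simp add: power2_eq_square)
    ultimately have "(w, (- ?m) *\<^sub>C w) \<in> B" by simp
    then have "0 \<le> Re (cinner ((- ?m) *\<^sub>C w) w)"
      using B(2) by (auto simp: nonnegative_operator_def)
    then have "\<mu> n * (norm w)\<^sup>2 \<le> 0"
      by (simp add: cinner_minus_left cinner_scaleC_left cinner_self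
          flip: of_real_power of_real_mult)
    then have "w = 0"
      using pos[of n] by (simp add: mult_le_0_iff)
    then have "k = ?m *\<^sub>C e n"
      by (simp add: w_def)
    with k(1) show ?thesis by simp
  qed
  have sub: "B \<subseteq> diagonal_operator e \<mu>"
  proof (rule subrelI)
    fix f g assume "(f, g) \<in> B"
    then have "(f, g) \<in> adjoint_operator B" by (simp add: adj)
    then have "cinner (complex_of_real (\<mu> n) *\<^sub>C e n) f = cinner (e n) g" for n
      using eig[of n] by (auto simp: adjoint_operator_def)
    then have "cinner g (e n) = complex_of_real (\<mu> n) * cinner f (e n)" for n
      by (metis cinner_commute cinner_scaleC_right cinner_scaleC_left complex_cnj_complex_of_real)
    then show "(f, g) \<in> diagonal_operator e \<mu>"
      by (simp add: diagonal_operator_def)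
  qed
  have "adjoint_operator (diagonal_operator e \<mu>) \<subseteq> adjoint_operator B"
    using sub by (auto simp: adjoint_operator_def)
  then have "diagonal_operator e \<mu> \<subseteq> B"
    using adj selfadjoint_diagonal[of \<mu>] by (simp add: selfadjoint_operator_def)
  with sub show ?thesis by blast
qed

end

text \<open>For \<open>(f, g)\<close> in the operator on the right, the intermediate vector must have the
  coefficients \<open>\<mu> n * cinner f (e n)\<close>. Their squared moduli are the products of the moduli of the
  coefficients of \<open>f\<close> and \<open>g\<close>, hence summable, and the vector exists by Riesz--Fischer.\<close>

lemma diagonal_relcomp:
  fixes e :: "nat \<Rightarrow> 'a::{complex_inner, complete_space}"
  assumes basis: "orthonormal_basis e"
  shows "diagonal_operator e \<mu> O diagonal_operator e \<mu> = diagonal_operator e (\<lambda>n. (\<mu> n)\<^sup>2)"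
proof (intro subset_antisym subrelI)
  fix f g assume fg: "(f, g) \<in> diagonal_operator e (\<lambda>n. (\<mu> n)\<^sup>2)"
  define c where "c n = complex_of_real (\<mu> n) * cinner f (e n)" for n
  have "summable (\<lambda>n. (cmod (c n))\<^sup>2)"
  proof (rule summable_comparison_test')
    show "summable (\<lambda>n. (cmod (cinner g (e n)))\<^sup>2 + (cmod (cinner f (e n)))\<^sup>2)"
      by (intro summable_add summable_coefficients[OF basis])
    fix n
    have "(cmod (c n))\<^sup>2 = cmod (cinner g (e n)) * cmod (cinner f (e n))"
      using fg by (simp add: c_def diagonal_operator_def norm_mult power2_eq_square norm_power)
    also have "\<dots> \<le> (cmod (cinner g (e n)))\<^sup>2 + (cmod (cinner f (e n)))\<^sup>2"
      using sum_squares_bound[of "cmod (cinner g (e n))" "cmod (cinner f (e n))"]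
        mult_nonneg_nonneg[OF norm_ge_zero norm_ge_zero, of "cinner g (e n)" "cinner f (e n)"]
      by linarith
    finally show "norm ((cmod (c n))\<^sup>2) \<le> (cmod (cinner g (e n)))\<^sup>2 + (cmod (cinner f (e n)))\<^sup>2"
      by simp
  qed
  then obtain k where k: "\<And>n. cinner k (e n) = c n"
    using riesz_fischer[OF basis] by blast
  have "(f, k) \<in> diagonal_operator e \<mu>" "(k, g) \<in> diagonal_operator e \<mu>"
    using fg by (auto simp: diagonal_operator_def k c_def power2_eq_square mult.assoc)
  then show "(f, g) \<in> diagonal_operator e \<mu> O diagonal_operator e \<mu>" by blast
qed (auto simp: diagonal_operator_def power2_eq_square mult.assoc)

lemma sqrt_diagonal:
  fixes e :: "nat \<Rightarrow> 'a::{complex_inner, complete_space}"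
  assumes "orthonormal_basis e" and pos: "\<And>n. \<mu> n > 0"
  shows "sqrt_operator (diagonal_operator e (\<lambda>n. (\<mu> n)\<^sup>2)) = diagonal_operator e \<mu>"
  unfolding sqrt_operator_def
proof (rule the_equality)
  have "nonnegative_operator (diagonal_operator e \<mu>)"
    using pos by (intro nonnegative_diagonal assms(1)) (simp add: less_imp_le)
  then show "selfadjoint_operator (diagonal_operator e \<mu>) \<and>
      nonnegative_operator (diagonal_operator e \<mu>) \<and>
      diagonal_operator e \<mu> O diagonal_operator e \<mu> = diagonal_operator e (\<lambda>n. (\<mu> n)\<^sup>2)"
    using selfadjoint_diagonal[OF assms(1)] diagonal_relcomp[OF assms(1)] by blast
qed (use sqrt_unique_diagonal[OF assms(1)] pos in blast)

lemma add_scalar_diagonal: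
  "add_scalar_operator (diagonal_operator e \<mu>) (complex_of_real c)
      = diagonal_operator e (\<lambda>n. \<mu> n + c)"
proof (intro subset_antisym subrelI)
  fix f g assume "(f, g) \<in> diagonal_operator e (\<lambda>n. \<mu> n + c)"
  then have "(f, g - complex_of_real c *\<^sub>C f) \<in> diagonal_operator e \<mu>"
    by (simp add: diagonal_operator_def cinner_diff_left cinner_scaleC_left distrib_right)
  moreover have "g = (g - complex_of_real c *\<^sub>C f) + complex_of_real c *\<^sub>C f" by simp
  ultimately show "(f, g) \<in> add_scalar_operator (diagonal_operator e \<mu>) (complex_of_real c)"
    unfolding add_scalar_operator_def by blast
qed (auto simp: add_scalar_operator_def diagonal_operator_def cinner_add_left cinner_scaleC_left distrib_right)

lemma diagonal_image_basis:
  assumes "orthonormal_basis e"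
  shows "diagonal_operator e \<mu> `` {e n} = {complex_of_real (\<mu> n) *\<^sub>C e n}"
  using basis_in_diagonal[OF assms, of n \<mu>] linear_diagonal[OF assms, of \<mu>]
  by (auto simp: linear_operator_def dest: single_valuedD)

section \<open>The weighted Hilbert space and its completeness\<close>

lemma omega_pos: "0 < x \<Longrightarrow> x < pi \<Longrightarrow> omega x > 0"
  by (simp add: omega_def sin_gt_zero)

lemma omega_le_one: "omega x \<le> 1"
  by (simp add: omega_def)

lemma omega_measurable [measurable]: "omega \<in> borel_measurable borel"
  unfolding omega_def by measurable

lemma space_omega [simp]: "space omega_measure = {0<..<pi}"
  by (simp add: omega_measure_def space_restrict_space)

lemma sets_omega: "sets omega_measure = sets (restrict_space borel {0<..<pi})"
  by (simp add: omega_measure_def sets_restrict_space)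

lemma borel_measurable_omega [measurable (raw)]:
  "f \<in> borel_measurable borel \<Longrightarrow> f \<in> borel_measurable omega_measure"
  using measurable_restrict_space1[of f borel borel "{0<..<pi}"]
    measurable_cong_sets[OF sets_omega refl, of borel] by blast

lemma borel_measurable_omega_iff:
  fixes f :: "real \<Rightarrow> 'a::real_normed_vector"
  shows "f \<in> borel_measurable omega_measure \<longleftrightarrow>
    (\<lambda>x. indicator {0<..<pi} x *\<^sub>R f x) \<in> borel_measurable borel"
  using measurable_cong_sets[OF sets_omega refl, of "borel :: 'a measure"]
    borel_measurable_restrict_space_iff[of "{0<..<pi}" borel f] by simp

lemma omega_measurable_restrict [measurable]:
  "omega \<in> borel_measurable (restrict_space lborel {0<..<pi})"
  by (rule measurable_restrict_space1) simp

lemma AE_omega: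
  "(AE x in omega_measure. P x) \<longleftrightarrow> (AE x in lborel. 0 < x \<and> x < pi \<longrightarrow> P x)"
proof -
  have "(AE x in omega_measure. P x) \<longleftrightarrow>
      (AE x in restrict_space lborel {0<..<pi}. 0 < ennreal (omega x) \<longrightarrow> P x)"
    unfolding omega_measure_def by (rule AE_density) measurable
  also have "\<dots> \<longleftrightarrow> (AE x in lborel. 0 < x \<and> x < pi \<longrightarrow> P x)"
    by (subst AE_restrict_space_iff) (auto intro!: AE_cong simp: omega_pos)
  finally show ?thesis .
qed

lemma measurable_restrict_lborel:
  "f \<in> borel_measurable omega_measure \<Longrightarrow> f \<in> borel_measurable (restrict_space lborel {0<..<pi})"
  by (simp add: omega_measure_def)

lemma AE_omega_nonneg: "AE x in restrict_space lborel {0<..<pi}. 0 \<le> omega x"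
  by (subst AE_restrict_space_iff) (auto simp: omega_def sin_ge_zero)

lemma integral_omega:
  fixes f :: "real \<Rightarrow> 'b::{banach, second_countable_topology}"
  assumes "f \<in> borel_measurable omega_measure"
  shows "(\<integral>x. f x \<partial>omega_measure) = (LBINT x:{0<..<pi}. omega x *\<^sub>R f x)"
  using measurable_restrict_lborel[OF assms] AE_omega_nonneg
  unfolding omega_measure_def set_lebesgue_integral_def
  by (subst integral_density) (auto simp: integral_restrict_space)

lemma integrable_omega:
  fixes f :: "real \<Rightarrow> 'b::{banach, second_countable_topology}"
  assumes "f \<in> borel_measurable omega_measure"
  shows "integrable omega_measure f \<longleftrightarrow> set_integrable lborel {0<..<pi} (\<lambda>x. omega x *\<^sub>R f x)"
  using measurable_restrict_lborel[OF assms] AE_omega_nonneg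
  unfolding omega_measure_def set_integrable_def
  by (subst integrable_density) (auto simp: integrable_restrict_space)

lemma finite_omega: "finite_measure omega_measure"
proof
  have "emeasure omega_measure (space omega_measure) =
      (\<integral>\<^sup>+x. ennreal (omega x) \<partial>restrict_space lborel {0<..<pi})"
    unfolding omega_measure_def
    by (subst emeasure_density) (auto simp: space_restrict_space sets_restrict_space_iff intro!: nn_integral_cong)
  also have "\<dots> \<le> (\<integral>\<^sup>+x. 1 \<partial>restrict_space lborel {0<..<pi})"
    by (intro nn_integral_mono) (simp add: omega_le_one)
  also have "\<dots> = ennreal pi"
    by (simp add: space_restrict_space emeasure_restrict_space)
  finally show "emeasure omega_measure (space omega_measure) \<noteq> \<infinity>"
    by (auto simp: top_unique)
qed

interpretation omega: finite_measure omega_measure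
  by (rule finite_omega)

lemma square_integrable_bounded:
  assumes "u \<in> borel_measurable omega_measure" "\<And>x. 0 < x \<Longrightarrow> x < pi \<Longrightarrow> cmod (u x) \<le> B"
  shows "square_integrable u"
  unfolding square_integrable_def
proof
  show "integrable omega_measure (\<lambda>x. (cmod (u x))\<^sup>2)"
    using assms by (intro omega.integrable_const_bound[where B = "B\<^sup>2"] AE_I2)
      (auto intro!: power_mono)
qed fact

lemma square_integrable_representative: "square_integrable (representative f)"
  and L2_class_representative: "L2_class (representative f) = f"
  using Quotient3_rep_reflp[OF Quotient3_weighted_L2] Quotient3_abs_rep[OF Quotient3_weighted_L2]
  by (auto simp: L2_rel_def)

lemma L2_class_eq_iff:
  assumes "square_integrable u" "square_integrable v"
  shows "L2_class u = L2_class v \<longleftrightarrow> (AE x in omega_measure. u x = v x)"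
  using Quotient3_rel[OF Quotient3_weighted_L2, of u v] assms by (auto simp: L2_rel_def)

lemma L2_class_cases:
  obtains u where "square_integrable u" "f = L2_class u"
  using square_integrable_representative L2_class_representative by metis

lemma L2_class_add:
  "square_integrable u \<Longrightarrow> square_integrable v \<Longrightarrow>
    L2_class u + L2_class v = L2_class (\<lambda>x. u x + v x)"
  by (rule plus_weighted_L2.abs_eq) (simp_all add: L2_rel_def)

lemma L2_class_scaleC: "square_integrable u \<Longrightarrow> c *\<^sub>C L2_class u = L2_class (\<lambda>x. c * u x)"
  by (rule scaleC_weighted_L2.abs_eq) (simp_all add: L2_rel_def)

lemma L2_class_minus: "square_integrable u \<Longrightarrow> - L2_class u = L2_class (\<lambda>x. - u x)"
  using L2_class_scaleC[of u "-1"] by (simp add: scaleC_minus_one)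

lemma L2_class_diff:
  assumes u: "square_integrable u" and v: "square_integrable v"
  shows "L2_class u - L2_class v = L2_class (\<lambda>x. u x - v x)"
  using L2_class_add[OF u square_integrable_scale[OF v, of "-1"]] L2_class_minus[OF v]
  by (simp add: diff_conv_add_uminus del: add_uminus_conv_diff)

lemma square_integrable_diff:
  "square_integrable u \<Longrightarrow> square_integrable v \<Longrightarrow> square_integrable (\<lambda>x. u x - v x)"
  using square_integrable_add[OF _ square_integrable_scale, of u v "-1"] by simp

lemma cinner_L2_class:
  "square_integrable u \<Longrightarrow> square_integrable v \<Longrightarrow>
    cinner (L2_class u) (L2_class v) = (\<integral>x. u x * cnj (v x) \<partial>omega_measure)"
  by (rule cinner_weighted_L2.abs_eq) (simp_all add: L2_rel_def)

lemma norm_L2_class: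
  assumes "square_integrable u"
  shows "(norm (L2_class u))\<^sup>2 = (\<integral>x. (cmod (u x))\<^sup>2 \<partial>omega_measure)"
proof -
  have "complex_of_real ((norm (L2_class u))\<^sup>2) =
      complex_of_real (\<integral>x. (cmod (u x))\<^sup>2 \<partial>omega_measure)"
    using assms by (simp add: cinner_L2_class mult_cnj_eq_norm_square flip: cinner_self of_real_power)
  then show ?thesis by (simp only: of_real_eq_iff)
qed

text \<open>Dominated convergence in the form in which the approximations below are carried out:
  representatives converging pointwise under a square-integrable majorant converge as classes.\<close>

lemma L2_tendsto_dominated:
  assumes g: "\<And>k. g k \<in> borel_measurable omega_measure" "h \<in> borel_measurable omega_measure"
    and w: "integrable omega_measure (\<lambda>x. (w x)\<^sup>2)"
    and bound: "\<And>k x. 0 < x \<Longrightarrow> x < pi \<Longrightarrow> cmod (g k x) \<le> w x"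
    and lim: "\<And>x. 0 < x \<Longrightarrow> x < pi \<Longrightarrow> (\<lambda>k. g k x) \<longlonglongrightarrow> h x"
  shows "(\<lambda>k. L2_class (g k)) \<longlonglongrightarrow> L2_class h"
proof -
  have sq: "square_integrable u" if "u \<in> borel_measurable omega_measure"
    and "\<And>x. 0 < x \<Longrightarrow> x < pi \<Longrightarrow> cmod (u x) \<le> w x" for u
    unfolding square_integrable_def
  proof
    show "integrable omega_measure (\<lambda>x. (cmod (u x))\<^sup>2)"
      using that
      by (intro Bochner_Integration.integrable_bound[OF w] AE_I2) (auto intro!: power_mono)
  qed fact
  have sqg: "square_integrable (g k)" for k
    using g bound by (intro sq)
  have bound_h: "cmod (h x) \<le> w x" if "0 < x" "x < pi" for x
    using lim[OF that] bound[OF that] by (intro Lim_norm_ubound) auto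
  have sqh: "square_integrable h"
    using g bound_h by (intro sq)
  have "(\<lambda>k. \<integral>x. (cmod (g k x - h x))\<^sup>2 \<partial>omega_measure) \<longlonglongrightarrow> (\<integral>x. 0 \<partial>omega_measure)"
  proof (rule integral_dominated_convergence[where w = "\<lambda>x. 4 * (w x)\<^sup>2"])
    show "AE x in omega_measure. (\<lambda>k. (cmod (g k x - h x))\<^sup>2) \<longlonglongrightarrow> 0"
    proof (rule AE_I2)
      fix x assume "x \<in> space omega_measure"
      then have "(\<lambda>k. (cmod (g k x - h x))\<^sup>2) \<longlonglongrightarrow> (cmod (h x - h x))\<^sup>2"
        by (intro tendsto_intros lim) auto
      then show "(\<lambda>k. (cmod (g k x - h x))\<^sup>2) \<longlonglongrightarrow> 0" by simp
    qed
    fix k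
    show "AE x in omega_measure. norm ((cmod (g k x - h x))\<^sup>2) \<le> 4 * (w x)\<^sup>2"
    proof (rule AE_I2)
      fix x assume "x \<in> space omega_measure"
      then have "cmod (g k x - h x) \<le> 2 * w x"
        using bound[of x k] bound_h[of x] norm_triangle_ineq4[of "g k x" "h x"] by simp
      then have "(cmod (g k x - h x))\<^sup>2 \<le> (2 * w x)\<^sup>2"
        by (intro power_mono) auto
      then show "norm ((cmod (g k x - h x))\<^sup>2) \<le> 4 * (w x)\<^sup>2"
        by (simp add: power_mult_distrib)
    qed
  qed (use g w in auto)
  then have "(\<lambda>k. sqrt ((norm (L2_class (g k) - L2_class h))\<^sup>2)) \<longlonglongrightarrow> sqrt 0"
    by (intro tendsto_real_sqrt)
       (simp add: L2_class_diff sqg sqh norm_L2_class square_integrable_diff)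
  then have "(\<lambda>k. norm (L2_class (g k) - L2_class h)) \<longlonglongrightarrow> 0"
    by simp
  then show ?thesis
    using Lim_null tendsto_norm_zero_iff by blast
qed

lemma nn_integral_square_le:
  assumes "square_integrable u" "norm (L2_class u) \<le> r"
  shows "(\<integral>\<^sup>+x. ennreal ((cmod (u x))\<^sup>2) \<partial>omega_measure) \<le> ennreal (r\<^sup>2)"
proof -
  have "(\<integral>\<^sup>+x. ennreal ((cmod (u x))\<^sup>2) \<partial>omega_measure) = ennreal ((norm (L2_class u))\<^sup>2)"
    using assms(1) by (simp add: norm_L2_class nn_integral_eq_integral square_integrable_def)
  then show ?thesis
    using assms(2) by (simp add: ennreal_leI power_mono)
qed

text \<open>A subsequence with distances below \<open>(1/2)\<^sup>k\<close> has increments summable in \<open>L\<^sup>1\<close>, because the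
  measure is finite; so its representatives converge almost everywhere, and Fatou's lemma shows
  that the pointwise limit is the limit in norm.\<close>

instance weighted_L2 :: complete_space
proof
  fix X :: "nat \<Rightarrow> weighted_L2" assume X: "Cauchy X"
  have "\<exists>N. \<forall>m\<ge>N. \<forall>n\<ge>N. dist (X m) (X n) < (1/2)^k" for k
    using metric_CauchyD[OF X, of "(1/2)^k"] by simp
  then obtain N where N: "\<And>k m n. m \<ge> N k \<Longrightarrow> n \<ge> N k \<Longrightarrow> dist (X m) (X n) < (1/2)^k"
    by metis
  \<comment> \<open>Summing the thresholds makes the subsequence strictly increasing.\<close>
  define r where "r k = (\<Sum>i\<le>k. N i) + k" for k
  have r: "strict_mono r"
    by (rule strict_monoI_Suc) (simp add: r_def)
  have rN: "r j \<ge> N k" if "j \<ge> k" for j k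
    using that member_le_sum[of k "{..j}" N] by (simp add: r_def trans_le_add1)
  define u where "u k = representative (X (r k))" for k
  have sq: "square_integrable (u k)" and Xu: "X (r k) = L2_class (u k)" for k
    by (simp_all add: u_def square_integrable_representative L2_class_representative)
  have [measurable]: "u k \<in> borel_measurable omega_measure" for k
    using sq by (simp add: square_integrable_def)
  have small: "(\<integral>\<^sup>+x. ennreal ((cmod (u j x - u k x))\<^sup>2) \<partial>omega_measure) \<le> ennreal (((1/2)^k)\<^sup>2)"
    if "j \<ge> k" for j k
  proof (rule nn_integral_square_le)
    show "norm (L2_class (\<lambda>x. u j x - u k x)) \<le> (1/2)^k"
      using N[OF rN[OF that] rN[OF order_refl]]
      by (simp add: sq Xu dist_norm L2_class_diff)
  qed (simp add: sq square_integrable_diff)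
  define M where "M = measure omega_measure (space omega_measure)"
  have M: "emeasure omega_measure (space omega_measure) = ennreal M" "M \<ge> 0"
    by (simp_all add: M_def omega.emeasure_eq_measure)
  have L1: "(\<integral>\<^sup>+x. ennreal (cmod (u (Suc k) x - u k x)) \<partial>omega_measure)
      \<le> ennreal ((1 + M) * (1/2)^k)"
    for k
  proof -
    \<comment> \<open>Young's inequality with the weight balanced against the size of the increment in norm.\<close>
    have "t \<le> 2^k * t\<^sup>2 + (1/2)^k" for t :: real
    proof -
      have "0 \<le> (2^k * t - 1)\<^sup>2" by simp
      also have "(2^k * t - 1)\<^sup>2 = 2^k * (2^k * t\<^sup>2 + (1/2)^k - 2 * t)"
        by (simp add: power2_eq_square algebra_simps power_one_over)
      finally have "2 * t \<le> 2^k * t\<^sup>2 + (1/2)^k"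
        using zero_less_power[of "2::real" k] by (simp add: zero_le_mult_iff not_le[symmetric])
      moreover have "0 \<le> 2^k * t\<^sup>2 + (1/2)^k" by (simp add: add_nonneg_nonneg)
      ultimately show ?thesis by linarith
    qed
    then have "(\<integral>\<^sup>+x. ennreal (cmod (u (Suc k) x - u k x)) \<partial>omega_measure) \<le>
        (\<integral>\<^sup>+x. ennreal (2^k) * ennreal ((cmod (u (Suc k) x - u k x))\<^sup>2) + ennreal ((1/2)^k) \<partial>omega_measure)"
      by (intro nn_integral_mono) (simp add: ennreal_leI flip: ennreal_mult ennreal_plus)
    also have "\<dots> = ennreal (2^k) * (\<integral>\<^sup>+x. ennreal ((cmod (u (Suc k) x - u k x))\<^sup>2) \<partial>omega_measure)
        + ennreal ((1/2)^k) * ennreal M"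
      by (simp add: nn_integral_add nn_integral_cmult M(1)[simplified])
    also have "\<dots> \<le> ennreal (2^k) * ennreal (((1/2)^k)\<^sup>2) + ennreal ((1/2)^k) * ennreal M"
      by (intro add_right_mono mult_left_mono small) auto
    also have "\<dots> = ennreal ((1 + M) * (1/2)^k)"
      using M(2) by (simp add: power2_eq_square power_one_over add_divide_distrib distrib_right mult.commute
          flip: ennreal_mult ennreal_plus)
    finally show ?thesis .
  qed
  have "(\<integral>\<^sup>+x. (\<Sum>k. ennreal (cmod (u (Suc k) x - u k x))) \<partial>omega_measure) =
      (\<Sum>k. \<integral>\<^sup>+x. ennreal (cmod (u (Suc k) x - u k x)) \<partial>omega_measure)"
    by (rule nn_integral_suminf) measurable
  also have "\<dots> \<le> (\<Sum>k. ennreal ((1 + M) * (1/2)^k))"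
    by (intro suminf_le L1) auto
  also have "\<dots> = ennreal (\<Sum>k. (1 + M) * (1/2)^k)"
    using M(2) by (intro suminf_ennreal2 summable_mult summable_geometric) auto
  finally have "(\<integral>\<^sup>+x. (\<Sum>k. ennreal (cmod (u (Suc k) x - u k x))) \<partial>omega_measure) \<noteq> \<infinity>"
    by (auto simp: top_unique)
  then have "AE x in omega_measure. (\<Sum>k. ennreal (cmod (u (Suc k) x - u k x))) \<noteq> \<infinity>"
    by (intro nn_integral_PInf_AE) measurable
  then have conv: "AE x in omega_measure. (\<lambda>k. u k x) \<longlonglongrightarrow> lim (\<lambda>k. u k x)"
  proof eventually_elim
    case (elim x)
    then have "summable (\<lambda>k. cmod (u (Suc k) x - u k x))"
      by (intro summable_suminf_not_top) auto
    then have "summable (\<lambda>k. u (Suc k) x - u k x)"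
      by (rule summable_norm_cancel)
    then have "convergent (\<lambda>n. (\<Sum>k<n. u (Suc k) x - u k x) + u 0 x)"
      by (intro convergent_add convergent_const) (simp add: summable_iff_convergent)
    then have "convergent (\<lambda>n. u n x)"
      by (simp add: sum_lessThan_telescope[of "\<lambda>k. u k x" for x])
    then show ?case by (simp add: convergent_LIMSEQ_iff)
  qed
  define v where "v x = lim (\<lambda>k. u k x)" for x
  have [measurable]: "v \<in> borel_measurable omega_measure"
    unfolding v_def by measurable
  have fatou: "(\<integral>\<^sup>+x. ennreal ((cmod (v x - u k x))\<^sup>2) \<partial>omega_measure) \<le> ennreal (((1/2)^k)\<^sup>2)"
      for k
  proof -
    have "(\<integral>\<^sup>+x. ennreal ((cmod (v x - u k x))\<^sup>2) \<partial>omega_measure) =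
        (\<integral>\<^sup>+x. liminf (\<lambda>j. ennreal ((cmod (u j x - u k x))\<^sup>2)) \<partial>omega_measure)"
    proof (rule nn_integral_cong_AE, use conv in eventually_elim)
      case (elim x)
      then have "(\<lambda>j. ennreal ((cmod (u j x - u k x))\<^sup>2)) \<longlonglongrightarrow> ennreal ((cmod (v x - u k x))\<^sup>2)"
        unfolding v_def by (intro tendsto_intros)
      then show ?case
        by (intro lim_imp_Liminf[symmetric]) auto
    qed
    also have "\<dots> \<le> liminf (\<lambda>j. \<integral>\<^sup>+x. ennreal ((cmod (u j x - u k x))\<^sup>2) \<partial>omega_measure)"
      by (rule nn_integral_liminf) measurable
    also have "\<dots> \<le> ennreal (((1/2)^k)\<^sup>2)"
      using small by (intro Liminf_le) (auto intro!: eventually_mono[OF eventually_ge_at_top[of k]])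
    finally show ?thesis .
  qed
  have sqd: "square_integrable (\<lambda>x. v x - u k x)" for k
    unfolding square_integrable_def
    using order.strict_trans1[OF fatou[of k]] by (auto intro!: integrableI_nonneg)
  have sqv: "square_integrable v"
    using square_integrable_add[OF sqd[of 0] sq[of 0]] by simp
  have "norm (X (r k) - L2_class v) \<le> (1/2)^k" for k
  proof -
    have "ennreal ((norm (L2_class v - X (r k)))\<^sup>2) \<le> ennreal (((1/2)^k)\<^sup>2)"
      unfolding Xu L2_class_diff[OF sqv sq] norm_L2_class[OF sqd]
      using fatou[of k] sqd[of k] by (simp add: nn_integral_eq_integral square_integrable_def)
    then have "(norm (L2_class v - X (r k)))\<^sup>2 \<le> ((1/2)^k)\<^sup>2"
      by (rule ennreal_le_iff[THEN iffD1, rotated]) simp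
    then have "norm (L2_class v - X (r k)) \<le> (1/2)^k"
      by (rule power2_le_imp_le) simp
    then show ?thesis
      by (simp add: norm_minus_commute)
  qed
  then have "(\<lambda>k. X (r k) - L2_class v) \<longlonglongrightarrow> 0"
    by (intro Lim_null_comparison[OF _ LIMSEQ_power_zero[of "1/2::real"]]) auto
  then have "(X \<circ> r) \<longlonglongrightarrow> L2_class v"
    by (simp add: o_def Lim_null[symmetric])
  then show "convergent X"
    using Cauchy_converges_subseq[OF X r] convergentI by blast
qed

section \<open>Density of polynomials in the cosine\<close>

definition cos_poly :: "real poly \<Rightarrow> weighted_L2" where
  "cos_poly p = L2_class (\<lambda>\<phi>. complex_of_real (poly p (cos \<phi>)))"

lemma continuous_on_poly_cos: "continuous_on S (\<lambda>x. poly p (cos x :: real))"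
  by (intro continuous_intros)

lemma poly_cos_measurable [measurable]: "(\<lambda>x. poly p (cos x :: real)) \<in> borel_measurable borel"
  by (intro borel_measurable_continuous_onI continuous_on_poly_cos)

lemma poly_cos_bounded:
  obtains B where "B > 0" "\<And>x::real. \<bar>poly p (cos x)\<bar> \<le> B"
proof -
  have "compact (poly p ` {-1..1::real})"
    by (intro compact_continuous_image continuous_intros) auto
  then obtain B where "B > 0" and B: "\<forall>y\<in>poly p ` {-1..1::real}. norm y \<le> B"
    using compact_imp_bounded bounded_pos by metis
  show thesis
    using B by (intro that[OF \<open>B > 0\<close>]) auto
qed

lemma square_integrable_poly_cos: "square_integrable (\<lambda>x. complex_of_real (poly p (cos x)))"
proof -
  obtain B where "B > 0" "\<And>x::real. \<bar>poly p (cos x)\<bar> \<le> B"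
    using poly_cos_bounded[of p] by blast
  then show ?thesis by (intro square_integrable_bounded[of _ B]) auto
qed

lemma cos_poly_add: "cos_poly (p + q) = cos_poly p + cos_poly q"
  by (simp add: cos_poly_def L2_class_add square_integrable_poly_cos)

lemma cos_poly_smult: "cos_poly (smult a p) = complex_of_real a *\<^sub>C cos_poly p"
  by (simp add: cos_poly_def L2_class_scaleC square_integrable_poly_cos)

lemma cos_poly_diff: "cos_poly (p - q) = cos_poly p - cos_poly q"
  using cos_poly_add[of "p - q" q] by (simp add: algebra_simps)

text \<open>The cosine maps \<open>[0, \<pi>]\<close> homeomorphically onto \<open>[-1, 1]\<close>, where the Weierstrass
  approximation theorem applies.\<close>

lemma weierstrass_poly_cos:
  fixes f :: "real \<Rightarrow> real"
  assumes f: "continuous_on {0..pi} f" and "e > 0"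
  obtains p where "\<And>x. 0 \<le> x \<Longrightarrow> x \<le> pi \<Longrightarrow> \<bar>f x - poly p (cos x)\<bar> < e"
proof -
  have "continuous_on {-1..1} (\<lambda>t. f (arccos t))"
    by (rule continuous_on_compose2[OF f]) (auto intro!: continuous_intros arccos_lbound arccos_ubound)
  then obtain g where g: "real_polynomial_function g"
    "\<And>t. t \<in> {-1..1} \<Longrightarrow> \<bar>f (arccos t) - g t\<bar> < e"
    using Stone_Weierstrass_real_polynomial_function[of "{-1..1::real}" "\<lambda>t. f (arccos t)" e] \<open>e > 0\<close>
    by auto
  obtain a n where a: "g = (\<lambda>x. \<Sum>i\<le>n. a i * x ^ i)"
    using g(1) real_polynomial_function_iff_sum by blast
  have "poly (\<Sum>i\<le>n. monom (a i) i) t = g t" for t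
    by (simp add: a poly_sum poly_monom)
  then show thesis
    using that[of "\<Sum>i\<le>n. monom (a i) i"] g(2)
        by (metis arccos_cos atLeastAtMost_iff cos_ge_minus_one cos_le_one)
qed

text \<open>The closure \<open>D\<close> of the span contains successively the classes of continuous functions
  (Weierstrass), of indicators of closed sets (limits of continuous functions of the distance to
  the set), of indicators of Borel sets (the closed sets form a generator stable under
  intersection, and the sets with indicator in \<open>D\<close> form a Dynkin system), of simple functions, and
  of all square-integrable functions.\<close>

lemma cos_poly_dense: "closure (cspan (range cos_poly)) = UNIV"
proof -
  define D where "D = closure (cspan (range cos_poly))"
  have subsp: "csubspace D"
    unfolding D_def by (intro csubspace_closure complex_vector.subspace_span)
  note D_add = complex_vector.subspace_add[OF subsp]
  note D_diff = complex_vector.subspace_diff[OF subsp]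
  note D_scale = complex_vector.subspace_scale[OF subsp]
  have D_lim: "l \<in> D" if "\<And>n. s n \<in> D" "s \<longlonglongrightarrow> l" for s l
    using that closed_sequentially[of D s l] by (auto simp: D_def)
  have D_poly: "cos_poly p \<in> D" for p
    unfolding D_def by (intro set_mp[OF closure_subset] complex_vector.span_base) simp
  have D_cong: "L2_class u = L2_class v"
    if "square_integrable u" "\<And>x. 0 < x \<Longrightarrow> x < pi \<Longrightarrow> u x = v x" for u v
  proof -
    have "v \<in> borel_measurable omega_measure"
      using that by (subst measurable_cong[of _ _ u]) (auto simp: square_integrable_def)
    moreover have "integrable omega_measure (\<lambda>x. (cmod (v x))\<^sup>2)"
      using that by (subst Bochner_Integration.integrable_cong[OF refl, of _ _ "\<lambda>x. (cmod (u x))\<^sup>2"])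
        (auto simp: square_integrable_def)
    ultimately have "square_integrable v" by (simp add: square_integrable_def)
    then show ?thesis
      using that by (auto simp: L2_class_eq_iff intro!: AE_I2)
  qed
  have D_cont: "L2_class (\<lambda>x. complex_of_real (f x)) \<in> D" if f: "continuous_on UNIV f"
      for f :: "real \<Rightarrow> real"
  proof -
    have f': "continuous_on {0..pi} f"
      using f continuous_on_subset by blast
    then have "compact (f ` {0..pi})"
      by (intro compact_continuous_image) auto
    then obtain B where B: "\<forall>y\<in>f ` {0..pi}. norm y \<le> B"
      using compact_imp_bounded bounded_pos by metis
    have "\<exists>p. \<forall>x. 0 \<le> x \<longrightarrow> x \<le> pi \<longrightarrow> \<bar>f x - poly p (cos x)\<bar> < inverse (real (Suc k))" for k
      using weierstrass_poly_cos[OF f', of "inverse (real (Suc k))"]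
          by (metis inverse_positive_iff_positive of_nat_0_less_iff zero_less_Suc)
    then obtain p where p: "\<And>k x. 0 \<le> x \<Longrightarrow> x \<le> pi
        \<Longrightarrow> \<bar>f x - poly (p k) (cos x)\<bar> < inverse (real (Suc k))"
      by metis
    have "(\<lambda>k. cos_poly (p k)) \<longlonglongrightarrow> L2_class (\<lambda>x. complex_of_real (f x))"
      unfolding cos_poly_def
    proof (rule L2_tendsto_dominated[where w = "\<lambda>_. B + 1"])
      have [measurable]: "f \<in> borel_measurable borel"
        by (rule borel_measurable_continuous_onI[OF f])
      show "(\<lambda>x. complex_of_real (f x)) \<in> borel_measurable omega_measure" by measurable
      fix x :: real assume x: "0 < x" "x < pi"
      show "(\<lambda>k. complex_of_real (poly (p k) (cos x))) \<longlonglongrightarrow> complex_of_real (f x)"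
      proof (intro tendsto_of_real, rule LIM_zero_cancel)
        show "(\<lambda>k. poly (p k) (cos x) - f x) \<longlonglongrightarrow> 0"
          using p[of x] x
          by (intro Lim_null_comparison[OF _ LIMSEQ_inverse_real_of_nat] always_eventually)
            (auto simp: abs_minus_commute less_imp_le)
      qed
      fix k
      have "inverse (real (Suc k)) \<le> 1"
        by (simp add: inverse_le_1_iff)
      moreover have "\<bar>f x\<bar> \<le> B"
        using B x by simp
      ultimately have "\<bar>poly (p k) (cos x)\<bar> \<le> B + 1"
        using p[of x k] x by linarith
      then show "cmod (complex_of_real (poly (p k) (cos x))) \<le> B + 1"
        by simp
    qed auto
    then show ?thesis
      by (rule D_lim[OF D_poly])
  qed
  let ?I = "\<lambda>A x. complex_of_real (indicator A x)"
  have sqI: "square_integrable (?I A)" if "A \<in> sets borel" for A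
    using that by (intro square_integrable_bounded[of _ 1]) (auto simp: indicator_def)
  have D_closed: "L2_class (?I C) \<in> D" if C: "closed C" for C
  proof (cases "C = {}")
    case True
    then show ?thesis using D_cont[of "\<lambda>_. 0"] by (simp add: indicator_def)
  next
    case False
    \<comment> \<open>Continuous functions decreasing to the indicator of the closed set.\<close>
    let ?f = "\<lambda>k x. max 0 (1 - real k * infdist x C)"
    have "(\<lambda>k. L2_class (\<lambda>x. complex_of_real (?f k x))) \<longlonglongrightarrow> L2_class (?I C)"
    proof (rule L2_tendsto_dominated[where w = "\<lambda>_. 1"])
      have [measurable]: "C \<in> sets borel" using C by simp
      show "?I C \<in> borel_measurable omega_measure" by measurable
      show "(\<lambda>x. complex_of_real (?f k x)) \<in> borel_measurable omega_measure" for k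
        by (intro borel_measurable_omega borel_measurable_continuous_onI continuous_intros)
      fix x :: real
      show "(\<lambda>k. complex_of_real (?f k x)) \<longlonglongrightarrow> ?I C x"
      proof (intro tendsto_of_real)
        show "(\<lambda>k. ?f k x) \<longlonglongrightarrow> indicator C x"
        proof (cases "x \<in> C")
          case True
          then show ?thesis by simp
        next
          case False
          then have d: "infdist x C > 0"
            using C \<open>C \<noteq> {}\<close> in_closed_iff_infdist_zero[of C x] infdist_nonneg[of x C] by fastforce
          obtain K where K: "real K * infdist x C > 1"
            using reals_Archimedean3[OF d] by blast
          have "?f k x = 0" if "k \<ge> K" for k
          proof -
            have "real K * infdist x C \<le> real k * infdist x C"
              using that d by (intro mult_right_mono) auto
            with K show ?thesis by simp
          qed
          then show ?thesis
            using False by (intro tendsto_eventually eventually_mono[OF eventually_ge_at_top[of K]]) simp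
        qed
      qed
      show "cmod (complex_of_real (?f k x)) \<le> 1" for k
        using infdist_nonneg[of x C] by (simp add: norm_of_real)
    qed auto
    moreover have "L2_class (\<lambda>x. complex_of_real (?f k x)) \<in> D" for k
      by (intro D_cont continuous_intros)
    ultimately show ?thesis
      by (rule D_lim[rotated])
  qed
  have D_zero: "L2_class (\<lambda>_. 0) \<in> D"
    using D_closed[of "{}"] by simp
  have D_borel: "L2_class (?I A) \<in> D" if "A \<in> sets borel" for A
  proof -
    have borel: "sets borel = sigma_sets UNIV (Collect (closed :: real set \<Rightarrow> bool))"
      by (simp add: borel_eq_closed)
    have "Int_stable (Collect (closed :: real set \<Rightarrow> bool))" "Collect closed \<subseteq> Pow (UNIV :: real set)"
      "A \<in> sigma_sets UNIV (Collect closed)"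
      using that by (auto simp: Int_stable_def borel)
    then show ?thesis
    proof (induction rule: sigma_sets_induct_disjoint)
      case (basic A)
      then show ?case by (simp add: D_closed)
    next
      case empty
      show ?case by (simp add: D_zero)
    next
      case (compl A)
      then have A: "A \<in> sets borel" by (simp add: borel)
      have "L2_class (?I UNIV) - L2_class (?I A) = L2_class (\<lambda>x. ?I UNIV x - ?I A x)"
        by (intro L2_class_diff sqI A) auto
      also have "(\<lambda>x. ?I UNIV x - ?I A x) = ?I (UNIV - A)"
        by (auto simp: indicator_def)
      finally show ?case
        using D_diff[OF D_closed[OF closed_UNIV] compl(2)] by simp
    next
      case (union A)
      then have A: "A i \<in> sets borel" for i by (auto simp: borel)
      have "L2_class (?I (\<Union>i<n. A i)) \<in> D" for n
      proof (induction n)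
        case 0
        show ?case by (simp add: D_zero)
      next
        case (Suc n)
        have "L2_class (?I (A n)) + L2_class (?I (\<Union>i<n. A i))
            = L2_class (\<lambda>x. ?I (A n) x + ?I (\<Union>i<n. A i) x)"
          using A by (intro L2_class_add sqI) auto
        also have "(\<lambda>x. ?I (A n) x + ?I (\<Union>i<n. A i) x) = ?I (\<Union>i<Suc n. A i)"
        proof
          fix x
          have "x \<notin> A i" if "x \<in> A n" "i < n" for i
            using disjoint_family_onD[OF union(1), of i n] that by auto
          then show "?I (A n) x + ?I (\<Union>i<n. A i) x = ?I (\<Union>i<Suc n. A i) x"
            by (auto simp: indicator_def lessThan_Suc)
        qed
        finally show ?case
          using D_add[OF union(3) Suc.IH, of n] by simp
      qed
      moreover have "(\<lambda>n. L2_class (?I (\<Union>i<n. A i))) \<longlonglongrightarrow> L2_class (?I (\<Union>i. A i))"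
      proof (rule L2_tendsto_dominated[where w = "\<lambda>_. 1"])
        show "(\<lambda>n. ?I (\<Union>i<n. A i) x) \<longlonglongrightarrow> ?I (\<Union>i. A i) x" for x
          by (intro tendsto_of_real LIMSEQ_indicator_UN)
      qed (use A in \<open>auto simp: indicator_def\<close>)
      ultimately show ?case
        using D_lim[of "\<lambda>n. L2_class (?I (\<Union>i<n. A i))"] by blast
    qed
  qed
  have D_sum: "square_integrable (\<lambda>x. \<Sum>y\<in>Y. y * ?I (A y) x) \<and> L2_class (\<lambda>x. \<Sum>y\<in>Y. y * ?I (A y) x)
      \<in> D"
    if "finite Y" "\<And>y. A y \<in> sets borel" for Y :: "complex set" and A
    using that(1)
  proof (induction rule: finite_induct)
    case empty
    show ?case by (simp add: square_integrable_zero D_zero)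
  next
    case (insert y Y)
    have sq: "square_integrable (\<lambda>x. y * ?I (A y) x)"
      by (intro square_integrable_scale sqI that)
    have "y *\<^sub>C L2_class (?I (A y)) + L2_class (\<lambda>x. \<Sum>y\<in>Y. y * ?I (A y) x) \<in> D"
      using insert by (intro D_add D_scale D_borel that) auto
    then show ?case
      using insert sq square_integrable_add[OF sq]
          by (simp add: L2_class_scaleC L2_class_add sqI that)
  qed
  have D_simple: "L2_class s \<in> D" if s: "simple_function omega_measure s" for s
  proof -
    let ?A = "\<lambda>y. s -` {y} \<inter> {0<..<pi}"
    have fin: "finite (s ` {0<..<pi})"
      using simple_functionD(1)[OF s] by simp
    have A: "?A y \<in> sets borel" for y
      using simple_functionD(2)[OF s, of "{y}"] by (auto simp: sets_omega sets_restrict_space_iff)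
    have "(\<Sum>y\<in>s ` {0<..<pi}. y * ?I (?A y) x) = s x" if "0 < x" "x < pi" for x
    proof -
      have "(\<Sum>y\<in>s ` {0<..<pi}. y * ?I (?A y) x) = (\<Sum>y\<in>s ` {0<..<pi}. if y = s x then y else 0)"
        using that by (intro sum.cong) (auto simp: indicator_def)
      also have "\<dots> = s x"
        using fin that by (simp add: sum.delta)
      finally show ?thesis .
    qed
    then have "L2_class (\<lambda>x. \<Sum>y\<in>s ` {0<..<pi}. y * ?I (?A y) x) = L2_class s"
      using D_sum[OF fin, of ?A, OF A] by (intro D_cong) auto
    then show ?thesis
      using D_sum[OF fin, of ?A, OF A] by simp
  qed
  have "f \<in> D" for f
  proof -
    obtain u where u: "square_integrable u" and f: "f = L2_class u"
      by (rule L2_class_cases)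
    then have m: "u \<in> borel_measurable omega_measure"
      by (simp add: square_integrable_def)
    obtain s where s: "\<And>i. simple_function omega_measure (s i)"
      "\<And>x. x \<in> space omega_measure \<Longrightarrow> (\<lambda>i. s i x) \<longlonglongrightarrow> u x"
      "\<And>i x. x \<in> space omega_measure \<Longrightarrow> dist (s i x) 0 \<le> 2 * dist (u x) 0"
      using borel_measurable_implies_sequence_metric[OF m, of 0] by blast
    have "(\<lambda>i. L2_class (s i)) \<longlonglongrightarrow> L2_class u"
    proof (rule L2_tendsto_dominated[where w = "\<lambda>x. 2 * cmod (u x)"])
      show "integrable omega_measure (\<lambda>x. (2 * cmod (u x))\<^sup>2)"
        using u by (simp add: square_integrable_def power_mult_distrib)
      show "s k \<in> borel_measurable omega_measure" for k
        by (rule borel_measurable_simple_function[OF s(1)])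
    qed (use s m in auto)
    then show ?thesis
      unfolding f by (rule D_lim[OF D_simple[OF s(1)]])
  qed
  then show ?thesis by (auto simp: D_def)
qed

lemma gegenbauer_recurrence:
  "smult (real n + 2) (gegenbauer \<nu> (Suc (Suc n))) =
     smult (2 * (real n + 1 + \<nu>)) ([:0, 1:] * gegenbauer \<nu> (Suc n)) -
     smult (real n + 2 * \<nu>) (gegenbauer \<nu> n)"
  by simp

text \<open>By the recurrence the span is invariant under multiplication by the variable, and it
  contains the constants.\<close>

lemma cspan_gegenbauer:
  assumes "\<nu> > 0"
  shows "cspan (range (\<lambda>n. cos_poly (gegenbauer \<nu> n))) = cspan (range cos_poly)"
proof -
  let ?V = "cspan (range (\<lambda>n. cos_poly (gegenbauer \<nu> n)))"
  have base: "cos_poly (gegenbauer \<nu> n) \<in> ?V" for n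
    by (intro complex_vector.span_base) simp
  have X: "[:0, 1:] * gegenbauer \<nu> (Suc n) =
      smult ((real n + 2) / (2 * (real n + 1 + \<nu>))) (gegenbauer \<nu> (Suc (Suc n))) +
      smult ((real n + 2 * \<nu>) / (2 * (real n + 1 + \<nu>))) (gegenbauer \<nu> n)" for n
  proof -
    have "real n + 1 + \<nu> > 0" using assms by simp
    then have "[:0, 1:] * gegenbauer \<nu> (Suc n) =
       smult (1 / (2 * (real n + 1 + \<nu>)))
         (smult (2 * (real n + 1 + \<nu>)) ([:0, 1:] * gegenbauer \<nu> (Suc n)))"
      by simp
    also have "smult (2 * (real n + 1 + \<nu>)) ([:0, 1:] * gegenbauer \<nu> (Suc n)) =
       smult (real n + 2) (gegenbauer \<nu> (Suc (Suc n))) + smult (real n + 2 * \<nu>) (gegenbauer \<nu> n)"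
      by (simp only: gegenbauer_recurrence diff_add_cancel)
    finally show ?thesis
      by (simp only: smult_add_right smult_smult times_divide_eq_left mult_1)
  qed
  have "cos_poly (p * gegenbauer \<nu> n) \<in> ?V" for p n
  proof (induction p arbitrary: n)
    case 0
    show ?case
      using cos_poly_smult[of 0 0] complex_vector.span_zero by simp
  next
    case (pCons a p)
    have "cos_poly (p * ([:0, 1:] * gegenbauer \<nu> n)) \<in> ?V"
    proof (cases n)
      case 0
      have "[:0, 1:] * gegenbauer \<nu> n = smult (1 / (2 * \<nu>)) (gegenbauer \<nu> (Suc 0))"
        using assms by (simp add: 0)
      then show ?thesis
        by (simp only: mult_smult_right cos_poly_smult)
           (intro complex_vector.span_scale pCons.IH)
    next
      case (Suc m)
      show ?thesis
        unfolding Suc X distrib_left mult_smult_right cos_poly_add cos_poly_smult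
        by (intro complex_vector.span_add complex_vector.span_scale pCons.IH)
    qed
    moreover have "pCons a p * gegenbauer \<nu> n = smult a (gegenbauer \<nu> n)
        + p * ([:0, 1:] * gegenbauer \<nu> n)"
      by (simp add: mult_pCons_left)
    ultimately show ?case
      by (simp only: cos_poly_add cos_poly_smult)
         (intro complex_vector.span_add complex_vector.span_scale base)
  qed
  from this[of _ 0] have "range cos_poly \<subseteq> ?V" by auto
  then show ?thesis
    by (intro subset_antisym complex_vector.span_mono complex_vector.span_minimal
        complex_vector.subspace_span) auto
qed

section \<open>The Gegenbauer differential equation\<close>

text \<open>The two classical identities \<open>x C\<^sub>m\<^sub>+\<^sub>1' - C\<^sub>m' = (m + 1) C\<^sub>m\<^sub>+\<^sub>1\<close> and \<open>C\<^sub>m\<^sub>+\<^sub>1' - x C\<^sub>m' =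
  (m + 2 \<nu>) C\<^sub>m\<close> are proved together: differentiating the recurrence and inserting the first one
  yields the next instance of the second, and the next instance of the first follows from both.\<close>

lemma gegenbauer_pderiv:
  shows "[:0, 1:] * pderiv (gegenbauer \<nu> (Suc m)) - pderiv (gegenbauer \<nu> m) =
      smult (real m + 1) (gegenbauer \<nu> (Suc m)) \<and>
    pderiv (gegenbauer \<nu> (Suc m)) - [:0, 1:] * pderiv (gegenbauer \<nu> m) =
      smult (real m + 2 * \<nu>) (gegenbauer \<nu> m)"
proof (induction m)
  case 0
  show ?case by (simp add: pderiv_pCons)
next
  case (Suc m)
  define c0 c1 c2 where "c0 = gegenbauer \<nu> m" and "c1 = gegenbauer \<nu> (Suc m)"
    and "c2 = gegenbauer \<nu> (Suc (Suc m))"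
  have rec: "smult (real m + 2) c2
      = smult (2 * (real m + 1 + \<nu>)) ([:0, 1:] * c1) - smult (real m + 2 * \<nu>) c0"
    unfolding c0_def c1_def c2_def by (rule gegenbauer_recurrence)
  have IH1: "x * poly (pderiv c1) x - poly (pderiv c0) x = (real m + 1) * poly c1 x" for x
    using arg_cong[OF Suc.IH[THEN conjunct1], of "\<lambda>p. poly p x"] by (simp add: c0_def c1_def)
  have IH2: "poly (pderiv c1) x - x * poly (pderiv c0) x = (real m + 2 * \<nu>) * poly c0 x" for x
    using arg_cong[OF Suc.IH[THEN conjunct2], of "\<lambda>p. poly p x"] by (simp add: c0_def c1_def)
  have rec1: "(real m + 2) * poly c2 x
      = 2 * (real m + 1 + \<nu>) * (x * poly c1 x) - (real m + 2 * \<nu>) * poly c0 x" for x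
    using arg_cong[OF rec, of "\<lambda>p. poly p x"] by simp
  have rec2: "(real m + 2) * poly (pderiv c2) x =
      2 * (real m + 1 + \<nu>) * (poly c1 x + x * poly (pderiv c1) x) - (real m + 2 * \<nu>) * poly (pderiv c0) x" for x
    using arg_cong[OF rec, of "\<lambda>p. poly (pderiv p) x"]
    by (simp add: pderiv_smult pderiv_diff pderiv_mult pderiv_pCons algebra_simps)
  have two: "poly (pderiv c2) x - x * poly (pderiv c1) x = (real m + 1 + 2 * \<nu>) * poly c1 x" for x
  proof -
    have "(real m + 2) * (poly (pderiv c2) x - x * poly (pderiv c1) x) =
        (real m + 2) * ((real m + 1 + 2 * \<nu>) * poly c1 x)"
      using rec2[of x] IH1[of x] by algebra
    then show ?thesis
      by (subst (asm) mult_left_cancel) auto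
  qed
  have one: "x * poly (pderiv c2) x - poly (pderiv c1) x = (real m + 2) * poly c2 x" for x
    using two[of x] IH1[of x] IH2[of x] rec1[of x] by algebra
  show ?case
    unfolding c1_def[symmetric] c2_def[symmetric]
    using one two by (simp add: poly_eq_poly_eq_iff[symmetric] fun_eq_iff ring_distribs)
qed

text \<open>In the variable \<open>t = cos \<phi>\<close> and for \<open>\<nu> = 1/4\<close> this is \<open>d\<^sup>2/d\<phi>\<^sup>2 + 1/2 cot \<phi> d/d\<phi>\<close>.\<close>

definition gegenbauer_op :: "real \<Rightarrow> real poly \<Rightarrow> real poly" where
  "gegenbauer_op \<nu> p =
     [:1, 0, -1:] * pderiv (pderiv p) - smult (2 * \<nu> + 1) ([:0, 1:] * pderiv p)"

text \<open>Differentiating the two identities above and eliminating the derivatives of the polynomial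
  of lower degree leaves the Gegenbauer equation.\<close>

lemma gegenbauer_ode:
  "gegenbauer_op \<nu> (gegenbauer \<nu> n) = smult (- (real n * (real n + 2 * \<nu>))) (gegenbauer \<nu> n)"
proof (cases n)
  case 0
  then show ?thesis by (simp add: gegenbauer_op_def)
next
  case (Suc m)
  define c0 c1 where "c0 = gegenbauer \<nu> m" and "c1 = gegenbauer \<nu> (Suc m)"
  note pair = gegenbauer_pderiv[of \<nu> m, folded c0_def c1_def]
  have i: "x * poly (pderiv c1) x - poly (pderiv c0) x = (real m + 1) * poly c1 x" for x
    using arg_cong[OF pair[THEN conjunct1], of "\<lambda>p. poly p x"] by simp
  have i': "poly (pderiv c1) x + x * poly (pderiv (pderiv c1)) x - poly (pderiv (pderiv c0)) x =
      (real m + 1) * poly (pderiv c1) x" for x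
    using arg_cong[OF pair[THEN conjunct1], of "\<lambda>p. poly (pderiv p) x"]
    by (simp add: pderiv_smult pderiv_diff pderiv_mult pderiv_pCons algebra_simps)
  have ii': "poly (pderiv (pderiv c1)) x - poly (pderiv c0) x - x * poly (pderiv (pderiv c0)) x =
      (real m + 2 * \<nu>) * poly (pderiv c0) x" for x
    using arg_cong[OF pair[THEN conjunct2], of "\<lambda>p. poly (pderiv p) x"]
    by (simp add: pderiv_smult pderiv_diff pderiv_mult pderiv_pCons algebra_simps)
  have "(1 - x\<^sup>2) * poly (pderiv (pderiv c1)) x - (2 * \<nu> + 1) * (x * poly (pderiv c1) x) =
      - ((real m + 1) * (real m + 1 + 2 * \<nu>) * poly c1 x)" for x
    using i[of x] i'[of x] ii'[of x] by algebra
  then show ?thesis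
    unfolding Suc c1_def[symmetric] gegenbauer_op_def
    by (simp add: poly_eq_poly_eq_iff[symmetric] fun_eq_iff algebra_simps power2_eq_square)
qed

section \<open>Smooth functions\<close>

text \<open>Differentiability is expressed through arbitrary witnesses for the derivatives instead of
  iterates of \<^const>\<open>deriv\<close>, so that the closure properties are plain inductions and only the
  derivative on \<open>S\<close> matters.\<close>

primrec diff_times :: "nat \<Rightarrow> real set \<Rightarrow> (real \<Rightarrow> real) \<Rightarrow> bool" where
  "diff_times 0 S f \<longleftrightarrow> True"
| "diff_times (Suc k) S f \<longleftrightarrow>
     (\<exists>f'. (\<forall>x\<in>S. (f has_real_derivative f' x) (at x)) \<and> diff_times k S f')"

lemma diff_times_Suc_D: "diff_times (Suc k) S f \<Longrightarrow> diff_times k S f"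
  by (induction k arbitrary: f) auto

lemma diff_times_cong:
  assumes "open S" "\<And>x. x \<in> S \<Longrightarrow> f x = g x" "diff_times k S f"
  shows "diff_times k S g"
  using assms by (cases k) (auto intro: has_field_derivative_transform_within_open)

text \<open>Base functions are shown to be smooth by exhibiting a set of functions that contains them
  and is closed under differentiation.\<close>

lemma diff_times_family:
  assumes "\<And>f. f \<in> F \<Longrightarrow> \<exists>f'\<in>F. \<forall>x\<in>S. (f has_real_derivative f' x) (at x)" "f \<in> F"
  shows "diff_times k S f"
  using assms(2)
proof (induction k arbitrary: f)
  case (Suc k)
  with assms(1)[OF Suc.prems] show ?case by auto
qed simp

lemma diff_times_add:
  "diff_times k S f \<Longrightarrow> diff_times k S g \<Longrightarrow> diff_times k S (\<lambda>x. f x + g x)"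
proof (induction k arbitrary: f g)
  case (Suc k)
  then obtain f' g' where
    "\<forall>x\<in>S. (f has_real_derivative f' x) (at x)" "diff_times k S f'"
    "\<forall>x\<in>S. (g has_real_derivative g' x) (at x)" "diff_times k S g'"
    by auto
  then show ?case
    by (auto intro!: exI[of _ "\<lambda>x. f' x + g' x"] DERIV_add Suc.IH)
qed simp

lemma diff_times_mult:
  "diff_times k S f \<Longrightarrow> diff_times k S g \<Longrightarrow> diff_times k S (\<lambda>x. f x * g x)"
proof (induction k arbitrary: f g)
  case (Suc k)
  then obtain f' g' where d:
    "\<forall>x\<in>S. (f has_real_derivative f' x) (at x)" "diff_times k S f'"
    "\<forall>x\<in>S. (g has_real_derivative g' x) (at x)" "diff_times k S g'"
    by auto
  have "\<forall>x\<in>S. ((\<lambda>x. f x * g x) has_real_derivative f' x * g x + g' x * f x) (at x)"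
    using d by (auto intro!: DERIV_mult)
  moreover have "diff_times k S (\<lambda>x. f' x * g x + g' x * f x)"
    by (intro diff_times_add Suc.IH[OF d(2) diff_times_Suc_D[OF Suc.prems(2)]]
        Suc.IH[OF d(4) diff_times_Suc_D[OF Suc.prems(1)]])
  ultimately show ?case by auto
qed simp

lemma diff_times_compose:
  assumes "\<And>x. x \<in> S \<Longrightarrow> f x \<in> T"
  shows "diff_times k T g \<Longrightarrow> diff_times k S f \<Longrightarrow> diff_times k S (\<lambda>x. g (f x))"
proof (induction k arbitrary: g)
  case (Suc k)
  then obtain f' g' where d:
    "\<forall>x\<in>S. (f has_real_derivative f' x) (at x)" "diff_times k S f'"
    "\<forall>x\<in>T. (g has_real_derivative g' x) (at x)" "diff_times k T g'"
    by auto
  have "\<forall>x\<in>S. ((\<lambda>x. g (f x)) has_real_derivative g' (f x) * f' x) (at x)"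
  proof
    fix x assume "x \<in> S"
    with d assms show "((\<lambda>x. g (f x)) has_real_derivative g' (f x) * f' x) (at x)"
      by (intro DERIV_chain2[of g _ f]) blast+
  qed
  moreover have "diff_times k S (\<lambda>x. g' (f x) * f' x)"
    by (rule diff_times_mult[OF Suc.IH[OF d(4) diff_times_Suc_D[OF Suc.prems(2)]] d(2)])
  ultimately show ?case by auto
qed simp

lemma diff_times_higher_deriv:
  assumes "open S"
  shows "diff_times (Suc k) S f \<Longrightarrow> x \<in> S \<Longrightarrow> (deriv ^^ k) f field_differentiable (at x)"
proof (induction k arbitrary: f)
  case 0
  then show ?case by (auto simp: field_differentiable_def)
next
  case (Suc k)
  then obtain f' where f': "\<forall>x\<in>S. (f has_real_derivative f' x) (at x)" "diff_times (Suc k) S f'"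
    by (metis diff_times.simps(2))
  have "diff_times (Suc k) S (deriv f)"
    using f'(1) by (intro diff_times_cong[OF assms _ f'(2)]) (metis DERIV_imp_deriv)
  then have "(deriv ^^ k) (deriv f) field_differentiable (at x)"
    using Suc by blast
  then show ?case by (simp add: funpow_swap1)
qed

lemma diff_times_extend_zero:
  assumes S: "open S" and K: "closed K" "K \<subseteq> S"
  shows "diff_times k S f \<Longrightarrow> (\<And>x. x \<notin> K \<Longrightarrow> f x = 0) \<Longrightarrow> diff_times k UNIV f"
proof (induction k arbitrary: f)
  case (Suc k)
  then obtain f' where f': "\<forall>x\<in>S. (f has_real_derivative f' x) (at x)" "diff_times k S f'"
    by auto
  have zero: "(f has_real_derivative 0) (at x)" if "x \<notin> K" for x
    using that K(1) Suc.prems(2)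
    by (intro has_field_derivative_transform_within_open[of "\<lambda>_. 0" 0 x "- K" f]) auto
  define h where "h x = (if x \<in> S then f' x else 0)" for x
  have "diff_times k S h"
    by (rule diff_times_cong[OF S _ f'(2)]) (simp add: h_def)
  moreover have "h x = 0" if "x \<notin> K" for x
    using DERIV_unique[OF zero[OF that], of "f' x"] f'(1) by (auto simp: h_def)
  ultimately have "diff_times k UNIV h"
    by (rule Suc.IH)
  moreover have "(f has_real_derivative h x) (at x)" for x
    using zero f'(1) K(2) by (auto simp: h_def)
  ultimately show ?case by auto
qed simp

lemma diff_times_poly: "diff_times k S (poly p)"
  by (rule diff_times_family[of "range poly"]) (auto intro!: poly_DERIV)

lemma diff_times_sin_cos: "diff_times k S (\<lambda>x. a * sin x + b * cos x + c)"
proof (rule diff_times_family[of "{\<lambda>x. a * sin x + b * cos x + c | a b c. True}"])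
  fix f :: "real \<Rightarrow> real" assume "f \<in> {\<lambda>x. a * sin x + b * cos x + c | a b c. True}"
  then obtain a b c where f: "f = (\<lambda>x. a * sin x + b * cos x + c)" by auto
  have "\<forall>x\<in>S. (f has_real_derivative (- b) * sin x + a * cos x + 0) (at x)"
    unfolding f by (auto intro!: derivative_eq_intros)
  moreover have "(\<lambda>x. (- b) * sin x + a * cos x + 0) \<in> {\<lambda>x. a * sin x + b * cos x
      + c | a b c. True}"
    by blast
  ultimately show "\<exists>f'\<in>{\<lambda>x. a * sin x + b * cos x + c | a b c. True}.
      \<forall>x\<in>S. (f has_real_derivative f' x) (at x)"
    by (rule bexI)
qed auto

lemma diff_times_poly_cos: "diff_times k S (\<lambda>x. poly p (cos x))"
  using diff_times_compose[OF _ diff_times_poly diff_times_sin_cos[of k S 0 1 0], of UNIV] by simp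

lemma diff_times_powr: "diff_times k {0<..} (\<lambda>x. c * x powr a)"
proof (rule diff_times_family[of "{\<lambda>x. c * x powr a | c a. True}"])
  fix f :: "real \<Rightarrow> real" assume "f \<in> {\<lambda>x. c * x powr a | c a. True}"
  then obtain c a where f: "f = (\<lambda>x. c * x powr a)" by auto
  have "\<forall>x\<in>{0<..}. (f has_real_derivative (c * a) * x powr (a - 1)) (at x)"
    unfolding f by (auto intro!: derivative_eq_intros simp: powr_diff)
  moreover have "(\<lambda>x. (c * a) * x powr (a - 1)) \<in> {\<lambda>x. c * x powr a | c a. True}"
    by blast
  ultimately show "\<exists>f'\<in>{\<lambda>x. c * x powr a | c a. True}. \<forall>x\<in>{0<..}. (f has_real_derivative f' x) (at x)"
    by (rule bexI)
qed auto

text \<open>The functions \<open>p(1/t) exp(-1/t)\<close>, extended by zero to \<open>t \<le> 0\<close>, are closed under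
  differentiation, which makes all of them smooth on the whole line.\<close>

definition flat :: "real poly \<Rightarrow> real \<Rightarrow> real" where
  "flat p t = (if t > 0 then poly p (1 / t) * exp (- (1 / t)) else 0)"

lemma tendsto_poly_div_exp: "((\<lambda>s::real. poly p s * exp (- s)) \<longlongrightarrow> 0) at_top"
proof -
  have "((\<lambda>s::real. \<Sum>i\<le>degree p. coeff p i * (s ^ i / exp s)) \<longlongrightarrow> (\<Sum>i\<le>degree p. coeff p i * 0)) at_top"
    by (intro tendsto_intros tendsto_power_div_exp_0)
  then show ?thesis
    by (simp add: poly_altdef exp_minus divide_inverse sum_distrib_right mult.assoc)
qed

lemma flat_tendsto_zero: "flat p \<midarrow>0\<rightarrow> 0"
proof -
  have "(flat p \<longlongrightarrow> 0) (at_right 0)"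
  proof (rule Lim_transform_eventually)
    show "((\<lambda>t. poly p (1 / t) * exp (- (1 / t))) \<longlongrightarrow> 0) (at_right 0)"
      using filterlim_compose[OF tendsto_poly_div_exp filterlim_inverse_at_top_right]
      by (simp add: inverse_eq_divide)
    show "\<forall>\<^sub>F t in at_right 0. poly p (1 / t) * exp (- (1 / t)) = flat p t"
      by (auto simp: eventually_at_filter flat_def)
  qed
  moreover have "(flat p \<longlongrightarrow> 0) (at_left 0)"
    by (rule tendsto_eventually) (auto simp: eventually_at_filter flat_def)
  ultimately show ?thesis
    by (rule filterlim_split_at_real[rotated])
qed

text \<open>At the origin the difference quotient of \<open>flat p\<close> is \<open>flat (pCons 0 p)\<close>, which tends to
  zero.\<close>

lemma DERIV_flat: "(flat p has_real_derivative flat (pCons 0 (pCons 0 (p - pderiv p))) t) (at t)"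
proof -
  consider "t > 0" | "t < 0" | "t = 0" by linarith
  then show ?thesis
  proof cases
    case 1
    have "((\<lambda>t. poly p (1 / t) * exp (- (1 / t))) has_real_derivative
        flat (pCons 0 (pCons 0 (p - pderiv p))) t) (at t)"
      using 1 by (auto intro!: derivative_eq_intros DERIV_chain2[OF poly_DERIV]
          simp: flat_def field_simps power2_eq_square)
    then show ?thesis
      by (rule has_field_derivative_transform_within_open[where S = "{0<..}"])
        (use 1 in \<open>auto simp: flat_def\<close>)
  next
    case 2
    have "((\<lambda>t. 0) has_real_derivative flat (pCons 0 (pCons 0 (p - pderiv p))) t) (at t)"
      using 2 by (auto simp: flat_def)
    then show ?thesis
      by (rule has_field_derivative_transform_within_open[where S = "{..<0}"])
        (use 2 in \<open>auto simp: flat_def\<close>)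
  next
    case 3
    have quotient: "(\<lambda>h. (flat p (0 + h) - flat p 0) / h) = flat (pCons 0 p)"
      by (auto simp: flat_def fun_eq_iff)
    have "flat (pCons 0 (pCons 0 (p - pderiv p))) 0 = 0"
      by (simp add: flat_def)
    then show ?thesis
      unfolding DERIV_def 3 quotient using flat_tendsto_zero by simp
  qed
qed

lemma diff_times_flat: "diff_times k S (flat p)"
  by (rule diff_times_family[of "range flat"]) (auto intro!: DERIV_flat)

section \<open>Test functions and cutoffs\<close>

lemma test_functionI:
  assumes "open S" "compact K" "K \<subseteq> S" "\<And>k. diff_times k S f" "\<And>x. x \<notin> K \<Longrightarrow> f x = 0"
  shows "test_function S f"
proof -
  have sub: "closure {x. f x \<noteq> 0} \<subseteq> K"
    using assms by (intro closure_minimal) (auto simp: compact_imp_closed)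
  have "diff_times k UNIV f" for k
    using assms by (intro diff_times_extend_zero[of S K]) (auto simp: compact_imp_closed)
  then have "(deriv ^^ k) f field_differentiable (at x)" for k x
    by (rule diff_times_higher_deriv[OF open_UNIV]) simp
  moreover have "compact (closure {x. f x \<noteq> 0})"
    using sub assms(2) compact_eq_bounded_closed bounded_subset closed_closure by metis
  ultimately show ?thesis
    using sub assms(3) by (auto simp: test_function_def)
qed

lemma
  assumes "test_function S \<psi>"
  shows test_function_DERIV: "(\<psi> has_real_derivative deriv \<psi> x) (at x)"
    and test_function_continuous: "continuous_on UNIV \<psi>"
    and test_function_deriv_continuous: "continuous_on UNIV (deriv \<psi>)"
    and test_function_support: "\<exists>K. compact K \<and> K \<subseteq> S \<and> (\<forall>x. x \<notin> K \<longrightarrow> \<psi> x = 0 \<and> deriv \<psi> x = 0)"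
proof -
  have d: "(deriv ^^ k) \<psi> field_differentiable (at x)" for k x
    using assms by (simp add: test_function_def)
  show D: "(\<psi> has_real_derivative deriv \<psi> x) (at x)" for x
    using d[of 0 x] by (simp add: field_differentiable_derivI)
  show "continuous_on UNIV \<psi>"
    using d[of 0] by (intro continuous_at_imp_continuous_on) (auto intro: field_differentiable_imp_continuous_at)
  show "continuous_on UNIV (deriv \<psi>)"
    using d[of 1] by (intro continuous_at_imp_continuous_on) (auto intro: field_differentiable_imp_continuous_at)
  define K where "K = closure {x. \<psi> x \<noteq> 0}"
  have K: "compact K" "K \<subseteq> S"
    using assms by (simp_all add: test_function_def K_def)
  have zero: "\<psi> x = 0" if "x \<notin> K" for x
    using that closure_subset[of "{x. \<psi> x \<noteq> 0}"] by (auto simp: K_def)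
  have deriv_zero: "deriv \<psi> x = 0" if "x \<notin> K" for x
  proof (rule DERIV_imp_deriv, rule has_field_derivative_transform_within_open)
    show "((\<lambda>_. 0) has_real_derivative 0) (at x)" by simp
    show "open (- K)" by (simp add: K_def open_Compl)
    show "x \<in> - K" using that by simp
    show "0 = \<psi> y" if "y \<in> - K" for y
      using zero that by simp
  qed
  show "\<exists>K. compact K \<and> K \<subseteq> S \<and> (\<forall>x. x \<notin> K \<longrightarrow> \<psi> x = 0 \<and> deriv \<psi> x = 0)"
    using K zero deriv_zero by blast
qed

text \<open>These functions increase to \<open>1\<close> on \<open>(0, \<pi>)\<close> without ever reaching it. What matters is that
  their derivatives are bounded by \<open>2 / sin x\<close> uniformly in \<open>n\<close> and tend to zero pointwise.\<close>

definition cutoff :: "nat \<Rightarrow> real \<Rightarrow> real" where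
  "cutoff n x = (if 0 < x \<and> x < pi then flat 1 (real n * sin x - 1) else 0)"

lemma cutoff_nonneg: "0 \<le> cutoff n x"
  by (simp add: cutoff_def flat_def)

lemma cutoff_le_one: "cutoff n x \<le> 1"
  by (simp add: cutoff_def flat_def)

definition cutoff_support :: "nat \<Rightarrow> real set" where
  "cutoff_support n = {x \<in> {0..pi}. 1 \<le> real n * sin x}"

lemma cutoff_support: "compact (cutoff_support n)" "cutoff_support n \<subseteq> {0<..<pi}"
proof -
  have "closed {x. 1 \<le> real n * sin x}"
    by (intro closed_Collect_le continuous_intros)
  moreover have "cutoff_support n = {0..pi} \<inter> {x. 1 \<le> real n * sin x}"
    by (auto simp: cutoff_support_def)
  ultimately show "compact (cutoff_support n)" by (auto intro: compact_Int_closed)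
  show "cutoff_support n \<subseteq> {0<..<pi}"
    by (auto simp: cutoff_support_def less_le)
qed

lemma cutoff_eq_0: "x \<notin> cutoff_support n \<Longrightarrow> cutoff n x = 0"
  by (auto simp: cutoff_def flat_def cutoff_support_def)

lemma cutoff_test_function:
  assumes "\<And>k. diff_times k {0<..<pi} g"
  shows "test_function {0<..<pi} (\<lambda>x. cutoff n x * g x)"
proof (rule test_functionI[OF _ cutoff_support[of n]])
  fix k
  have "diff_times k {0<..<pi} (\<lambda>x. flat 1 (real n * sin x + 0 * cos x + (-1)))"
    by (rule diff_times_compose[OF _ diff_times_flat diff_times_sin_cos]) (rule UNIV_I)
  then have "diff_times k {0<..<pi} (cutoff n)"
    by (rule diff_times_cong[rotated 2]) (auto simp: cutoff_def)
  then show "diff_times k {0<..<pi} (\<lambda>x. cutoff n x * g x)"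
    by (intro diff_times_mult assms)
qed (auto simp: cutoff_eq_0)

lemma cutoff_pos:
  assumes "0 < x" "x < pi"
  shows "\<exists>n. cutoff n x > 0"
proof -
  have "sin x > 0" using assms by (rule sin_gt_zero)
  then obtain n where "real n * sin x > 1"
    using reals_Archimedean3 by blast
  then show ?thesis using assms by (auto simp: cutoff_def flat_def)
qed

lemma multiple_of_sin_at_top:
  assumes "0 < x" "x < pi"
  shows "filterlim (\<lambda>n. real n * sin x - 1) at_top sequentially"
proof -
  have "filterlim (\<lambda>n. -1 + sin x * real n) at_top sequentially"
    using sin_gt_zero[OF assms]
    by (intro filterlim_tendsto_add_at_top[OF tendsto_const]
        filterlim_tendsto_pos_mult_at_top[OF tendsto_const] filterlim_real_sequentially)
  then show ?thesis by (simp add: mult.commute)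
qed

lemma flat_le: "\<bar>flat [:0, 0, 1:] t\<bar> \<le> (1 / t)\<^sup>2"
  by (auto simp: flat_def power2_eq_square divide_simps)

lemma cutoff_tendsto:
  assumes x: "0 < x" "x < pi"
  shows "(\<lambda>n. cutoff n x) \<longlonglongrightarrow> 1"
proof (rule Lim_transform_eventually)
  have "(\<lambda>n. inverse (real n * sin x - 1)) \<longlonglongrightarrow> 0"
    using filterlim_compose[OF tendsto_inverse_0_at_top[OF filterlim_ident] multiple_of_sin_at_top[OF x]] by simp
  then have "(\<lambda>n. exp (- inverse (real n * sin x - 1))) \<longlonglongrightarrow> exp (- 0)"
    by (intro tendsto_intros)
  then show "(\<lambda>n. exp (- inverse (real n * sin x - 1))) \<longlonglongrightarrow> 1" by simp
  have "\<forall>\<^sub>F n in sequentially. real n * sin x - 1 > 0"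
    using multiple_of_sin_at_top[OF x] unfolding filterlim_at_top_dense by blast
  then show "\<forall>\<^sub>F n in sequentially. exp (- inverse (real n * sin x - 1)) = cutoff n x"
    by eventually_elim (use x in \<open>simp add: cutoff_def flat_def inverse_eq_divide\<close>)
qed

definition cutoff_deriv :: "nat \<Rightarrow> real \<Rightarrow> real" where
  "cutoff_deriv n x = flat [:0, 0, 1:] (real n * sin x - 1) * (real n * cos x)"

lemma DERIV_cutoff:
  assumes "0 < x" "x < pi"
  shows "(cutoff n has_real_derivative cutoff_deriv n x) (at x)"
proof -
  have "((\<lambda>x. flat 1 (real n * sin x - 1)) has_real_derivative cutoff_deriv n x) (at x)"
    unfolding cutoff_deriv_def using DERIV_flat[of 1 "real n * sin x - 1"]
    by (intro DERIV_chain2[of "flat 1"]) (auto intro!: derivative_eq_intros simp: one_pCons pderiv_pCons)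
  then show ?thesis
    by (rule has_field_derivative_transform_within_open[where S = "{0<..<pi}"])
       (use assms in \<open>auto simp: cutoff_def\<close>)
qed

text \<open>In terms of \<open>s = 1 / (n sin x - 1)\<close> the quantity is at most \<open>(s\<^sup>2 + s) exp (- s)\<close>, and \<open>exp
  s \<ge> 1 + s + s\<^sup>2 / 2\<close>.\<close>

lemma cutoff_deriv_bound:
  assumes "0 < x" "x < pi"
  shows "\<bar>cutoff_deriv n x * sin x\<bar> \<le> 2"
proof (cases "real n * sin x - 1 > 0")
  case True
  define s where "s = 1 / (real n * sin x - 1)"
  have s: "s > 0" using True by (simp add: s_def)
  then have "real n * sin x = 1 + 1 / s" by (simp add: s_def)
  then have "cutoff_deriv n x * sin x = (s\<^sup>2 * exp (- s) * (1 + 1 / s)) * cos x"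
    using True by (simp add: cutoff_deriv_def flat_def flip: s_def) (simp add: power2_eq_square mult_ac)
  also have "s\<^sup>2 * exp (- s) * (1 + 1 / s) = (s\<^sup>2 + s) / exp s"
    using s by (simp add: field_simps power2_eq_square exp_minus)
  finally have eq: "\<bar>cutoff_deriv n x * sin x\<bar> = (s\<^sup>2 + s) / exp s * \<bar>cos x\<bar>"
    using s by (simp add: abs_mult)
  have "(s\<^sup>2 + s) / exp s \<le> 2"
    using exp_lower_Taylor_quadratic[of s] s by (simp add: divide_le_eq)
  then have "(s\<^sup>2 + s) / exp s * \<bar>cos x\<bar> \<le> 2 * 1"
    using s by (intro mult_mono) auto
  then show ?thesis by (simp add: eq)
qed (simp add: cutoff_deriv_def flat_def)

lemma cutoff_deriv_tendsto:
  assumes x: "0 < x" "x < pi"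
  shows "(\<lambda>n. cutoff_deriv n x) \<longlonglongrightarrow> 0"
proof (rule Lim_null_comparison)
  have s: "sin x > 0" using x by (rule sin_gt_zero)
  have "(\<lambda>n. 4 / (sin x)\<^sup>2 * inverse (real n)) \<longlonglongrightarrow> 4 / (sin x)\<^sup>2 * 0"
    by (intro tendsto_intros lim_inverse_n)
  then show "(\<lambda>n. 4 / (sin x)\<^sup>2 * inverse (real n)) \<longlonglongrightarrow> 0" by simp
  have "\<forall>\<^sub>F n in sequentially. real n * sin x - 1 > 1"
    using multiple_of_sin_at_top[OF x] unfolding filterlim_at_top_dense by blast
  then show "\<forall>\<^sub>F n in sequentially. norm (cutoff_deriv n x) \<le> 4 / (sin x)\<^sup>2 * inverse (real n)"
  proof eventually_elim
    case (elim n)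
    then have n: "real n > 0" by (cases n) auto
    have half: "real n * sin x / 2 \<le> real n * sin x - 1"
      using elim by simp
    have "1 / (real n * sin x - 1) \<le> 1 / (real n * sin x / 2)"
      using n s elim half by (intro divide_left_mono) auto
    then have "(1 / (real n * sin x - 1))\<^sup>2 \<le> (1 / (real n * sin x / 2))\<^sup>2"
      using elim by (intro power_mono) auto
    then have flat: "\<bar>flat [:0, 0, 1:] (real n * sin x - 1)\<bar> \<le> (1 / (real n * sin x / 2))\<^sup>2"
      using flat_le order_trans by blast
    have "norm (cutoff_deriv n x) = \<bar>flat [:0, 0, 1:] (real n * sin x - 1)\<bar> * (real n * \<bar>cos x\<bar>)"
      by (simp add: cutoff_deriv_def abs_mult)
    also have "\<dots> \<le> (1 / (real n * sin x / 2))\<^sup>2 * (real n * 1)"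
      using flat by (intro mult_mono) auto
    also have "\<dots> = 4 / (sin x)\<^sup>2 * inverse (real n)"
      using n s by (simp add: field_simps power2_eq_square)
    finally show ?case .
  qed
qed

section \<open>The weak derivative and the form\<close>

lemma omega_continuous: "continuous_on S omega"
  unfolding omega_def by (intro continuous_intros)

lemma omega_lower_bound:
  assumes "compact K" "K \<subseteq> {0<..<pi}"
  obtains m where "m > 0" "\<And>x. x \<in> K \<Longrightarrow> m \<le> omega x"
proof (cases "K = {}")
  case True
  then show thesis by (intro that[of 1]) auto
next
  case False
  then obtain y where "y \<in> K" "\<And>x. x \<in> K \<Longrightarrow> omega y \<le> omega x"
    using continuous_attains_inf[OF assms(1) False omega_continuous] by blast
  then show thesis
    using assms(2) omega_pos by (intro that[of "omega y"]) auto
qed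

text \<open>The inner product with \<open>over_omega g\<close> is the unweighted integral against \<open>g\<close>. This turns the
  pairings with test functions, which occur in weak derivatives, into inner products of the
  weighted space.\<close>

definition over_omega :: "(real \<Rightarrow> real) \<Rightarrow> weighted_L2" where
  "over_omega g = L2_class (\<lambda>x. complex_of_real (g x / omega x))"

lemma square_integrable_over_omega:
  assumes "continuous_on UNIV g" "compact K" "K \<subseteq> {0<..<pi}" "\<And>x. x \<notin> K \<Longrightarrow> g x = 0"
  shows "square_integrable (\<lambda>x. complex_of_real (g x / omega x))"
proof -
  obtain m where m: "m > 0" "\<And>x. x \<in> K \<Longrightarrow> m \<le> omega x"
    by (rule omega_lower_bound[OF assms(2,3)]) blast
  have "compact (g ` K)"
    using assms(1,2) by (intro compact_continuous_image) (auto intro: continuous_on_subset)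
  then obtain B where B: "B > 0" "\<forall>y\<in>g ` K. norm y \<le> B"
    using compact_imp_bounded bounded_pos by metis
  have [measurable]: "g \<in> borel_measurable borel"
    by (rule borel_measurable_continuous_onI[OF assms(1)])
  show ?thesis
  proof (rule square_integrable_bounded[of _ "B / m"])
    fix x :: real
    show "cmod (complex_of_real (g x / omega x)) \<le> B / m"
    proof (cases "x \<in> K")
      case True
      then have "\<bar>g x\<bar> \<le> B" "m \<le> omega x" using B m by auto
      then show ?thesis
        using m(1) B(1) by (simp add: norm_divide) (intro frac_le, auto)
    next
      case False
      then show ?thesis using assms(4) m B by simp
    qed
  qed measurable
qed

lemma cinner_over_omega:
  assumes "square_integrable u" "square_integrable (\<lambda>x. complex_of_real (g x / omega x))"
  shows "cinner (L2_class u) (over_omega g) = (LBINT x:{0<..<pi}. u x * complex_of_real (g x))"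
proof -
  have m: "(\<lambda>x. u x * cnj (complex_of_real (g x / omega x))) \<in> borel_measurable omega_measure"
    using square_integrable_mult_cnj[OF assms] by (rule borel_measurable_integrable)
  have "cinner (L2_class u) (over_omega g) =
      (LBINT x:{0<..<pi}. omega x *\<^sub>R (u x * cnj (complex_of_real (g x / omega x))))"
    unfolding over_omega_def cinner_L2_class[OF assms] by (rule integral_omega[OF m])
  also have "\<dots> = (LBINT x:{0<..<pi}. u x * complex_of_real (g x))"
    using omega_pos by (intro set_lebesgue_integral_cong) (force simp: scaleR_conv_of_real)+
  finally show ?thesis .
qed

lemma
  assumes "test_function {0<..<pi} \<psi>"
  shows square_integrable_test: "square_integrable (\<lambda>x. complex_of_real (\<psi> x / omega x))"
    and square_integrable_test_deriv: "square_integrable (\<lambda>x. complex_of_real (deriv \<psi> x / omega x))"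
proof -
  obtain K where K: "compact K" "K \<subseteq> {0<..<pi}"
    and zero: "\<forall>x. x \<notin> K \<longrightarrow> \<psi> x = 0 \<and> deriv \<psi> x = 0"
    using test_function_support[OF assms] by blast
  show "square_integrable (\<lambda>x. complex_of_real (\<psi> x / omega x))"
    using zero by (intro square_integrable_over_omega[OF test_function_continuous[OF assms] K]) auto
  show "square_integrable (\<lambda>x. complex_of_real (deriv \<psi> x / omega x))"
    using zero by (intro square_integrable_over_omega[OF test_function_deriv_continuous[OF assms] K]) auto
qed

text \<open>The weak derivative as an unbounded operator of the weighted space into itself. Being
  defined by inner products with fixed vectors it is evidently linear and closed; the form is \<open>4 *
  cinner d e\<close> for the images \<open>d, e\<close> of its arguments, and its domain is the domain of this
  operator.\<close>

definition weak_deriv_rel :: "weighted_L2 rel" where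
  "weak_deriv_rel = {(f, d). \<forall>\<psi>. test_function {0<..<pi} \<psi> \<longrightarrow>
     cinner f (over_omega (deriv \<psi>)) = - cinner d (over_omega \<psi>)}"

lemma weak_deriv_rel_iff:
  assumes "square_integrable u" "square_integrable v"
  shows "(L2_class u, L2_class v) \<in> weak_deriv_rel \<longleftrightarrow> has_weak_derivative {0<..<pi} u v"
proof -
  have "cinner (L2_class u) (over_omega (deriv \<psi>))
      = (LBINT x:{0<..<pi}. u x * complex_of_real (deriv \<psi> x))"
    "cinner (L2_class v) (over_omega \<psi>) = (LBINT x:{0<..<pi}. v x * complex_of_real (\<psi> x))"
    if "test_function {0<..<pi} \<psi>" for \<psi>
    by (rule cinner_over_omega assms square_integrable_test square_integrable_test_deriv that)+
  then show ?thesis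
    by (simp add: weak_deriv_rel_def has_weak_derivative_def cong: imp_cong)
qed

lemma weak_deriv_rel_closed:
  assumes "\<And>n. (s n, t n) \<in> weak_deriv_rel" "s \<longlonglongrightarrow> f" "t \<longlonglongrightarrow> d"
  shows "(f, d) \<in> weak_deriv_rel"
proof -
  have "cinner f (over_omega (deriv \<psi>)) = - cinner d (over_omega \<psi>)"
    if "test_function {0<..<pi} \<psi>" for \<psi>
  proof (rule LIMSEQ_unique)
    show "(\<lambda>n. cinner (s n) (over_omega (deriv \<psi>))) \<longlonglongrightarrow> cinner f (over_omega (deriv \<psi>))"
      by (intro tendsto_cinner assms tendsto_const)
    have "cinner (s n) (over_omega (deriv \<psi>)) = - cinner (t n) (over_omega \<psi>)" for n
      using assms(1) that by (auto simp: weak_deriv_rel_def)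
    then show "(\<lambda>n. cinner (s n) (over_omega (deriv \<psi>))) \<longlonglongrightarrow> - cinner d (over_omega \<psi>)"
      by (simp only:) (intro tendsto_minus tendsto_cinner assms tendsto_const)
  qed
  then show ?thesis by (simp add: weak_deriv_rel_def)
qed

lemma weak_deriv_rel_add:
  "(f, d) \<in> weak_deriv_rel \<Longrightarrow> (f', d') \<in> weak_deriv_rel \<Longrightarrow> (f + f', d + d') \<in> weak_deriv_rel"
  by (auto simp: weak_deriv_rel_def cinner_add_left)

lemma weak_deriv_rel_scaleC:
  "(f, d) \<in> weak_deriv_rel \<Longrightarrow> (c *\<^sub>C f, c *\<^sub>C d) \<in> weak_deriv_rel"
  by (auto simp: weak_deriv_rel_def cinner_scaleC_left)

lemma weak_deriv_rel_diff:
  "(f, d) \<in> weak_deriv_rel \<Longrightarrow> (f', d') \<in> weak_deriv_rel \<Longrightarrow> (f - f', d - d') \<in> weak_deriv_rel"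
  by (auto simp: weak_deriv_rel_def cinner_diff_left)

lemma L2_loc_measurable: "L2_loc {0<..<pi} v \<Longrightarrow> v \<in> borel_measurable omega_measure"
  by (simp add: L2_loc_def set_borel_measurable_def borel_measurable_omega_iff)

text \<open>On a compact subset of \<open>(0, \<pi>)\<close> the weight is bounded away from zero.\<close>

lemma square_integrable_imp_L2_loc:
  assumes "square_integrable u"
  shows "L2_loc {0<..<pi} u"
  unfolding L2_loc_def
proof (intro conjI allI impI)
  have m: "u \<in> borel_measurable omega_measure"
    using assms by (simp add: square_integrable_def)
  then show um: "set_borel_measurable lborel {0<..<pi} u"
    by (simp add: set_borel_measurable_def borel_measurable_omega_iff)
  fix K :: "real set" assume K: "compact K" "K \<subseteq> {0<..<pi}"
  obtain c where c: "c > 0" "\<And>x. x \<in> K \<Longrightarrow> c \<le> omega x"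
    by (rule omega_lower_bound[OF K]) blast
  have Kb: "K \<in> sets borel" using K(1) by (simp add: borel_compact)
  have "set_integrable lborel {0<..<pi} (\<lambda>x. omega x *\<^sub>R (cmod (u x))\<^sup>2)"
    using assms m by (subst integrable_omega[symmetric]) (auto simp: square_integrable_def)
  then have int: "set_integrable lborel K (\<lambda>x. omega x *\<^sub>R (cmod (u x))\<^sup>2)"
    by (rule set_integrable_subset) (use Kb K(2) in auto)
  then have "integrable lborel (\<lambda>x. (1 / c) * (indicator K x *\<^sub>R (omega x *\<^sub>R (cmod (u x))\<^sup>2)))"
    by (intro integrable_mult_right) (simp add: set_integrable_def)
  then show "set_integrable lborel K (\<lambda>x. (cmod (u x))\<^sup>2)"
    unfolding set_integrable_def
  proof (rule Bochner_Integration.integrable_bound)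
    have "(\<lambda>x. indicator K x *\<^sub>R (cmod (indicator {0<..<pi} x *\<^sub>R u x))\<^sup>2)
        \<in> borel_measurable lborel"
      using um Kb unfolding set_borel_measurable_def by measurable
    also have "(\<lambda>x. indicator K x *\<^sub>R (cmod (indicator {0<..<pi} x *\<^sub>R u x))\<^sup>2) =
        (\<lambda>x. indicator K x *\<^sub>R (cmod (u x))\<^sup>2)"
      using K(2) by (auto simp: fun_eq_iff indicator_def)
    finally show "(\<lambda>x. indicator K x *\<^sub>R (cmod (u x))\<^sup>2) \<in> borel_measurable lborel" .
    have "(cmod (u x))\<^sup>2 \<le> \<bar>omega x\<bar> * (cmod (u x))\<^sup>2 / c" if "x \<in> K" for x
    proof -
      have "c * (cmod (u x))\<^sup>2 \<le> \<bar>omega x\<bar> * (cmod (u x))\<^sup>2"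
        using c that by (intro mult_right_mono) force+
      then show ?thesis using c(1) by (simp add: field_simps)
    qed
    then show "AE x in lborel. norm (indicator K x *\<^sub>R (cmod (u x))\<^sup>2)
        \<le> norm ((1 / c) * (indicator K x *\<^sub>R (omega x *\<^sub>R (cmod (u x))\<^sup>2)))"
      using c(1) by (auto simp: indicator_def abs_mult)
  qed
qed

lemma square_integrable_cutoff:
  assumes v: "L2_loc {0<..<pi} v"
  shows "square_integrable (\<lambda>x. v x * complex_of_real (cutoff n x / omega x))"
  unfolding square_integrable_def
proof
  let ?K = "cutoff_support n"
  note K = cutoff_support[of n]
  have [measurable]: "v \<in> borel_measurable omega_measure"
    by (rule L2_loc_measurable[OF v])
  have "cutoff n \<in> borel_measurable borel"
    using test_function_continuous[OF cutoff_test_function[of "poly 1" n]] diff_times_poly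
    by (intro borel_measurable_continuous_onI) simp
  note [measurable] = this
  show m: "(\<lambda>x. v x * complex_of_real (cutoff n x / omega x)) \<in> borel_measurable omega_measure"
    by measurable
  obtain c where c: "c > 0" "\<And>x. x \<in> ?K \<Longrightarrow> c \<le> omega x"
    by (rule omega_lower_bound[OF K]) blast
  have "integrable lborel (\<lambda>x. (1 / c) * (indicator ?K x *\<^sub>R (cmod (v x))\<^sup>2))"
    using v K unfolding L2_loc_def set_integrable_def by (intro integrable_mult_right) blast
  then have "set_integrable lborel {0<..<pi}
      (\<lambda>x. omega x *\<^sub>R (cmod (v x * complex_of_real (cutoff n x / omega x)))\<^sup>2)"
    unfolding set_integrable_def
  proof (rule Bochner_Integration.integrable_bound)
    have "(\<lambda>x. omega x *\<^sub>R (cmod (v x * complex_of_real (cutoff n x / omega x)))\<^sup>2)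
        \<in> borel_measurable omega_measure"
      by measurable
    then show "(\<lambda>x. indicator {0<..<pi} x *\<^sub>R omega x *\<^sub>R
        (cmod (v x * complex_of_real (cutoff n x / omega x)))\<^sup>2) \<in> borel_measurable lborel"
      unfolding borel_measurable_omega_iff by simp
    have "omega x * (cmod (v x * complex_of_real (cutoff n x / omega x)))\<^sup>2
        \<le> (1 / c) * (cmod (v x))\<^sup>2"
      if x: "x \<in> ?K" for x
    proof -
      have w: "omega x > 0" using K(2) x omega_pos by auto
      have "(cutoff n x)\<^sup>2 \<le> 1"
        using cutoff_nonneg cutoff_le_one by (simp add: power_le_one)
      then have "(cutoff n x)\<^sup>2 / omega x \<le> 1 / c"
        using c x w by (intro frac_le) auto
      then have "(cmod (v x))\<^sup>2 * ((cutoff n x)\<^sup>2 / omega x) \<le> (cmod (v x))\<^sup>2 * (1 / c)"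
        by (intro mult_left_mono) auto
      then show ?thesis
        using w by (simp add: norm_mult norm_divide power_mult_distrib power_divide power2_eq_square mult_ac)
    qed
    then show "AE x in lborel. norm (indicator {0<..<pi} x *\<^sub>R omega x *\<^sub>R
        (cmod (v x * complex_of_real (cutoff n x / omega x)))\<^sup>2) \<le>
        norm ((1 / c) * (indicator ?K x *\<^sub>R (cmod (v x))\<^sup>2))"
      using c K(2) omega_pos
      by (intro AE_I2) (auto simp: indicator_def cutoff_eq_0 abs_of_pos abs_mult)
  qed
  then show "integrable omega_measure (\<lambda>x. (cmod (v x * complex_of_real (cutoff n x / omega x)))\<^sup>2)"
    by (subst integrable_omega) measurable
qed

text \<open>The cutoff times a polynomial in the cosine is a test function. Hence the classes of \<open>v *
  cutoff n / omega\<close> and \<open>v' * cutoff n / omega\<close> have the same inner products with all these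
  polynomials and agree by density; every point of the interval lies where some cutoff is
  positive.\<close>

lemma weak_derivative_unique:
  assumes v: "L2_loc {0<..<pi} v" "L2_loc {0<..<pi} v'"
    and weak: "has_weak_derivative {0<..<pi} u v" "has_weak_derivative {0<..<pi} u v'"
  shows "AE x in omega_measure. v x = v' x"
proof -
  let ?r = "\<lambda>v n x. v x * complex_of_real (cutoff n x / omega x)"
  have pairing: "cinner (L2_class (?r v n)) (cos_poly p) =
      (LBINT x:{0<..<pi}. v x * complex_of_real (cutoff n x * poly p (cos x)))"
    if "L2_loc {0<..<pi} v" for v n p
  proof -
    note sq = square_integrable_cutoff[OF that, of n] square_integrable_poly_cos[of p]
    have "cinner (L2_class (?r v n)) (cos_poly p) =
        (LBINT x:{0<..<pi}. omega x *\<^sub>R (?r v n x * cnj (complex_of_real (poly p (cos x)))))"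
      unfolding cos_poly_def cinner_L2_class[OF sq]
      by (rule integral_omega[OF borel_measurable_integrable[OF square_integrable_mult_cnj[OF sq]]])
    also have "\<dots> = (LBINT x:{0<..<pi}. v x * complex_of_real (cutoff n x * poly p (cos x)))"
      using omega_pos by (intro set_lebesgue_integral_cong) (force simp: scaleR_conv_of_real)+
    finally show ?thesis .
  qed
  have "AE x in omega_measure. ?r v n x = ?r v' n x" for n
  proof -
    have "cinner (L2_class (?r v n)) (cos_poly p) = cinner (L2_class (?r v' n)) (cos_poly p)" for p
    proof -
      let ?\<psi> = "\<lambda>x. cutoff n x * poly p (cos x)"
      have "test_function {0<..<pi} ?\<psi>"
        by (intro cutoff_test_function diff_times_poly_cos)
      then have "(LBINT x:{0<..<pi}. u x * complex_of_real (deriv ?\<psi> x)) =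
            - (LBINT x:{0<..<pi}. v x * complex_of_real (?\<psi> x))"
          "(LBINT x:{0<..<pi}. u x * complex_of_real (deriv ?\<psi> x)) =
            - (LBINT x:{0<..<pi}. v' x * complex_of_real (?\<psi> x))"
        using weak unfolding has_weak_derivative_def by blast+
      then show ?thesis
        unfolding pairing[OF v(1)] pairing[OF v(2)] by simp
    qed
    then have "L2_class (?r v n) - L2_class (?r v' n) = 0"
      by (intro orthogonal_to_dense_imp_zero[OF cos_poly_dense]) (auto simp: cinner_diff_left)
    then show ?thesis
      using square_integrable_cutoff[OF v(1)] square_integrable_cutoff[OF v(2)]
      by (simp add: L2_class_eq_iff)
  qed
  then have "AE x in omega_measure. \<forall>n. ?r v n x = ?r v' n x"
    unfolding AE_all_countable by blast
  then show ?thesis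
    unfolding AE_omega
  proof eventually_elim
    case (elim x)
    show ?case
    proof
      assume x: "0 < x \<and> x < pi"
      then obtain n where "cutoff n x > 0" using cutoff_pos by blast
      moreover have "omega x > 0" using x omega_pos by blast
      ultimately show "v x = v' x" using elim x by (auto dest: spec[of _ n])
    qed
  qed
qed

lemma set_integrable_omega_square:
  assumes "L2_loc {0<..<pi} v"
  shows "set_integrable lborel {0<..<pi} (\<lambda>x. omega x * (cmod (v x))\<^sup>2) \<longleftrightarrow> square_integrable v"
proof -
  have m: "v \<in> borel_measurable omega_measure" by (rule L2_loc_measurable[OF assms])
  then show ?thesis
    using integrable_omega[of "\<lambda>x. (cmod (v x))\<^sup>2"] by (simp add: square_integrable_def)
qed

text \<open>By uniqueness the chosen \<^const>\<open>weak_derivative\<close> agrees almost everywhere with any representative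
  of \<open>d\<close>.\<close>

lemma weak_derivativeI:
  assumes "(f, d) \<in> weak_deriv_rel"
  shows "f \<in> form_domain" "square_integrable (weak_derivative f)" "L2_class (weak_derivative f) = d"
proof -
  obtain v where v: "square_integrable v" "d = L2_class v" by (rule L2_class_cases)
  have sq: "square_integrable (representative f)" and f: "L2_class (representative f) = f"
    by (rule square_integrable_representative, rule L2_class_representative)
  have hv: "L2_loc {0<..<pi} v" "has_weak_derivative {0<..<pi} (representative f) v"
    using assms weak_deriv_rel_iff[OF sq v(1)]
        by (auto simp: f v(2) square_integrable_imp_L2_loc[OF v(1)])
  then have "\<exists>v. L2_loc {0<..<pi} v \<and> has_weak_derivative {0<..<pi} (representative f) v"
    by blast
  then have "L2_loc {0<..<pi} (weak_derivative f) \<and>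
      has_weak_derivative {0<..<pi} (representative f) (weak_derivative f)"
    unfolding weak_derivative_def by (rule someI_ex)
  then have wd: "L2_loc {0<..<pi} (weak_derivative f)"
    "has_weak_derivative {0<..<pi} (representative f) (weak_derivative f)"
    by blast+
  have ae: "AE x in omega_measure. weak_derivative f x = v x"
    by (rule weak_derivative_unique[OF wd(1) hv(1) wd(2) hv(2)])
  have "integrable omega_measure (\<lambda>x. (cmod (weak_derivative f x))\<^sup>2)"
  proof (rule Bochner_Integration.integrable_cong_AE_imp)
    show "integrable omega_measure (\<lambda>x. (cmod (v x))\<^sup>2)"
      using v(1) by (simp add: square_integrable_def)
    show "AE x in omega_measure. (cmod (v x))\<^sup>2 = (cmod (weak_derivative f x))\<^sup>2"
      using ae by eventually_elim simp
  qed (use L2_loc_measurable[OF wd(1)] in measurable)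
  then show sqw: "square_integrable (weak_derivative f)"
    using L2_loc_measurable[OF wd(1)] by (simp add: square_integrable_def)
  show "L2_class (weak_derivative f) = d"
    using ae by (simp add: v(2) L2_class_eq_iff[OF sqw v(1)])
  show "f \<in> form_domain"
    unfolding form_domain_def H1_loc_def
    using wd sqw set_integrable_omega_square[OF wd(1)] square_integrable_imp_L2_loc[OF sq] by blast
qed

lemma form_domainE:
  assumes "f \<in> form_domain"
  obtains d where "(f, d) \<in> weak_deriv_rel"
proof -
  have "\<exists>v. L2_loc {0<..<pi} v \<and> has_weak_derivative {0<..<pi} (representative f) v"
    using assms unfolding form_domain_def H1_loc_def by blast
  then have "L2_loc {0<..<pi} (weak_derivative f) \<and>
      has_weak_derivative {0<..<pi} (representative f) (weak_derivative f)"
    unfolding weak_derivative_def by (rule someI_ex)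
  then have wd: "L2_loc {0<..<pi} (weak_derivative f)"
    "has_weak_derivative {0<..<pi} (representative f) (weak_derivative f)"
    by blast+
  then have "square_integrable (weak_derivative f)"
    using assms set_integrable_omega_square by (simp add: form_domain_def)
  then have "(f, L2_class (weak_derivative f)) \<in> weak_deriv_rel"
    using weak_deriv_rel_iff[OF square_integrable_representative[of f]] wd(2)
    by (simp add: L2_class_representative)
  then show thesis by (rule that)
qed

lemma form_a0_eq:
  assumes "(f, d) \<in> weak_deriv_rel" "(g, e) \<in> weak_deriv_rel"
  shows "form_a0 f g = 4 * cinner d e"
proof -
  note F = weak_derivativeI[OF assms(1)] and G = weak_derivativeI[OF assms(2)]
  have "cinner d e = (LBINT x:{0<..<pi}. omega x *\<^sub>R (weak_derivative f x * cnj (weak_derivative g x)))"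
    unfolding F(3)[symmetric] G(3)[symmetric] cinner_L2_class[OF F(2) G(2)]
    by (rule integral_omega[OF borel_measurable_integrable[OF square_integrable_mult_cnj[OF F(2) G(2)]]])
  then show ?thesis
    by (simp add: form_a0_def scaleR_conv_of_real mult.assoc)
qed

lemma A0_iff:
  assumes "(f, d) \<in> weak_deriv_rel"
  shows "(f, g) \<in> A0 \<longleftrightarrow> (\<forall>(h, k) \<in> weak_deriv_rel. 4 * cinner d k = cinner g h)"
proof
  assume "(f, g) \<in> A0"
  then show "\<forall>(h, k) \<in> weak_deriv_rel. 4 * cinner d k = cinner g h"
    using weak_derivativeI(1) form_a0_eq[OF assms] by (fastforce simp: A0_def)
next
  assume *: "\<forall>(h, k) \<in> weak_deriv_rel. 4 * cinner d k = cinner g h"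
  have "form_a0 f h = cinner g h" if "h \<in> form_domain" for h
    using that
  proof (rule form_domainE)
    fix k assume "(h, k) \<in> weak_deriv_rel"
    then show ?thesis using * form_a0_eq[OF assms] by fastforce
  qed
  then show "(f, g) \<in> A0"
    using weak_derivativeI(1)[OF assms] by (simp add: A0_def)
qed

section \<open>Integration by parts against the flux\<close>

definition cos_poly_deriv :: "real poly \<Rightarrow> weighted_L2" where
  "cos_poly_deriv p = L2_class (\<lambda>\<phi>. complex_of_real (- sin \<phi> * poly (pderiv p) (cos \<phi>)))"

lemma square_integrable_cos_poly_deriv:
  "square_integrable (\<lambda>x. complex_of_real (- sin x * poly (pderiv p) (cos x)))"
proof -
  obtain B where B: "B > 0" "\<And>x::real. \<bar>poly (pderiv p) (cos x)\<bar> \<le> B"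
    using poly_cos_bounded[of "pderiv p"] by blast
  show ?thesis
  proof (rule square_integrable_bounded[of _ "1 * B"])
    show "cmod (complex_of_real (- sin x * poly (pderiv p) (cos x))) \<le> 1 * B" for x
      unfolding norm_of_real abs_mult using B by (intro mult_mono) auto
  qed measurable
qed

lemma DERIV_poly_cos:
  "((\<lambda>x. poly p (cos x)) has_real_derivative - sin x * poly (pderiv p) (cos x)) (at x)"
  using DERIV_chain2[OF poly_DERIV DERIV_cos, of p x] by (simp add: mult.commute)

text \<open>The test function vanishes at both ends of the interval, so integration by parts on \<open>[0, \<pi>]\<close>
  has no boundary terms.\<close>

lemma cos_poly_weak_deriv: "(cos_poly p, cos_poly_deriv p) \<in> weak_deriv_rel"
  unfolding cos_poly_def cos_poly_deriv_def
    weak_deriv_rel_iff[OF square_integrable_poly_cos square_integrable_cos_poly_deriv]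
    has_weak_derivative_def
proof (intro allI impI)
  fix \<psi> assume t: "test_function {0<..<pi} \<psi>"
  let ?F = "\<lambda>x::real. poly p (cos x)" and ?f = "\<lambda>x::real. - sin x * poly (pderiv p) (cos x)"
  obtain K where K: "K \<subseteq> {0<..<pi}" "\<forall>x. x \<notin> K \<longrightarrow> \<psi> x = 0 \<and> deriv \<psi> x = 0"
    using test_function_support[OF t] by blast
  then have "0 \<notin> K" "pi \<notin> K" by auto
  with K(2) have z: "\<psi> 0 = 0" "deriv \<psi> 0 = 0" "\<psi> pi = 0" "deriv \<psi> pi = 0"
    by auto
  have parts: "(\<integral>x. (?F x * deriv \<psi> x) * indicator {0..pi} x \<partial>lborel) =
      ?F pi * \<psi> pi - ?F 0 * \<psi> 0 - (\<integral>x. (?f x * \<psi> x) * indicator {0..pi} x \<partial>lborel)"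
  proof (rule integral_by_parts)
    show "isCont ?f x" for x by (intro continuous_intros)
    show "isCont (deriv \<psi>) x" for x
      using test_function_deriv_continuous[OF t] by (simp add: continuous_on_eq_continuous_at)
    show "(?F has_real_derivative ?f x) (at x)" for x by (rule DERIV_poly_cos)
    show "(\<psi> has_real_derivative deriv \<psi> x) (at x)" for x by (rule test_function_DERIV[OF t])
  qed simp
  have F: "(\<lambda>x. (?F x * deriv \<psi> x) * indicator {0..pi} x)
      = (\<lambda>x. indicator {0<..<pi} x *\<^sub>R (?F x * deriv \<psi> x))"
    using z by (auto simp: fun_eq_iff indicator_def less_le)
  have f: "(\<lambda>x. (?f x * \<psi> x) * indicator {0..pi} x) = (\<lambda>x. indicator {0<..<pi} x *\<^sub>R (?f x * \<psi> x))"
    using z by (auto simp: fun_eq_iff indicator_def less_le)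
  have "(LBINT x:{0<..<pi}. ?F x * deriv \<psi> x) = - (LBINT x:{0<..<pi}. ?f x * \<psi> x)"
    using parts unfolding F f z set_lebesgue_integral_def by simp
  then have "complex_of_real (LBINT x:{0<..<pi}. ?F x * deriv \<psi> x) =
      - complex_of_real (LBINT x:{0<..<pi}. ?f x * \<psi> x)"
    by simp
  then show "(LBINT x:{0<..<pi}. complex_of_real (?F x) * complex_of_real (deriv \<psi> x)) =
      - (LBINT x:{0<..<pi}. complex_of_real (?f x) * complex_of_real (\<psi> x))"
    unfolding of_real_mult[symmetric] set_integral_complex_of_real .
qed

lemma poly_gegenbauer_op:
  "poly (gegenbauer_op (1/4) p) (cos x) =
    (sin x)\<^sup>2 * poly (pderiv (pderiv p)) (cos x) - 3 / 2 * (cos x * poly (pderiv p) (cos x))"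
proof -
  have "(sin x)\<^sup>2 = 1 - cos x * cos x"
    using sin_squared_eq[of x] by (simp add: power2_eq_square)
  show ?thesis
    unfolding \<open>(sin x)\<^sup>2 = _\<close> by (simp add: gegenbauer_op_def algebra_simps)
qed

text \<open>This is where the vanishing of the flux at the ends of the interval enters. The flux \<open>omega
  u'\<close> of \<open>u = p \<circ> cos\<close> is \<open>- (sin x)\<^sup>3\<^sup>/\<^sup>2 p'(cos x)\<close>; multiplied by a cutoff it becomes a test
  function, for which the identity of weak derivatives holds. Removing the cutoff produces the
  additional term \<open>cutoff' * flux\<close>, which is \<open>O(omega)\<close> uniformly since the flux is \<open>O(omega sin)\<close>
  and the derivative of the cutoff is \<open>O(1 / sin)\<close>, and which tends to zero pointwise. Dominated
  convergence therefore makes it disappear.\<close>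

lemma flux_integration_by_parts:
  assumes hd: "(h, d) \<in> weak_deriv_rel"
  shows "cinner d (cos_poly_deriv p) = - cinner h (cos_poly (gegenbauer_op (1/4) p))"
proof -
  let ?q = "pderiv p"
  define \<psi> where "\<psi> n x = cutoff n x * (((-1) * sin x powr (3/2)) * poly ?q (cos x))" for n x
  have test: "test_function {0<..<pi} (\<psi> n)" for n
    unfolding \<psi>_def
  proof (intro cutoff_test_function diff_times_mult[OF _ diff_times_poly_cos])
    fix k
    have "diff_times k {0<..<pi} (\<lambda>x. (-1) * (1 * sin x + 0 * cos x + 0) powr (3/2))"
      by (rule diff_times_compose[of "{0<..<pi}" "\<lambda>x. 1 * sin x + 0 * cos x + 0" "{0<..}" k
            "\<lambda>y. (-1) * y powr (3/2)", OF _ diff_times_powr diff_times_sin_cos])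
         (simp add: sin_gt_zero)
    then show "diff_times k {0<..<pi} (\<lambda>x. (-1) * sin x powr (3/2))" by simp
  qed
  obtain B where B: "B > 0" "\<And>x::real. \<bar>poly ?q (cos x)\<bar> \<le> B"
    using poly_cos_bounded[of ?q] by blast
  obtain C where C: "C > 0" "\<And>x::real. \<bar>poly (gegenbauer_op (1/4) p) (cos x)\<bar> \<le> C"
    using poly_cos_bounded[of "gegenbauer_op (1/4) p"] by blast
  have powr: "sin x powr (3/2) = sin x * omega x" if "0 < x" "x < pi" for x
    using sin_gt_zero[OF that] powr_add[of "sin x" 1 "1/2"] by (simp add: omega_def powr_half_sqrt)
  have val: "\<psi> n x / omega x = cutoff n x * (- sin x * poly ?q (cos x))" if "0 < x" "x < pi" for n x
    using omega_pos[OF that] by (simp add: \<psi>_def powr[OF that])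
  have dval: "deriv (\<psi> n) x / omega x = (cutoff_deriv n x * sin x) * (- poly ?q (cos x)) +
      cutoff n x * poly (gegenbauer_op (1/4) p) (cos x)" if x: "0 < x" "x < pi" for n x
  proof -
    have s: "sin x > 0" using sin_gt_zero[OF x] .
    have half: "sin x powr (1/2) = omega x"
      using s by (simp add: omega_def powr_half_sqrt)
    have "((\<lambda>x. sin x powr (3/2)) has_real_derivative 3/2 * omega x * cos x) (at x)"
      using s by (auto intro!: derivative_eq_intros simp: half)
    then have "(\<psi> n has_real_derivative
        cutoff_deriv n x * (((-1) * sin x powr (3/2)) * poly ?q (cos x)) +
        (((-1) * (3/2 * omega x * cos x)) * poly ?q (cos x) +
          (- sin x * poly (pderiv ?q) (cos x)) * ((-1) * sin x powr (3/2))) * cutoff n x) (at x)"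
      unfolding \<psi>_def
      by (intro DERIV_mult DERIV_cutoff[OF x] DERIV_cmult DERIV_poly_cos)
    then have "deriv (\<psi> n) x =
        cutoff_deriv n x * (((-1) * sin x powr (3/2)) * poly ?q (cos x)) +
        (((-1) * (3/2 * omega x * cos x)) * poly ?q (cos x) +
          (- sin x * poly (pderiv ?q) (cos x)) * ((-1) * sin x powr (3/2))) * cutoff n x"
      by (rule DERIV_imp_deriv)
    also have "\<dots> = omega x * ((cutoff_deriv n x * sin x) * (- poly ?q (cos x)) +
      cutoff n x * poly (gegenbauer_op (1/4) p) (cos x))"
      by (simp add: powr[OF x] poly_gegenbauer_op power2_eq_square algebra_simps)
    finally show ?thesis
      using omega_pos[OF x] by simp
  qed
  have lim1: "(\<lambda>n. over_omega (\<psi> n)) \<longlonglongrightarrow> cos_poly_deriv p"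
    unfolding over_omega_def cos_poly_deriv_def
  proof (rule L2_tendsto_dominated[where w = "\<lambda>_. 1 * (1 * B)"])
    show "(\<lambda>x. complex_of_real (\<psi> k x / omega x)) \<in> borel_measurable omega_measure" for k
      using square_integrable_test[OF test] unfolding square_integrable_def by blast
    show "(\<lambda>x. complex_of_real (- sin x * poly ?q (cos x))) \<in> borel_measurable omega_measure"
      by measurable
    fix x :: real assume x: "0 < x" "x < pi"
    show "cmod (complex_of_real (\<psi> k x / omega x)) \<le> 1 * (1 * B)" for k
      unfolding val[OF x] norm_of_real abs_mult
      using B cutoff_nonneg cutoff_le_one by (intro mult_mono) auto
    have "(\<lambda>k. cutoff k x * (- sin x * poly ?q (cos x))) \<longlonglongrightarrow> 1 * (- sin x * poly ?q (cos x))"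
      by (intro tendsto_intros cutoff_tendsto x)
    then show "(\<lambda>k. complex_of_real (\<psi> k x / omega x))
        \<longlonglongrightarrow> complex_of_real (- sin x * poly ?q (cos x))"
      unfolding val[OF x] by (intro tendsto_of_real) simp
  qed simp
  have lim2: "(\<lambda>n. over_omega (deriv (\<psi> n))) \<longlonglongrightarrow> cos_poly (gegenbauer_op (1/4) p)"
    unfolding over_omega_def cos_poly_def
  proof (rule L2_tendsto_dominated[where w = "\<lambda>_. 2 * B + 1 * C"])
    show "(\<lambda>x. complex_of_real (deriv (\<psi> k) x / omega x)) \<in> borel_measurable omega_measure" for k
      using square_integrable_test_deriv[OF test] unfolding square_integrable_def by blast
    fix x :: real assume x: "0 < x" "x < pi"
    show "cmod (complex_of_real (deriv (\<psi> k) x / omega x)) \<le> 2 * B + 1 * C" for k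
    proof -
      have "\<bar>(cutoff_deriv k x * sin x) * (- poly ?q (cos x))\<bar> \<le> 2 * B"
        unfolding abs_mult[of _ "- poly ?q (cos x)"]
        using B cutoff_deriv_bound[OF x] by (intro mult_mono) auto
      moreover have "\<bar>cutoff k x * poly (gegenbauer_op (1/4) p) (cos x)\<bar> \<le> 1 * C"
        unfolding abs_mult using C cutoff_nonneg cutoff_le_one by (intro mult_mono) auto
      ultimately show ?thesis
        unfolding dval[OF x] norm_of_real by linarith
    qed
    have "(\<lambda>k. (cutoff_deriv k x * sin x) * (- poly ?q (cos x)) +
        cutoff k x * poly (gegenbauer_op (1/4) p) (cos x)) \<longlonglongrightarrow>
      (0 * sin x) * (- poly ?q (cos x)) + 1 * poly (gegenbauer_op (1/4) p) (cos x)"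
      by (intro tendsto_intros cutoff_tendsto cutoff_deriv_tendsto x)
    then show "(\<lambda>k. complex_of_real (deriv (\<psi> k) x / omega x)) \<longlonglongrightarrow>
        complex_of_real (poly (gegenbauer_op (1/4) p) (cos x))"
      unfolding dval[OF x] by (intro tendsto_of_real) simp
  qed auto
  have "cinner h (over_omega (deriv (\<psi> n))) = - cinner d (over_omega (\<psi> n))" for n
    using hd test by (auto simp: weak_deriv_rel_def)
  then have "(\<lambda>n. - cinner d (over_omega (\<psi> n))) \<longlonglongrightarrow> cinner h (cos_poly (gegenbauer_op (1/4) p))"
    using tendsto_cinner[OF tendsto_const lim2, of h] by simp
  moreover have "(\<lambda>n. - cinner d (over_omega (\<psi> n))) \<longlonglongrightarrow> - cinner d (cos_poly_deriv p)"
    by (intro tendsto_minus tendsto_cinner tendsto_const lim1)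
  ultimately have "cinner h (cos_poly (gegenbauer_op (1/4) p)) = - cinner d (cos_poly_deriv p)"
    by (rule LIMSEQ_unique)
  then show ?thesis by simp
qed

abbreviation geg :: "nat \<Rightarrow> real poly" where "geg \<equiv> gegenbauer (1/4)"

definition eigenvalue :: "nat \<Rightarrow> real" where "eigenvalue n = real (2 * n * (2 * n + 1))"

lemma flux_gegenbauer:
  assumes "(h, d) \<in> weak_deriv_rel"
  shows "4 * cinner d (cos_poly_deriv (geg n))
      = complex_of_real (eigenvalue n) * cinner h (cos_poly (geg n))"
proof -
  have "eigenvalue n = 4 * (real n * (real n + 2 * (1/4)))"
    by (simp add: eigenvalue_def algebra_simps)
  then show ?thesis
    unfolding flux_integration_by_parts[OF assms] gegenbauer_ode cos_poly_smult cinner_scaleC_right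
    by simp
qed

text \<open>The form is symmetric, and the eigenvalues are distinct.\<close>

lemma orthogonal_gegenbauer:
  assumes "m \<noteq> n"
  shows "cinner (cos_poly (geg m)) (cos_poly (geg n)) = 0"
proof -
  have "complex_of_real (eigenvalue n) * cinner (cos_poly (geg m)) (cos_poly (geg n)) =
      4 * cinner (cos_poly_deriv (geg m)) (cos_poly_deriv (geg n))"
    by (rule flux_gegenbauer[OF cos_poly_weak_deriv, symmetric])
  also have "\<dots> = cnj (4 * cinner (cos_poly_deriv (geg n)) (cos_poly_deriv (geg m)))"
    by (simp flip: cinner_commute)
  also have "\<dots> = cnj (complex_of_real (eigenvalue m) * cinner (cos_poly (geg n)) (cos_poly (geg m)))"
    by (simp only: flux_gegenbauer[OF cos_poly_weak_deriv])
  also have "\<dots> = complex_of_real (eigenvalue m) * cinner (cos_poly (geg m)) (cos_poly (geg n))"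
    by (simp flip: cinner_commute)
  finally have "eigenvalue n = eigenvalue m \<or> cinner (cos_poly (geg m)) (cos_poly (geg n)) = 0"
    unfolding mult_cancel_right of_real_eq_iff by blast
  moreover have "eigenvalue n \<noteq> eigenvalue m"
  proof -
    have "strict_mono (\<lambda>n::nat. 2 * n * (2 * n + 1))"
      by (rule strict_monoI_Suc) simp
    then show ?thesis
      using assms strict_mono_eq[of "\<lambda>n::nat. 2 * n * (2 * n + 1)" n m]
      unfolding eigenvalue_def of_nat_eq_iff by blast
  qed
  ultimately show ?thesis by blast
qed

lemma cinner_cos_poly:
  "cinner (cos_poly p) (cos_poly q) = complex_of_real (\<integral>x. poly (p * q) (cos x) \<partial>omega_measure)"
  unfolding cos_poly_def cinner_L2_class[OF square_integrable_poly_cos square_integrable_poly_cos]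
  by (simp flip: of_real_mult)

section \<open>Norms of the Gegenbauer polynomials\<close>

definition gegenbauer_norm2 :: "nat \<Rightarrow> real" where
  "gegenbauer_norm2 n = (\<integral>x. poly (geg n * geg n) (cos x) \<partial>omega_measure)"

lemma cinner_gegenbauer: "cinner (cos_poly (geg m)) (cos_poly (geg n)) =
    (if m = n then complex_of_real (gegenbauer_norm2 n) else 0)"
  using orthogonal_gegenbauer[of m n] by (simp add: cinner_cos_poly gegenbauer_norm2_def)

text \<open>Both squared norms are compared with the integral \<open>c\<close> of \<open>x C\<^sub>n C\<^sub>n\<^sub>+\<^sub>1\<close>: the recurrence for
  \<open>C\<^sub>n\<^sub>+\<^sub>2\<close> tested against \<open>C\<^sub>n\<close> expresses \<open>c\<close> through the norm of \<open>C\<^sub>n\<close>, and the recurrence for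
  \<open>C\<^sub>n\<^sub>+\<^sub>1\<close> tested against \<open>C\<^sub>n\<^sub>+\<^sub>1\<close> expresses the norm of \<open>C\<^sub>n\<^sub>+\<^sub>1\<close> through \<open>c\<close>.\<close>

lemma gegenbauer_norm2_rec:
  "gegenbauer_norm2 (Suc n) =
    (real n + 1/4) * (real n + 1/2) / ((real n + 1) * (real n + 5/4)) * gegenbauer_norm2 n"
proof -
  define c where "c = (\<integral>x. poly ([:0, 1:] * (geg n * geg (Suc n))) (cos x) \<partial>omega_measure)"
  have c: "cinner (cos_poly ([:0, 1:] * geg n)) (cos_poly (geg (Suc n))) = complex_of_real c"
    "cinner (cos_poly ([:0, 1:] * geg (Suc n))) (cos_poly (geg n)) = complex_of_real c"
    by (simp_all only: cinner_cos_poly c_def mult_ac)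
  have "complex_of_real ((real n + 2) * 0) =
      cinner (cos_poly (smult (real n + 2) (geg (Suc (Suc n))))) (cos_poly (geg n))"
    by (simp only: cos_poly_smult cinner_scaleC_left cinner_gegenbauer) simp
  also have "\<dots> = complex_of_real (2 * (real n + 1 + 1/4) * c - (real n
      + 2 * (1/4)) * gegenbauer_norm2 n)"
    unfolding gegenbauer_recurrence cos_poly_diff cos_poly_smult cinner_diff_left cinner_scaleC_left c
    by (simp add: cinner_gegenbauer)
  finally have lower: "2 * (real n + 5/4) * c = (real n + 1/2) * gegenbauer_norm2 n"
    unfolding of_real_eq_iff by (simp add: algebra_simps)
  have upper: "(real n + 1) * gegenbauer_norm2 (Suc n) = 2 * (real n + 1/4) * c"
  proof (cases n)
    case 0
    have "[:0, 1:] * geg 0 = smult 2 (geg (Suc 0))" by simp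
    then have "cinner (cos_poly (smult 2 (geg (Suc 0)))) (cos_poly (geg (Suc 0)))
        = complex_of_real c"
      using c(1) by (simp only: 0)
    then have "complex_of_real (2 * gegenbauer_norm2 (Suc 0)) = complex_of_real c"
      by (simp only: cos_poly_smult cinner_scaleC_left cinner_gegenbauer) simp
    then show ?thesis unfolding of_real_eq_iff by (simp add: 0)
  next
    case (Suc m)
    have "complex_of_real ((real m + 2) * gegenbauer_norm2 (Suc n)) =
        cinner (cos_poly (smult (real m + 2) (geg (Suc (Suc m))))) (cos_poly (geg (Suc n)))"
      by (simp only: cos_poly_smult cinner_scaleC_left cinner_gegenbauer Suc) simp
    also have "\<dots> = complex_of_real (2 * (real m + 1 + 1/4) * c)"
      unfolding gegenbauer_recurrence cos_poly_diff cos_poly_smult cinner_diff_left cinner_scaleC_left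
      using c(1) by (simp add: cinner_gegenbauer Suc del: gegenbauer.simps)
    finally have "(real m + 2) * gegenbauer_norm2 (Suc n) = 2 * (real m + 1 + 1/4) * c"
      unfolding of_real_eq_iff .
    then show ?thesis by (simp add: Suc algebra_simps)
  qed
  have "c = (real n + 1/2) * gegenbauer_norm2 n / (2 * (real n + 5/4))"
    using lower by (simp add: field_simps)
  moreover have "gegenbauer_norm2 (Suc n) = 2 * (real n + 1/4) * c / (real n + 1)"
    using upper by (simp add: eq_divide_eq mult.commute)
  ultimately have "gegenbauer_norm2 (Suc n) =
      2 * (real n + 1/4) * ((real n + 1/2) * gegenbauer_norm2 n / (2 * (real n + 5/4))) / (real n + 1)"
    by (simp only:)
  also have "\<dots> = (real n + 1/4) * (real n
      + 1/2) / ((real n + 1) * (real n + 5/4)) * gegenbauer_norm2 n"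
    by (simp only: times_divide_eq_left times_divide_eq_right divide_divide_eq_left mult_ac
        mult_divide_mult_cancel_left_if) simp
  finally show ?thesis .
qed

lemma Gamma_real_plus1: "x > 0 \<Longrightarrow> Gamma (x + 1) = x * Gamma (x :: real)"
  by (intro Gamma_plus1) (auto elim!: nonpos_Ints_cases)

lemma h_const_rec:
  "h_const (Suc n) =
    (real n + 1/4) * (real n + 1/2) / ((real n + 1) * (real n + 5/4)) * h_const n"
proof -
  have "Gamma (real (Suc n) + 1/2) = (real n + 1/2) * Gamma (real n + 1/2)"
    using Gamma_real_plus1[of "real n + 1/2"] by (simp add: add_ac)
  moreover have "Gamma (real (Suc n) + 1) = (real n + 1) * Gamma (real n + 1)"
    using Gamma_real_plus1[of "real n + 1"] by (simp add: add_ac)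
  moreover have "real (Suc n) + 1/4 = real n + 5/4" by simp
  ultimately show ?thesis
    unfolding h_const_def by (simp only:) (simp add: divide_simps)
qed

lemma Gamma_quarter_reflection: "Gamma (1/4) * Gamma (3/4 :: real) = pi * sqrt 2"
proof -
  have three: "complex_of_real (3/4) = 1 - complex_of_real (1/4)"
    by (simp add: complex_eq_iff)
  have "complex_of_real (Gamma (1/4) * Gamma (3/4))
      = Gamma (complex_of_real (1/4)) * Gamma (complex_of_real (3/4))"
    by (simp only: Gamma_complex_of_real of_real_mult)
  also have "\<dots> = Gamma (complex_of_real (1/4)) * Gamma (1 - complex_of_real (1/4))"
    by (simp only: three)
  also have "\<dots> = of_real pi / sin (of_real pi * of_real (1/4))"
    by (rule Gamma_reflection_complex)
  also have "\<dots> = complex_of_real (pi / sin (pi * (1/4)))"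
    by (simp only: sin_of_real flip: of_real_divide of_real_mult)
  finally have "Gamma (1/4) * Gamma (3/4) = pi / sin (pi * (1/4))"
    unfolding of_real_eq_iff .
  also have "pi * (1/4) = pi / 4" by simp
  also have "pi / sin (pi / 4) = pi * (2 / sqrt 2)"
    by (simp add: sin_45)
  also have "2 / sqrt 2 = sqrt 2"
    by (simp add: real_div_sqrt)
  finally show ?thesis .
qed

text \<open>The substitution \<open>t = (1 - cos x) / 2\<close> satisfies \<open>t (1 - t) = (sin x / 2)\<^sup>2\<close> and \<open>dt = sin x
  / 2 dx\<close>, which turns the integral of the weight into a Beta integral.\<close>

lemma measure_omega: "measure omega_measure (space omega_measure) = sqrt 2 * Beta (3/4) (3/4)"
proof -
  define b where "b t = t powr (3/4 - 1) * (1 - t) powr (3/4 - 1)" for t :: real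
  define g where "g x = (1 - cos x) / 2" for x :: real
  have g: "g 0 = 0" "g pi = 1" by (simp_all add: g_def)
  have b_nonneg: "b t \<ge> 0" for t by (simp add: b_def)
  have [measurable]: "b \<in> borel_measurable borel" unfolding b_def by measurable
  have "((\<lambda>t. if t \<in> {0..1} then b t else 0) has_integral Beta (3/4) (3/4)) UNIV"
    using has_integral_Beta_real[of "3/4" "3/4"] by (simp only: b_def has_integral_restrict_UNIV)
  then have beta: "(\<integral>\<^sup>+t. ennreal (if t \<in> {0..1} then b t else 0) \<partial>lborel)
      = ennreal (Beta (3/4) (3/4))"
    by (intro nn_integral_has_integral_lborel) (auto simp: b_nonneg)
  have pullback: "sqrt 2 * (b (g x) * (sin x / 2)) = omega x" if x: "0 < x" "x < pi" for x
  proof -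
    have s: "sin x > 0" using sin_gt_zero[OF x] .
    have "(cos x)\<^sup>2 < 1"
      using zero_less_power[OF s, of 2] sin_cos_squared_add[of x] by linarith
    then have c: "\<bar>cos x\<bar> < 1"
      by (simp only: abs_square_less_1)
    have "b (g x) = (g x * (1 - g x)) powr (- (1/4))"
      unfolding b_def using c by (subst powr_mult[symmetric]) (auto simp: g_def)
    also have "g x * (1 - g x) = (sin x / 2)\<^sup>2"
      by (simp add: g_def power2_eq_square field_simps sin_squared_eq[of x, unfolded power2_eq_square])
    also have "\<dots> powr (- (1/4)) = (sin x / 2) powr (- (1/2))"
      using s by (simp add: powr_powr flip: powr_numeral)
    finally have "b (g x) * (sin x / 2) = (sin x / 2) powr (1/2)"
      using s powr_add[of "sin x / 2" "- (1/2)" 1] by simp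
    then show ?thesis
      using s by (simp add: powr_half_sqrt omega_def real_sqrt_divide)
  qed
  have "emeasure omega_measure (space omega_measure) =
      (\<integral>\<^sup>+x. ennreal (omega x) * indicator {0<..<pi} x \<partial>lborel)"
    unfolding omega_measure_def
    by (subst emeasure_density)
       (auto simp: space_restrict_space sets_restrict_space_iff nn_integral_restrict_space mult_ac
         intro!: nn_integral_cong split: split_indicator)
  also have "\<dots> = (\<integral>\<^sup>+x. ennreal (sqrt 2) * ennreal (b (g x) * (sin x / 2) * indicator {0..pi} x)
      \<partial>lborel)"
  proof (rule nn_integral_cong)
    fix x :: real
    show "ennreal (omega x) * indicator {0<..<pi} x =
        ennreal (sqrt 2) * ennreal (b (g x) * (sin x / 2) * indicator {0..pi} x)"
      using pullback[of x] by (cases "x = 0 \<or> x = pi")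
        (auto simp: indicator_def b_nonneg sin_ge_zero simp flip: ennreal_mult)
  qed
  also have "\<dots> = ennreal (sqrt 2) * (\<integral>\<^sup>+x. ennreal (b (g x) * (sin x / 2) * indicator {0..pi} x)
      \<partial>lborel)"
    unfolding g_def by (rule nn_integral_cmult) measurable
  also have "(\<integral>\<^sup>+x. ennreal (b (g x) * (sin x / 2) * indicator {0..pi} x) \<partial>lborel) =
      (\<integral>\<^sup>+t. ennreal (b t * indicator {g 0..g pi} t) \<partial>lborel)"
  proof (rule nn_integral_substitution[symmetric])
    show "(g has_real_derivative sin x / 2) (at x)" for x
      unfolding g_def by (auto intro!: derivative_eq_intros)
    show "set_borel_measurable borel {g 0..g pi} b"
      unfolding set_borel_measurable_def by measurable
    show "continuous_on {0..pi} (\<lambda>x. sin x / 2)" by (intro continuous_intros) auto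
  qed (auto simp: sin_ge_zero)
  also have "\<dots> = ennreal (Beta (3/4) (3/4))"
    unfolding beta[symmetric] by (intro nn_integral_cong) (auto simp: g indicator_def)
  finally show ?thesis
    by (simp add: measure_def Beta_def flip: ennreal_mult)
qed

text \<open>The reflection formula trades \<open>Gamma (3/4)\<close> for \<open>Gamma (1/4)\<close>.\<close>

lemma gegenbauer_norm2_0: "gegenbauer_norm2 0 = h_const 0"
proof -
  have "0 < Gamma (1/4 :: real)"
    by (rule Gamma_real_pos) simp
  then have quarter: "Gamma (1/4 :: real) \<noteq> 0"
    by (metis less_irrefl)
  have "gegenbauer_norm2 0 = sqrt 2 * Beta (3/4) (3/4)"
    using measure_omega by (simp add: gegenbauer_norm2_def)
  also have "\<dots> = sqrt 2 * (Gamma (3/4))\<^sup>2 / Gamma (1/2 + 1)"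
    by (simp add: Beta_def power2_eq_square)
  also have "Gamma (1/2 + 1) = 1/2 * sqrt pi"
    by (subst Gamma_real_plus1) (simp_all add: Gamma_one_half_real)
  also have "Gamma (3/4) = pi * sqrt 2 / Gamma (1/4 :: real)"
    using Gamma_quarter_reflection by (simp add: eq_divide_eq quarter mult.commute)
  also have "sqrt 2 * (pi * sqrt 2 / Gamma (1/4))\<^sup>2 / (1/2 * sqrt pi) =
      4 * sqrt 2 * pi * (pi / sqrt pi) / (Gamma (1/4))\<^sup>2"
    by (simp add: power_divide power_mult_distrib) (simp add: power2_eq_square mult_ac)
  also have "pi / sqrt pi = sqrt pi"
    by (simp add: real_div_sqrt)
  also have "4 * sqrt 2 * pi * sqrt pi / (Gamma (1/4))\<^sup>2 = h_const 0"
    by (simp add: h_const_def Gamma_one_half_real)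
  finally show ?thesis .
qed

lemma gegenbauer_norm2_eq: "gegenbauer_norm2 n = h_const n"
  by (induction n) (simp_all only: gegenbauer_norm2_0 gegenbauer_norm2_rec h_const_rec)

lemma h_const_pos: "h_const n > 0"
  unfolding h_const_def by (intro divide_pos_pos mult_pos_pos Gamma_real_pos zero_less_power) auto

section \<open>The eigenfunction basis and the operators\<close>

definition Phi_coeff :: "nat \<Rightarrow> real" where
  "Phi_coeff n = h_const n powr (- (1/2))"

lemma Phi_eq: "Phi n = complex_of_real (Phi_coeff n) *\<^sub>C cos_poly (geg n)"
  by (simp add: Phi_def cos_poly_def Phi_coeff_def L2_class_scaleC square_integrable_poly_cos)

lemma Phi_coeff_square: "Phi_coeff n * Phi_coeff n * h_const n = 1"
proof -
  have "Phi_coeff n * Phi_coeff n = h_const n powr (-1)"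
    by (simp add: Phi_coeff_def flip: powr_add)
  then show ?thesis
    using h_const_pos[of n] by (simp add: powr_minus)
qed

lemma Phi_coeff_nonzero: "Phi_coeff n \<noteq> 0"
  using Phi_coeff_square[of n] by auto

lemma orthonormal_basis_Phi: "orthonormal_basis Phi"
  unfolding orthonormal_basis_def
proof (intro conjI allI)
  fix m n
  have "complex_of_real (Phi_coeff n * Phi_coeff n * h_const n) = 1"
    by (simp only: Phi_coeff_square of_real_1)
  then show "cinner (Phi m) (Phi n) = (if m = n then 1 else 0)"
    by (simp add: Phi_eq cinner_scaleC_left cinner_scaleC_right cinner_gegenbauer gegenbauer_norm2_eq mult.assoc)
next
  have "cos_poly (geg n) \<in> cspan (range Phi)" for n
  proof -
    have "cos_poly (geg n) = complex_of_real (1 / Phi_coeff n) *\<^sub>C Phi n"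
      using Phi_coeff_nonzero[of n]
          by (simp add: Phi_eq scaleC_scaleC scaleC_one flip: of_real_mult)
    then show ?thesis
      by (simp only:) (intro complex_vector.span_scale complex_vector.span_base rangeI)
  qed
  then have "cspan (range (\<lambda>n. cos_poly (geg n))) \<subseteq> cspan (range Phi)"
    by (intro complex_vector.span_minimal complex_vector.subspace_span) auto
  then have "closure (cspan (range cos_poly)) \<subseteq> closure (cspan (range Phi))"
    unfolding cspan_gegenbauer[of "1/4", simplified] by (rule closure_mono)
  then show "closure (cspan (range Phi)) = UNIV"
    using cos_poly_dense by auto
qed

definition Phi_deriv :: "nat \<Rightarrow> weighted_L2" where
  "Phi_deriv n = complex_of_real (Phi_coeff n) *\<^sub>C cos_poly_deriv (geg n)"

lemma Phi_weak_deriv: "(Phi n, Phi_deriv n) \<in> weak_deriv_rel"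
  unfolding Phi_eq Phi_deriv_def by (intro weak_deriv_rel_scaleC cos_poly_weak_deriv)

lemma flux_Phi:
  assumes "(h, d) \<in> weak_deriv_rel"
  shows "4 * cinner d (Phi_deriv n) = complex_of_real (eigenvalue n) * cinner h (Phi n)"
  using flux_gegenbauer[OF assms, of n]
  by (simp add: Phi_eq Phi_deriv_def cinner_scaleC_right mult_ac)

text \<open>Integration by parts against the eigenfunctions determines the coefficients of \<open>g\<close> for \<open>(f,
  g) \<in> A0\<close>. Conversely, if the coefficients are related in this way, then the weak derivatives \<open>t
  N\<close> of the partial sums \<open>s N\<close> of \<open>f\<close> satisfy \<open>4 \<parallel>t M - t N\<parallel>\<^sup>2 \<le> \<parallel>w M - w N\<parallel> \<parallel>s M - s N\<parallel>\<close> with the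
  partial sums \<open>w N\<close> of \<open>g\<close>. So they form a Cauchy sequence, and closedness of the weak derivative
  puts \<open>f\<close> into the form domain.\<close>

lemma A0_eq_diagonal: "A0 = diagonal_operator Phi eigenvalue"
proof (intro subset_antisym subrelI)
  fix f g assume fg: "(f, g) \<in> A0"
  then obtain d where d: "(f, d) \<in> weak_deriv_rel"
    using form_domainE by (auto simp: A0_def)
  have "cinner g (Phi n) = complex_of_real (eigenvalue n) * cinner f (Phi n)" for n
    using A0_iff[OF d] fg Phi_weak_deriv[of n] flux_Phi[OF d, of n] by fastforce
  then show "(f, g) \<in> diagonal_operator Phi eigenvalue"
    by (simp add: diagonal_operator_def)
next
  fix f g assume fg: "(f, g) \<in> diagonal_operator Phi eigenvalue"
  define s where "s = fourier_sum Phi f"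
  define w where "w = fourier_sum Phi g"
  define t where "t N = (\<Sum>n<N. cinner f (Phi n) *\<^sub>C Phi_deriv n)" for N
  have s: "s \<longlonglongrightarrow> f" and w: "w \<longlonglongrightarrow> g"
    unfolding s_def w_def by (rule fourier_sum_tendsto[OF orthonormal_basis_Phi])+
  have st: "(s N, t N) \<in> weak_deriv_rel" for N
  proof (induction N)
    case 0
    show ?case by (simp add: s_def t_def fourier_sum_def weak_deriv_rel_def)
  next
    case (Suc N)
    then have "(s N + cinner f (Phi N) *\<^sub>C Phi N, t N + cinner f (Phi N) *\<^sub>C Phi_deriv N)
        \<in> weak_deriv_rel"
      by (intro weak_deriv_rel_add weak_deriv_rel_scaleC Phi_weak_deriv)
    then show ?case by (simp add: s_def t_def fourier_sum_def)
  qed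
  have weak: "4 * cinner (t N) k = cinner (w N) h" if hk: "(h, k) \<in> weak_deriv_rel" for N h k
  proof -
    have "4 * cinner (Phi_deriv n) k = complex_of_real (eigenvalue n) * cinner (Phi n) h" for n
      using arg_cong[OF flux_Phi[OF hk, of n], of cnj]
      by (simp flip: cinner_commute)
    moreover have "cinner g (Phi n) = complex_of_real (eigenvalue n) * cinner f (Phi n)" for n
      using fg by (simp add: diagonal_operator_def)
    ultimately have "cinner f (Phi n) * (4 * cinner (Phi_deriv n) k)
        = cinner g (Phi n) * cinner (Phi n) h" for n
      by simp
    then show ?thesis
      by (simp add: t_def w_def fourier_sum_def cinner_sum_left cinner_scaleC_left sum_distrib_left
          mult.left_commute[of 4])
  qed
  have bound: "4 * (norm (t M - t N))\<^sup>2 \<le> norm (w M - w N) * norm (s M - s N)" for M N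
  proof -
    have "(s M - s N, t M - t N) \<in> weak_deriv_rel"
      by (intro weak_deriv_rel_diff st)
    from weak[OF this, of M] weak[OF this, of N]
    have "cinner (w M - w N) (s M - s N) = 4 * cinner (t M - t N) (t M - t N)"
      by (simp only: cinner_diff_left right_diff_distrib)
    then have "cmod (cinner (w M - w N) (s M - s N)) = 4 * (norm (t M - t N))\<^sup>2"
      by (simp add: cinner_self norm_mult norm_power)
    then show ?thesis
      using norm_cinner_le[of "w M - w N" "s M - s N"] by simp
  qed
  have "Cauchy t"
  proof (rule metric_CauchyI)
    fix e :: real assume "e > 0"
    obtain M1 where M1: "\<And>m n. m \<ge> M1 \<Longrightarrow> n \<ge> M1 \<Longrightarrow> norm (s m - s n) < e"
      using CauchyD[OF LIMSEQ_imp_Cauchy[OF s] \<open>e > 0\<close>] by blast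
    obtain M2 where M2: "\<And>m n. m \<ge> M2 \<Longrightarrow> n \<ge> M2 \<Longrightarrow> norm (w m - w n) < e"
      using CauchyD[OF LIMSEQ_imp_Cauchy[OF w] \<open>e > 0\<close>] by blast
    have "dist (t m) (t n) < e" if "m \<ge> max M1 M2" "n \<ge> max M1 M2" for m n
    proof -
      have "norm (w m - w n) * norm (s m - s n) \<le> e * e"
        using M1[of m n] M2[of m n] that \<open>e > 0\<close> by (intro mult_mono) auto
      then have "4 * (norm (t m - t n))\<^sup>2 \<le> e\<^sup>2"
        using bound[of m n] by (simp add: power2_eq_square)
      moreover have "0 < e\<^sup>2" using \<open>e > 0\<close> by simp
      ultimately have "(norm (t m - t n))\<^sup>2 < e\<^sup>2"
        by linarith
      then show ?thesis
        using \<open>e > 0\<close> by (simp add: dist_norm power_less_imp_less_base)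
    qed
    then show "\<exists>M. \<forall>m\<ge>M. \<forall>n\<ge>M. dist (t m) (t n) < e" by blast
  qed
  then obtain d where d: "t \<longlonglongrightarrow> d"
    using Cauchy_convergent convergent_def by blast
  have fd: "(f, d) \<in> weak_deriv_rel"
    by (rule weak_deriv_rel_closed[OF st s d])
  have "4 * cinner d k = cinner g h" if hk: "(h, k) \<in> weak_deriv_rel" for h k
  proof (rule LIMSEQ_unique)
    show "(\<lambda>N. 4 * cinner (t N) k) \<longlonglongrightarrow> 4 * cinner d k"
      by (intro tendsto_mult tendsto_cinner tendsto_const d)
    show "(\<lambda>N. 4 * cinner (t N) k) \<longlonglongrightarrow> cinner g h"
      unfolding weak[OF hk] by (intro tendsto_cinner tendsto_const w)
  qed
  then show "(f, g) \<in> A0"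
    using A0_iff[OF fd] by blast
qed

text \<open>\<open>2 n (2 n + 1) + 1/4\<close> is the square of the positive number \<open>2 n + 1/2\<close>.\<close>

lemma T_op_eq_diagonal: "T_op = diagonal_operator Phi (\<lambda>n. real (2 * n))"
proof -
  have "add_scalar_operator A0 (1/4) = diagonal_operator Phi (\<lambda>n. (real (2 * n) + 1/2)\<^sup>2)"
  proof -
    have "(\<lambda>n. eigenvalue n + 1/4) = (\<lambda>n. (real (2 * n) + 1/2)\<^sup>2)"
      by (simp add: eigenvalue_def fun_eq_iff power2_eq_square algebra_simps)
    then show ?thesis
      using add_scalar_diagonal[of Phi eigenvalue "1/4"] by (simp add: A0_eq_diagonal)
  qed
  then have "sqrt_operator (add_scalar_operator A0 (1/4))
      = diagonal_operator Phi (\<lambda>n. real (2 * n) + 1/2)"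
    using sqrt_diagonal[OF orthonormal_basis_Phi, of "\<lambda>n. real (2 * n) + 1/2"] by simp
  then show ?thesis
    using add_scalar_diagonal[of Phi "\<lambda>n. real (2 * n) + 1/2" "- (1/2)"] by (simp add: T_op_def)
qed

theorem proposition4p2:
  shows "orthonormal_basis Phi \<and>
    (\<forall>n. A0 `` {Phi n} = {of_nat (2 * n * (2 * n + 1)) *\<^sub>C Phi n}) \<and>
    (\<forall>n. T_op `` {Phi n} = {of_nat (2 * n) *\<^sub>C Phi n})"
proof (intro conjI allI)
  show "orthonormal_basis Phi" by (rule orthonormal_basis_Phi)
  show "A0 `` {Phi n} = {of_nat (2 * n * (2 * n + 1)) *\<^sub>C Phi n}" for n
    unfolding A0_eq_diagonal diagonal_image_basis[OF orthonormal_basis_Phi] eigenvalue_def of_real_of_nat_eq ..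
  show "T_op `` {Phi n} = {of_nat (2 * n) *\<^sub>C Phi n}" for n
    unfolding T_op_eq_diagonal diagonal_image_basis[OF orthonormal_basis_Phi] of_real_of_nat_eq ..
qed

end
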